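(* Let $\psi$ be a modified ruin probability for the mixed-Poisson Cramér-Lundberg model described in the context. Assume that $0<\ell_1<c/\mu$, that $p_1:=G(\{\ell_1\})>0$, and that $$\psi_{\rm cl}(u,\ell_1)\sim c_{\ell_1}e^{-R_{\ell_1}u},\qquad u\to\infty,$$ for some constants $c_{\ell_1},R_{\ell_1}>0$. In addition, assume that for every $\ell\in(0,\ell_1)$ there exists $R_\ell>R_{\ell_1}$ such that $$\psi_{\rm cl}(u,\ell)\le e^{-R_\ell u},\qquad u\ge0.$$ If $\psi$ is continuous or monotone on $(-\infty,0)$, then $$\psi(u)\sim C_{\ell_1}\,\psi_{\rm cl}(u),\qquad u\to\infty,$$ where $$C_{\ell_1}:=\int_{(-\infty,0)}\psi(y)\,\nu_{\ell_1}(\mathrm{d}y)$$ and $\nu_{\ell_1}$ is the probability measure on $(-\infty,0)$ determined by $$\nu_{\ell_1}((-\infty,-x])=\frac{1}{c-\ell_1\mu}\left(ce^{-R_{\ell_1}x}-\ell_1\int_0^x e^{-R_{\ell_1}(x-z)}\bar F(z)\,\mathrm{d}z-\ell_1\int_x^{\infty}\bar F(z)\,\mathrm{d}z\right),\qquad x\ge0.$$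
   Context: Model. For initial capital $u$ and premium rate $c>0$, let $U_t=u+ct-\sum_{i=1}^{N_t}X_i$, $t\ge0$, under the probability $\mathbb{P}_u$. The claim sizes $X_1,X_2,\dots$ are i.i.d. positive random variables with distribution function $F$, tail $\bar F=1-F$ and finite mean $\mu=\mathbb{E}[X_1]$. The claim number process $(N_t)_{t\ge0}$ is a mixed Poisson process with nonnegative mixing variable $\Lambda$ having distribution function $G$ (conditionally on $\Lambda=\ell$, it is a homogeneous Poisson process of rate $\ell$), and it is independent of the claim sizes. Put $\ell_1:=\inf\{\ell\ge0:G(\ell)=1\}$; $G(\{\ell_1\})$ denotes the mass $\mathbb{P}(\Lambda=\ell_1)$. Classical ruin. The ruin time is $T:=\inf\{t>0:U_t<0\}$. For fixed intensity $\ell$, $\psi_{\rm cl}(u,\ell):=\mathbb{P}_u(T<\infty\mid\Lambda=\ell)$, with the convention $\psi_{\rm cl}(u,\ell)=1$ when $\ell\mu\ge c$; here conditioning on $\Lambda=\ell$ means that the claim number process is Poisson with rate $\ell$. The mixed-Poisson classical ruin probability is $\psi_{\rm cl}(u):=\int_{[0,\infty)}\psi_{\rm cl}(u,\ell)\,G(\mathrm{d}\ell)$. Modified ruin. A modified ruin probability is a measurable function $\psi:\mathbb{R}\to[0,1]$ such that $$\psi(u)=\int_{(-\infty,0)}\psi(y)\,\mathbb{P}_u(U_T\in \mathrm{d}y,\,T<\infty),\qquad u\ge0.$$ Notation. $f(u)\sim g(u)$ as $u\to\infty$ means $f(u)=(1+o(1))g(u)$. *)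

theory Defs
  imports "HOL-Probability.Probability" "HOL-Library.Landau_Symbols"
begin

text \<open>
  Paths are required to be regular at every point of the sample space, so that the ruin time is
  measurable without completing the probability space. Continuity is with respect to the discrete
  topology of \<^typ>\<open>nat\<close>; only times \<^term>\<open>t \<ge> 0\<close> matter.
\<close>

definition counting_process :: "'a measure \<Rightarrow> (real \<Rightarrow> 'a \<Rightarrow> nat) \<Rightarrow> bool" where
  "counting_process M N \<longleftrightarrow>
     (\<forall>t\<ge>0. N t \<in> measurable M (count_space UNIV)) \<and>
     (\<forall>\<omega>\<in>space M. N 0 \<omega> = 0 \<and> mono_on {0..} (\<lambda>t. N t \<omega>) \<and>
        (\<forall>t\<ge>0. continuous (at_right t) (\<lambda>s. N s \<omega>)))"

definition time_grid :: "nat \<Rightarrow> (nat \<Rightarrow> real) \<Rightarrow> bool" where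
  "time_grid n t \<longleftrightarrow> 0 \<le> t 0 \<and> (\<forall>i<n. t i \<le> t (Suc i))"

text \<open>
  The Poisson weights are written out because \<^const>\<open>poisson_pmf\<close> is only specified for positive
  rates, whereas rate 0 (unit mass at 0, as \<^prop>\<open>0 ^ 0 = (1::real)\<close>) is needed here.
\<close>

definition poisson_increments :: "real \<Rightarrow> nat \<Rightarrow> (nat \<Rightarrow> real) \<Rightarrow> (nat \<Rightarrow> nat) \<Rightarrow> real" where
  "poisson_increments l n t k =
     (\<Prod>i<n. (l * (t (Suc i) - t i)) ^ k i / fact (k i) * exp (- (l * (t (Suc i) - t i))))"

definition poisson_process :: "'a measure \<Rightarrow> real \<Rightarrow> (real \<Rightarrow> 'a \<Rightarrow> nat) \<Rightarrow> bool" where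
  "poisson_process M l N \<longleftrightarrow>
     counting_process M N \<and>
     (\<forall>n t k. time_grid n t \<longrightarrow>
        measure M {\<omega>\<in>space M. \<forall>i<n. N (t (Suc i)) \<omega> = N (t i) \<omega> + k i}
          = poisson_increments l n t k)"

text \<open>
  Conditionally on \<^term>\<open>\<Lambda> = l\<close> the increments have the law of a Poisson process of rate \<^term>\<open>l\<close>;
  the conditional law is expressed by integrating over Borel sets of values of \<^term>\<open>\<Lambda>\<close>.
\<close>

definition mixed_poisson_process ::
    "'a measure \<Rightarrow> ('a \<Rightarrow> real) \<Rightarrow> (real \<Rightarrow> 'a \<Rightarrow> nat) \<Rightarrow> bool" where
  "mixed_poisson_process M \<Lambda> N \<longleftrightarrow>
     counting_process M N \<and>
     \<Lambda> \<in> borel_measurable M \<and> (AE \<omega> in M. 0 \<le> \<Lambda> \<omega>) \<and>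
     (\<forall>B\<in>sets borel. \<forall>n t k. time_grid n t \<longrightarrow>
        measure M {\<omega>\<in>space M. \<Lambda> \<omega> \<in> B \<and> (\<forall>i<n. N (t (Suc i)) \<omega> = N (t i) \<omega> + k i)}
          = (LINT l:B|distr M borel \<Lambda>. poisson_increments l n t k))"

text \<open>The claims \<open>X\<^sub>1, X\<^sub>2, \<dots>\<close> are indexed from 0.\<close>

definition claim_sizes :: "'a measure \<Rightarrow> (real \<Rightarrow> real) \<Rightarrow> (nat \<Rightarrow> 'a \<Rightarrow> real) \<Rightarrow> bool" where
  "claim_sizes M F X \<longleftrightarrow>
     prob_space.indep_vars M (\<lambda>_. borel) X UNIV \<and>
     (\<forall>i. cdf (distr M borel (X i)) = F) \<and>
     (\<forall>i. AE \<omega> in M. 0 < X i \<omega>)"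

definition independent_of_claims ::
    "'a measure \<Rightarrow> (real \<Rightarrow> 'a \<Rightarrow> nat) \<Rightarrow> (nat \<Rightarrow> 'a \<Rightarrow> real) \<Rightarrow> bool" where
  "independent_of_claims M N X \<longleftrightarrow>
     prob_space.indep_set M
       (sigma_sets (space M) {N t -` A \<inter> space M | t A. 0 \<le> t})
       (sigma_sets (space M) {X i -` A \<inter> space M | i A. A \<in> sets borel})"

definition poisson_model ::
    "'a measure \<Rightarrow> real \<Rightarrow> (real \<Rightarrow> real) \<Rightarrow> (real \<Rightarrow> 'a \<Rightarrow> nat) \<Rightarrow> (nat \<Rightarrow> 'a \<Rightarrow> real) \<Rightarrow> bool" where
  "poisson_model M l F N X \<longleftrightarrow>
     prob_space M \<and> claim_sizes M F X \<and> poisson_process M l N \<and> independent_of_claims M N X"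

definition mixed_poisson_model ::
    "'a measure \<Rightarrow> ('a \<Rightarrow> real) \<Rightarrow> (real \<Rightarrow> real) \<Rightarrow> (real \<Rightarrow> 'a \<Rightarrow> nat) \<Rightarrow> (nat \<Rightarrow> 'a \<Rightarrow> real)
       \<Rightarrow> bool" where
  "mixed_poisson_model M \<Lambda> F N X \<longleftrightarrow>
     prob_space M \<and> claim_sizes M F X \<and> mixed_poisson_process M \<Lambda> N \<and>
     independent_of_claims M N X"

definition surplus ::
    "real \<Rightarrow> (real \<Rightarrow> 'a \<Rightarrow> nat) \<Rightarrow> (nat \<Rightarrow> 'a \<Rightarrow> real) \<Rightarrow> real \<Rightarrow> real \<Rightarrow> 'a \<Rightarrow> real" where
  "surplus c N X u t \<omega> = u + c * t - (\<Sum>i<N t \<omega>. X i \<omega>)"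

definition ruin_time ::
    "real \<Rightarrow> (real \<Rightarrow> 'a \<Rightarrow> nat) \<Rightarrow> (nat \<Rightarrow> 'a \<Rightarrow> real) \<Rightarrow> real \<Rightarrow> 'a \<Rightarrow> ereal" where
  "ruin_time c N X u \<omega> = Inf (ereal ` {t. 0 < t \<and> surplus c N X u t \<omega> < 0})"

definition ruin_event ::
    "'a measure \<Rightarrow> real \<Rightarrow> (real \<Rightarrow> 'a \<Rightarrow> nat) \<Rightarrow> (nat \<Rightarrow> 'a \<Rightarrow> real) \<Rightarrow> real \<Rightarrow> 'a set" where
  "ruin_event M c N X u = {\<omega>\<in>space M. ruin_time c N X u \<omega> < \<infinity>}"

text \<open>The (sub-probability) law \<open>P\<^sub>u(U\<^sub>T \<in> dy, T < \<infinity>)\<close>.\<close>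

definition deficit_law ::
    "'a measure \<Rightarrow> real \<Rightarrow> (real \<Rightarrow> 'a \<Rightarrow> nat) \<Rightarrow> (nat \<Rightarrow> 'a \<Rightarrow> real) \<Rightarrow> real \<Rightarrow> real measure" where
  "deficit_law M c N X u =
     distr (restrict_space M (ruin_event M c N X u)) borel
       (\<lambda>\<omega>. surplus c N X u (real_of_ereal (ruin_time c N X u \<omega>)) \<omega>)"

definition modified_ruin_probability ::
    "'a measure \<Rightarrow> real \<Rightarrow> (real \<Rightarrow> 'a \<Rightarrow> nat) \<Rightarrow> (nat \<Rightarrow> 'a \<Rightarrow> real) \<Rightarrow> (real \<Rightarrow> real) \<Rightarrow> bool" where
  "modified_ruin_probability M c N X \<psi> \<longleftrightarrow>
     \<psi> \<in> borel_measurable borel \<and> (\<forall>u. 0 \<le> \<psi> u \<and> \<psi> u \<le> 1) \<and>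
     (\<forall>u\<ge>0. \<psi> u = (LINT y:{..<0}|deficit_law M c N X u. \<psi> y))"

text \<open>
  \<open>P\<^sub>u(\<cdot> | \<Lambda> = l)\<close> is represented by a family \<^term>\<open>Q\<close> of probability spaces: \<^term>\<open>Q l\<close> carries
  a claim number process \<^term>\<open>K l\<close> and claims \<^term>\<open>Y l\<close>, intended to form a
  \<^const>\<open>poisson_model\<close> of rate \<^term>\<open>l\<close>. The ruin probability only depends on the law of the model.
\<close>

definition psi_cl_given ::
    "(real \<Rightarrow> 'b measure) \<Rightarrow> (real \<Rightarrow> real \<Rightarrow> 'b \<Rightarrow> nat) \<Rightarrow> (real \<Rightarrow> nat \<Rightarrow> 'b \<Rightarrow> real)
       \<Rightarrow> real \<Rightarrow> real \<Rightarrow> real \<Rightarrow> real \<Rightarrow> real" where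
  "psi_cl_given Q K Y c \<mu> u l =
     (if l * \<mu> \<ge> c then 1 else measure (Q l) (ruin_event (Q l) c (K l) (Y l) u))"

definition psi_cl ::
    "(real \<Rightarrow> 'b measure) \<Rightarrow> (real \<Rightarrow> real \<Rightarrow> 'b \<Rightarrow> nat) \<Rightarrow> (real \<Rightarrow> nat \<Rightarrow> 'b \<Rightarrow> real)
       \<Rightarrow> real \<Rightarrow> real \<Rightarrow> real measure \<Rightarrow> real \<Rightarrow> real" where
  "psi_cl Q K Y c \<mu> G u = (LINT l:{0..}|G. psi_cl_given Q K Y c \<mu> u l)"

definition limit_deficit_measure ::
    "real \<Rightarrow> real \<Rightarrow> (real \<Rightarrow> real) \<Rightarrow> real \<Rightarrow> real \<Rightarrow> real measure \<Rightarrow> bool" where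
  "limit_deficit_measure c \<mu> F l R \<nu> \<longleftrightarrow>
     prob_space \<nu> \<and> sets \<nu> = sets (restrict_space borel {..<0}) \<and>
     (\<forall>x\<ge>0. measure \<nu> ({..- x} \<inter> {..<0}) =
        1 / (c - l * \<mu>) *
        (c * exp (- R * x)
         - l * (LINT z:{0..x}|lborel. exp (- R * (x - z)) * (1 - F z))
         - l * (LINT z:{x..}|lborel. 1 - F z)))"

end

theory Submission
  imports Defs
begin

text \<open>
  Let \<open>H\<^sub>l(u, y)\<close> be the probability, at rate \<open>l\<close> and initial capital \<open>u\<close>, of ruin with a deficit larger
  than \<open>y\<close>. Conditioning on the number of claims in a short interval \<open>[0, h]\<close> shows that \<open>H\<^sub>l\<close> is
  Lipschitz in \<open>u\<close> and, integrating its right derivative, that \<open>H\<^sub>l(\<cdot>, y)\<close> solves the defective renewal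
  equation with kernel \<open>k(z) = (l / c) (1 - F(z))\<close>. Bounded solutions being unique, \<open>H\<^sub>l\<close> can be written in terms of
  \<open>\<psi>\<^sub>l = H\<^sub>l(\<cdot>, 0)\<close>, with \<open>\<rho> = l \<mu> / c\<close>:

  \<open>(1 - \<rho>) H\<^sub>l(u, y) = \<psi>\<^sub>l(u + y) - \<psi>\<^sub>l(u) \<integral>\<^bsub>[y, \<infinity>)\<^esub> k(z) dz - \<integral>\<^bsub>[0, y]\<^esub> k(z) \<psi>\<^sub>l(u + y - z) dz\<close>.

  At \<open>l = l\<^sub>1\<close> the exponential asymptotics of \<open>\<psi>\<^sub>l\<close> turn the right hand side, after division by
  \<open>\<psi>\<^sub>l(u)\<close>, into the tail of the limiting measure. The deficit probabilities of the mixed model are averages of the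
  \<open>H\<^sub>l\<close>, in which the rates below \<open>l\<^sub>1\<close> are negligible, so the law of the deficit given ruin converges weakly to
  a law without atoms. Since \<open>\<psi>\<close> is continuous almost everywhere with respect to it, the integrals of \<open>\<psi>\<close>
  converge as well. If the limit constant vanishes, then \<open>\<psi>\<close> is zero on the range of the deficits, hence on
  \<open>[0, \<infinity>)\<close>.
\<close>

section \<open>Sample paths and their restriction to a grid\<close>

text \<open>The models are specified by the joint laws of finitely many increments, and the spaces
  \<open>Q l\<close> are related to one another and to \<open>M\<close> only through these laws.
  Every statement about whole paths therefore passes through one device: path by path, the fall
  event eventually agrees with an event on a finite grid, and the probability of a grid event is an
  explicit function of the rate. The same limit yields both the mixture formula over the rates and
  the Markov property at a fixed rate. Integrating the right derivative leaves the value at capital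
  0 undetermined; the assumed decay of the ruin probabilities supplies it. The exponent
  \<open>R1\<close> enters through the assumed asymptotics alone, so nonnegativity and monotonicity
  of the limiting tail are inherited from the probabilities converging to it. A vanishing constant
  has to be treated apart because asymptotic equivalence to 0 means eventual equality, which no
  convergence of ratios can give.\<close>

definition regular_path :: "(real \<Rightarrow> nat) \<Rightarrow> bool" where
  "regular_path n \<longleftrightarrow>
     n 0 = 0 \<and> mono_on {0..} n \<and> (\<forall>t\<ge>0. continuous (at_right t) n)"

definition level :: "real \<Rightarrow> (real \<Rightarrow> nat) \<Rightarrow> (nat \<Rightarrow> real) \<Rightarrow> real \<Rightarrow> real \<Rightarrow> real" where
  "level c n x u t = u + c * t - (\<Sum>i<n t. x i)"

text \<open>For nonnegative \<open>y\<close> at most one \<open>t\<close> qualifies, namely the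
  first time of negative surplus. Quantifying over \<open>t\<close> expresses the size of the
  deficit without evaluating the path at an infimum, and the same shape makes sense on a
  grid.\<close>

definition falls_below ::
    "real \<Rightarrow> (real \<Rightarrow> nat) \<Rightarrow> (nat \<Rightarrow> real) \<Rightarrow> real \<Rightarrow> real \<Rightarrow> bool" where
  "falls_below c n x u y \<longleftrightarrow>
     (\<exists>t\<ge>0. level c n x u t < - y \<and> (\<forall>s. 0 \<le> s \<longrightarrow> s < t \<longrightarrow> 0 \<le> level c n x u s))"

text \<open>Here \<open>s k\<close> is the number of claims up to the grid point
  \<open>d * real k\<close>; for fixed \<open>s\<close> the predicate is a condition on finitely
  many claims.\<close>

definition grid_falls_below ::
    "real \<Rightarrow> real \<Rightarrow> nat \<Rightarrow> (nat \<Rightarrow> nat) \<Rightarrow> (nat \<Rightarrow> real) \<Rightarrow> real \<Rightarrow> real \<Rightarrow> bool" where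
  "grid_falls_below c d K s x u y \<longleftrightarrow>
     (\<exists>k\<le>K. u + c * (d * real k) - (\<Sum>i<s k. x i) < - y \<and>
        (\<forall>j<k. 0 \<le> u + c * (d * real j) - (\<Sum>i<s j. x i)))"

lemma sum_lessThan_add:
  fixes f :: "nat \<Rightarrow> 'a::comm_monoid_add"
  shows "(\<Sum>i<a + b. f i) = (\<Sum>i<a. f i) + (\<Sum>i<b. f (a + i))"
  by (induction b) (simp_all add: add.assoc)

lemma level_eq_surplus: "surplus c N X u t \<omega> = level c (\<lambda>t. N t \<omega>) (\<lambda>i. X i \<omega>) u t"
  by (simp add: surplus_def level_def)

text \<open>Convergence in a discrete space is eventual equality, so right continuity gives an
  interval of constancy.\<close>

lemma regular_path_right_constant:
  assumes "regular_path n" "0 \<le> t"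
  obtains e where "e > 0" "\<And>s. t \<le> s \<Longrightarrow> s < t + e \<Longrightarrow> n s = n t"
proof -
  have "(n \<longlongrightarrow> n t) (at_right t)"
    using assms by (simp add: regular_path_def continuous_within)
  then have "eventually (\<lambda>s. n s = n t) (at_right t)"
    by (simp add: tendsto_discrete)
  then obtain b where "b > t" "\<And>s. t < s \<Longrightarrow> s < b \<Longrightarrow> n s = n t"
    by (auto simp: eventually_at_right_field)
  then show ?thesis
    by (intro that[of "b - t"]) (auto simp: order_le_less)
qed

text \<open>The infimum of the times with negative surplus is attained: just after it the claim
  count is constant and premiums only raise the level, so a negative value shortly afterwards forces
  one at the infimum.\<close>

lemma first_passage:
  assumes n: "regular_path n" and "c > 0"
    and neg: "0 \<le> s" "level c n x u s < 0"
  obtains t where "0 \<le> t" "t \<le> s" "level c n x u t < 0" "\<And>r. 0 \<le> r \<Longrightarrow> r < t \<Longrightarrow> 0 \<le> level c n x u r"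
proof -
  define S where "S = {t. 0 \<le> t \<and> level c n x u t < 0}"
  define t where "t = Inf S"
  have S: "S \<noteq> {}" "bdd_below S" "s \<in> S" using neg by (auto simp: S_def intro: bdd_belowI[of _ 0])
  have t0: "0 \<le> t" unfolding t_def using S by (intro cInf_greatest) (auto simp: S_def)
  have le: "t \<le> r" if "r \<in> S" for r unfolding t_def using S that by (intro cInf_lower)
  obtain e where e: "e > 0" "\<And>r. t \<le> r \<Longrightarrow> r < t + e \<Longrightarrow> n r = n t"
    using regular_path_right_constant[OF n t0] by blast
  have "\<exists>r\<in>S. r < t + e"
    using S(1,2) e(1) unfolding t_def by (metis cInf_lessD less_add_same_cancel1)
  then obtain r where r: "r \<in> S" "r < t + e" by blast
  have "level c n x u t \<le> level c n x u r"
    using e(2)[OF le[OF r(1)] r(2)] le[OF r(1)] \<open>c > 0\<close> by (simp add: level_def)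
  also have "\<dots> < 0" using r by (simp add: S_def)
  finally have "level c n x u t < 0" .
  moreover have "0 \<le> level c n x u r" if "0 \<le> r" "r < t" for r
    using le[of r] that by (force simp: S_def)
  ultimately show ?thesis using t0 le[OF S(3)] by (intro that[of t])
qed

lemma falls_below_zero_iff:
  assumes "regular_path n" "c > 0"
  shows "falls_below c n x u 0 \<longleftrightarrow> (\<exists>t\<ge>0. level c n x u t < 0)"
proof
  assume "\<exists>t\<ge>0. level c n x u t < 0"
  then obtain s where "0 \<le> s" "level c n x u s < 0" by blast
  then obtain t where "0 \<le> t" "level c n x u t < 0" "\<And>r. 0 \<le> r \<Longrightarrow> r < t \<Longrightarrow> 0 \<le> level c n x u r"
    using first_passage[OF assms] by metis
  then show "falls_below c n x u 0" by (auto simp: falls_below_def)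
qed (auto simp: falls_below_def)

lemma falls_below_iff_first_passage:
  assumes t: "0 \<le> t" "level c n x u t < 0" "\<And>r. 0 \<le> r \<Longrightarrow> r < t \<Longrightarrow> 0 \<le> level c n x u r" and "0 \<le> y"
  shows "falls_below c n x u y \<longleftrightarrow> level c n x u t < - y"
proof
  assume "falls_below c n x u y"
  then obtain r where r: "0 \<le> r" "level c n x u r < - y"
      "\<And>s. 0 \<le> s \<Longrightarrow> s < r \<Longrightarrow> 0 \<le> level c n x u s"
    by (auto simp: falls_below_def)
  have "\<not> r < t" using t(3)[of r] r(1,2) \<open>0 \<le> y\<close> by auto
  moreover have "\<not> t < r" using r(3)[of t] t(1,2) by auto
  ultimately show "level c n x u t < - y" using r(2) by (cases "r = t") auto
qed (use t in \<open>auto simp: falls_below_def\<close>)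

lemma falls_below_mono:
  "falls_below c n x u y \<Longrightarrow> y' \<le> y \<Longrightarrow> falls_below c n x u y'"
  by (force simp: falls_below_def)

text \<open>
  With quadratically many steps of width \<open>1 / (j + 1)\<close> the horizon grows with \<open>j\<close>, so that a single
  limit suffices.
\<close>

definition grid_steps :: "nat \<Rightarrow> nat" where "grid_steps j = (Suc j)\<^sup>2"

definition grid_width :: "nat \<Rightarrow> real" where "grid_width j = 1 / real (Suc j)"

lemma grid_width_pos: "0 < grid_width j" by (simp add: grid_width_def)

text \<open>
  On the interval of constancy following the ruin time the surplus increases linearly, so the first
  grid point with negative surplus carries a value just above the surplus at ruin.
\<close>

lemma eventually_grid_falls_below_iff:
  assumes n: "regular_path n" and "c > 0" "y \<ge> 0"
  shows "\<forall>\<^sub>F j in sequentially.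
    grid_falls_below c (grid_width j) (grid_steps j) (\<lambda>k. n (grid_width j * real k)) x u y
      \<longleftrightarrow> falls_below c n x u y"
proof (cases "\<exists>t\<ge>0. level c n x u t < 0")
  case False
  then have *: "0 \<le> level c n x u t" if "0 \<le> t" for t using that by force
  have "\<not> falls_below c n x u y"
    using * \<open>y \<ge> 0\<close> by (force simp: falls_below_def)
  moreover have "\<not> grid_falls_below c (grid_width j) (grid_steps j)
      (\<lambda>k. n (grid_width j * real k)) x u y" for j
  proof
    assume "grid_falls_below c (grid_width j) (grid_steps j) (\<lambda>k. n (grid_width j * real k)) x u y"
    then obtain k where "level c n x u (grid_width j * real k) < - y"
      by (auto simp: grid_falls_below_def level_def)
    then show False using *[of "grid_width j * real k"] grid_width_pos[of j] \<open>y \<ge> 0\<close> by force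
  qed
  ultimately show ?thesis by simp
next
  case True
  then obtain s where "0 \<le> s" "level c n x u s < 0" by blast
  then obtain t where t: "0 \<le> t" "level c n x u t < 0"
      "\<And>r. 0 \<le> r \<Longrightarrow> r < t \<Longrightarrow> 0 \<le> level c n x u r"
    using first_passage[OF n \<open>c > 0\<close>] by metis
  obtain e where e: "e > 0" "\<And>s. t \<le> s \<Longrightarrow> s < t + e \<Longrightarrow> n s = n t"
    using regular_path_right_constant[OF n t(1)] by blast
  \<comment> \<open>The margin by which premiums may lift the level after \<open>t\<close> without a
    change of sides: it has to stay below \<open>- y\<close> if the path went there, and otherwise
    merely below 0, since a level at or above \<open>- y\<close> only rises.\<close>
  define m where "m = (if level c n x u t < - y then - y - level c n x u t else - level c n x u t)"
  have m: "m > 0" using t by (auto simp: m_def)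
  have w0: "grid_width \<longlonglongrightarrow> 0"
    unfolding grid_width_def using LIMSEQ_inverse_real_of_nat by (simp add: inverse_eq_divide)
  have ev: "\<forall>\<^sub>F j in sequentially. grid_width j < e \<and> c * grid_width j < m \<and> t + 1 < real (Suc j)"
  proof (intro eventually_conj)
    show "\<forall>\<^sub>F j in sequentially. grid_width j < e" using w0 e(1) by (rule order_tendstoD)
    have "(\<lambda>j. c * grid_width j) \<longlonglongrightarrow> c * 0" by (intro tendsto_intros w0)
    then show "\<forall>\<^sub>F j in sequentially. c * grid_width j < m" using m by (auto dest: order_tendstoD)
    show "\<forall>\<^sub>F j in sequentially. t + 1 < real (Suc j)"
      proof -
      have "filterlim (\<lambda>j. real (Suc j)) at_top sequentially"
        by (rule filterlim_compose[OF filterlim_real_sequentially filterlim_Suc])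
      then show ?thesis unfolding filterlim_at_top_dense by blast
    qed
  qed
  from ev show ?thesis
  proof eventually_elim
    case (elim j)
    define d where "d = grid_width j"
    have d: "d > 0" "d < e" "c * d < m" "d * real (Suc j) = 1"
      using elim grid_width_pos by (auto simp: d_def grid_width_def)
    \<comment> \<open>The first grid point at or after \<open>t\<close>. It lies in the interval of
      constancy, and \<open>t + 1 < real (Suc j)\<close> keeps it within the quadratic number of
      steps.\<close>
    define k where "k = nat \<lceil>t / d\<rceil>"
    have k: "t \<le> d * real k" "d * real k < t + d"
    proof -
      have "real k = of_int \<lceil>t / d\<rceil>" using t(1) d(1) by (simp add: k_def)
      then have "t / d \<le> real k" "real k < t / d + 1" by linarith+
      then show "t \<le> d * real k" "d * real k < t + d" using d(1) by (auto simp: field_simps)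
    qed
    have "real k * d < real (Suc j) * 1"
    proof -
      have "d \<le> 1" by (simp add: d_def grid_width_def)
      then show ?thesis using k(2) elim by (simp add: mult.commute)
    qed
    then have "real k * d * real (Suc j) < real (Suc j) * real (Suc j)"
      by (intro mult_strict_right_mono) auto
    moreover have "real k * d * real (Suc j) = real k"
      by (simp only: mult.assoc d(4) mult_1_right)
    ultimately have "real k < real (Suc j) * real (Suc j)"
      by (simp only:)
    then have kK: "k \<le> grid_steps j"
      unfolding grid_steps_def power2_eq_square by (metis less_imp_le of_nat_less_iff of_nat_mult)
    have nk: "n (d * real k) = n t" by (rule e(2)) (use k d(2) in auto)
    have lev: "level c n x u (d * real k) = level c n x u t + c * (d * real k - t)"
      by (simp add: level_def nk algebra_simps)
    have dk: "c * (d * real k - t) < c * d" "0 \<le> c * (d * real k - t)"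
      using k \<open>c > 0\<close> by (auto)
    have neg: "level c n x u (d * real k) < 0"
      using lev dk d(3) \<open>y \<ge> 0\<close> by (auto simp: m_def split: if_splits)
    have before: "0 \<le> level c n x u (d * real i)" if "i < k" for i
    proof -
      have "int i < \<lceil>t / d\<rceil>" using that by (simp add: k_def)
      then have "real i < t / d" by linarith
      then show ?thesis using d(1) by (intro t(3)) (auto simp: field_simps)
    qed
    have "grid_falls_below c d (grid_steps j) (\<lambda>k. n (d * real k)) x u y
        \<longleftrightarrow> level c n x u (d * real k) < - y"
    proof
      assume "grid_falls_below c d (grid_steps j) (\<lambda>k. n (d * real k)) x u y"
      then obtain i where i: "level c n x u (d * real i) < - y"
          "\<And>r. r < i \<Longrightarrow> 0 \<le> level c n x u (d * real r)"
        by (auto simp: grid_falls_below_def level_def)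
      have "\<not> i < k" using before[of i] i(1) \<open>y \<ge> 0\<close> by auto
      moreover have "\<not> k < i" using i(2)[of k] neg by auto
      ultimately show "level c n x u (d * real k) < - y" using i(1) by (cases "i = k") auto
    next
      assume "level c n x u (d * real k) < - y"
      then show "grid_falls_below c d (grid_steps j) (\<lambda>k. n (d * real k)) x u y"
        using before kK by (auto simp: grid_falls_below_def level_def)
    qed
    also have "\<dots> \<longleftrightarrow> level c n x u t < - y"
      using lev dk d(3) by (auto simp: m_def split: if_splits)
    also have "\<dots> \<longleftrightarrow> falls_below c n x u y"
      using falls_below_iff_first_passage[OF t \<open>y \<ge> 0\<close>] by simp
    finally show ?case by (simp add: d_def)
  qed
qed

text \<open>The pathwise half of the Markov property: without ruin up to \<open>h\<close> the fall
  is decided by the path restarted at \<open>h\<close>, the claims already paid being removed from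
  the sequence.\<close>

lemma falls_below_shift:
  assumes n: "regular_path n" and "h \<ge> 0" "y \<ge> 0"
    and nonneg: "\<And>s. 0 \<le> s \<Longrightarrow> s \<le> h \<Longrightarrow> 0 \<le> level c n x u s"
  shows "falls_below c n x u y \<longleftrightarrow>
    falls_below c (\<lambda>t. n (h + t) - n h) (\<lambda>i. x (n h + i)) (level c n x u h) y"
proof -
  have lev: "level c (\<lambda>t. n (h + t) - n h) (\<lambda>i. x (n h + i)) (level c n x u h) t
      = level c n x u (h + t)" if "0 \<le> t" for t
  proof -
    have "n h \<le> n (h + t)"
      using n that \<open>h \<ge> 0\<close> by (auto simp: regular_path_def mono_on_def)
    then have "(\<Sum>i<n (h + t). x i) = (\<Sum>i<n h. x i) + (\<Sum>i<n (h + t) - n h. x (n h + i))"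
      using sum_lessThan_add[of x "n h" "n (h + t) - n h"] by simp
    then show ?thesis by (simp add: level_def algebra_simps)
  qed
  show ?thesis
  proof
    assume "falls_below c n x u y"
    then obtain t where t: "0 \<le> t" "level c n x u t < - y"
      "\<And>s. 0 \<le> s \<Longrightarrow> s < t \<Longrightarrow> 0 \<le> level c n x u s" by (auto simp: falls_below_def)
    have "h < t" using nonneg[of t] t(1,2) \<open>y \<ge> 0\<close> by (cases "t \<le> h") auto
    then show "falls_below c (\<lambda>t. n (h + t) - n h) (\<lambda>i. x (n h + i)) (level c n x u h) y"
      unfolding falls_below_def using t \<open>h \<ge> 0\<close>
      by (intro exI[of _ "t - h"]) (auto simp: lev)
  next
    assume "falls_below c (\<lambda>t. n (h + t) - n h) (\<lambda>i. x (n h + i)) (level c n x u h) y"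
    then obtain t where t: "0 \<le> t" "level c n x u (h + t) < - y"
      "\<And>s. 0 \<le> s \<Longrightarrow> s < t \<Longrightarrow> 0 \<le> level c n x u (h + s)" by (auto simp: falls_below_def lev)
    have "0 \<le> level c n x u s" if "0 \<le> s" "s < h + t" for s
      using nonneg[of s] t(3)[of "s - h"] that by (cases "s \<le> h") auto
    then show "falls_below c n x u y"
      unfolding falls_below_def using t \<open>h \<ge> 0\<close> by (intro exI[of _ "h + t"]) auto
  qed
qed

lemma regular_path_shift:
  assumes n: "regular_path n" and "h \<ge> 0"
  shows "regular_path (\<lambda>t. n (h + t) - n h)"
  unfolding regular_path_def
proof (intro conjI allI impI)
  show "mono_on {0..} (\<lambda>t. n (h + t) - n h)"
    using n \<open>h \<ge> 0\<close> by (auto simp: regular_path_def mono_on_def intro!: diff_le_mono)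
  fix t :: real assume "0 \<le> t"
  then obtain e where e: "e > 0" "\<And>s. h + t \<le> s \<Longrightarrow> s < h + t + e \<Longrightarrow> n s = n (h + t)"
    using regular_path_right_constant[OF n, of "h + t"] \<open>h \<ge> 0\<close> by auto
  have "n (h + s) - n h = n (h + t) - n h" if "t < s" "s < t + e" for s
    using e(2)[of "h + s"] that by simp
  then have "eventually (\<lambda>s. n (h + s) - n h = n (h + t) - n h) (at_right t)"
    using e(1) by (auto simp only: eventually_at_right_field intro!: exI[of _ "t + e"])
  then show "continuous (at_right t) (\<lambda>t. n (h + t) - n h)"
    by (simp add: continuous_within tendsto_discrete)
qed simp

section \<open>Skeletons of the claim number process\<close>

definition poisson_weight :: "real \<Rightarrow> nat \<Rightarrow> real" where
  "poisson_weight a k = a ^ k / fact k * exp (- a)"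

lemma poisson_weight_nonneg: "0 \<le> a \<Longrightarrow> 0 \<le> poisson_weight a k"
  by (simp add: poisson_weight_def)

lemma poisson_weight_le_1:
  assumes "0 \<le> a" shows "poisson_weight a k \<le> 1"
proof (cases "a = 0")
  case True
  then show ?thesis by (cases k) (auto simp: poisson_weight_def)
next
  case False
  then have "poisson_weight a k = pmf (poisson_pmf a) k"
    using assms by (simp add: poisson_weight_def)
  then show ?thesis by (simp add: pmf_le_1)
qed

definition list_weight :: "real \<Rightarrow> nat list \<Rightarrow> real" where
  "list_weight a v = (\<Prod>i<length v. poisson_weight a (v ! i))"

lemma list_weight_nonneg: "0 \<le> a \<Longrightarrow> 0 \<le> list_weight a v"
  by (auto simp: list_weight_def intro!: prod_nonneg poisson_weight_nonneg)

lemma list_weight_le_1: "0 \<le> a \<Longrightarrow> list_weight a v \<le> 1"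
  by (auto simp: list_weight_def intro!: prod_le_1 poisson_weight_nonneg poisson_weight_le_1)

lemma borel_measurable_poisson_weight[measurable]:
  assumes [measurable]: "f \<in> borel_measurable M"
  shows "(\<lambda>x. poisson_weight (f x) k) \<in> borel_measurable M"
  unfolding poisson_weight_def by measurable

lemma borel_measurable_list_weight[measurable]:
  assumes [measurable]: "f \<in> borel_measurable M"
  shows "(\<lambda>x. list_weight (f x) v) \<in> borel_measurable M"
  unfolding list_weight_def by measurable

definition claims_law :: "(real \<Rightarrow> real) \<Rightarrow> (nat \<Rightarrow> real) measure" where
  "claims_law F = PiM UNIV (\<lambda>_. interval_measure F)"

lemma sets_claims_law[measurable_cong]: "sets (claims_law F) = sets (PiM UNIV (\<lambda>_. borel))"
  unfolding claims_law_def by (intro sets_PiM_cong) auto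

text \<open>\<open>a\<close> is the expected number of claims per step. The sum over the increment
  vectors is written as a nonnegative integral over a counting measure, so that Tonelli exchanges it
  with the integral over the rate.\<close>

definition skeleton_prob ::
    "(real \<Rightarrow> real) \<Rightarrow> real \<Rightarrow> nat \<Rightarrow> (nat list \<Rightarrow> (nat \<Rightarrow> real) set) \<Rightarrow> ennreal" where
  "skeleton_prob F a K Z =
     (\<integral>\<^sup>+v. ennreal (list_weight a v) * emeasure (claims_law F) (Z v) \<partial>count_space {v. length v = K})"

lemma borel_measurable_skeleton_prob[measurable]:
  assumes [measurable]: "f \<in> borel_measurable M"
  shows "(\<lambda>x. skeleton_prob F (f x) K Z) \<in> borel_measurable M"
proof -
  interpret sigma_finite_measure "count_space {v::nat list. length v = K}"
    by (rule sigma_finite_measure_count_space_countable) auto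
  have "(\<lambda>(x, v). ennreal (list_weight (f x) v) * emeasure (claims_law F) (Z v))
    \<in> borel_measurable (M \<Otimes>\<^sub>M count_space {v. length v = K})"
    by (subst measurable_pair_swap_iff, rule measurable_pair_measure_countable1) auto
  then show ?thesis unfolding skeleton_prob_def by measurable
qed

text \<open>The offset \<open>h\<close> lets the grid begin after an initial interval, as the
  restarted path requires.\<close>

definition increments :: "(real \<Rightarrow> nat) \<Rightarrow> real \<Rightarrow> real \<Rightarrow> nat \<Rightarrow> nat list" where
  "increments n h d K = map (\<lambda>i. n (h + d * real (Suc i)) - n (h + d * real i)) [0..<K]"

lemma increments_eq_iff:
  "increments n h d K = v \<longleftrightarrow>
    length v = K \<and> (\<forall>i<K. n (h + d * real (Suc i)) - n (h + d * real i) = v ! i)"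
  unfolding increments_def list_eq_iff_nth_eq by (auto simp del: of_nat_Suc)

lemma sum_list_take_increments:
  assumes n: "mono_on {0..} n" and "0 \<le> h" "0 \<le> d" "k \<le> K"
  shows "sum_list (take k (increments n h d K)) = n (h + d * real k) - n h"
  using \<open>k \<le> K\<close>
proof (induction k)
  case (Suc k)
  have "n h \<le> n (h + d * real k)" "n (h + d * real k) \<le> n (h + d * real (Suc k))"
    by (rule mono_onD[OF n]; use assms in \<open>simp add: mult_left_mono\<close>)+
  moreover have "take (Suc k) (increments n h d K)
      = take k (increments n h d K) @ [n (h + d * real (Suc k)) - n (h + d * real k)]"
    using Suc.prems by (subst take_Suc_conv_app_nth) (auto simp: increments_def)
  ultimately show ?case using Suc by simp
qed simp

text \<open>One locale for both models: \<open>G\<close> is either the law of the mixing variable or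
  a unit mass at a fixed rate. The law of the counts averaged over \<open>G\<close> is the form that
  both share.\<close>

locale mixture_model = prob_space M + mix: prob_space G
  for M :: "'a measure" and G :: "real measure" +
  fixes F :: "real \<Rightarrow> real" and N :: "real \<Rightarrow> 'a \<Rightarrow> nat" and X :: "nat \<Rightarrow> 'a \<Rightarrow> real"
  assumes sets_G[measurable_cong]: "sets G = sets borel"
    and nonneg_G: "AE l in G. 0 \<le> l"
    and claims: "claim_sizes M F X"
    and counting: "counting_process M N"
    and indep: "independent_of_claims M N X"
    and fdd: "time_grid n t \<Longrightarrow>
      prob {\<omega>\<in>space M. \<forall>i<n. N (t (Suc i)) \<omega> = N (t i) \<omega> + k i} =
        (LINT l|G. poisson_increments l n t k)"
begin

lemma measurable_N[measurable]: "0 \<le> t \<Longrightarrow> N t \<in> measurable M (count_space UNIV)"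
  using counting by (simp add: counting_process_def)

lemma regular_paths: "\<omega> \<in> space M \<Longrightarrow> regular_path (\<lambda>t. N t \<omega>)"
  using counting by (simp add: counting_process_def regular_path_def)

lemma measurable_X[measurable]: "X i \<in> borel_measurable M"
  using claims by (auto simp: claim_sizes_def indep_vars_def2)

lemma measurable_claims[measurable]: "(\<lambda>\<omega> i. X i \<omega>) \<in> measurable M (PiM UNIV (\<lambda>_. borel))"
  by (rule measurable_PiM_single') (auto)

lemma distr_X: "distr M borel (X i) = interval_measure F"
proof -
  interpret D: real_distribution "distr M borel (X i)"
    by (intro real_distribution_distr) simp
  have F: "cdf (distr M borel (X i)) = F" using claims by (simp add: claim_sizes_def)
  have props: "\<And>x y. x \<le> y \<Longrightarrow> F x \<le> F y" "\<And>a. continuous (at_right a) F"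
      "(F \<longlongrightarrow> 0) at_bot" "(F \<longlongrightarrow> 1) at_top"
    unfolding F[symmetric]
    by (auto intro: D.cdf_nondecreasing D.cdf_is_right_cont D.cdf_lim_at_bot D.cdf_lim_at_top_prob)
  show ?thesis
    using props by (intro cdf_unique real_distribution_interval_measure)
      (auto simp: F cdf_interval_measure D.real_distribution_axioms)
qed

sublocale claim: real_distribution "interval_measure F"
  using real_distribution_distr[OF measurable_X[of 0]] distr_X[of 0] by simp

lemma cdf_claim: "cdf (interval_measure F) = F"
  using claims distr_X[of 0] unfolding claim_sizes_def by metis

lemma distr_claims: "distr M (PiM UNIV (\<lambda>_. borel)) (\<lambda>\<omega> i. X i \<omega>) = claims_law F"
proof -
  have "indep_vars (\<lambda>_. borel) X UNIV" using claims by (simp add: claim_sizes_def)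
  then show ?thesis
    by (subst (asm) indep_vars_iff_distr_eq_PiM) (auto simp: distr_X claims_law_def restrict_UNIV)
qed

lemma emeasure_claims:
  assumes [measurable]: "A \<in> sets (PiM UNIV (\<lambda>_. borel))"
  shows "emeasure M {\<omega>\<in>space M. (\<lambda>i. X i \<omega>) \<in> A} = emeasure (claims_law F) A"
  unfolding distr_claims[symmetric]
  by (subst emeasure_distr) (auto intro!: arg_cong[where f="emeasure M"])

section \<open>Joint law of grid increments and claims\<close>

lemma measurable_increments[measurable]:
  assumes "0 \<le> h" "0 \<le> d"
  shows "(\<lambda>\<omega>. increments (\<lambda>t. N t \<omega>) h d K) \<in> measurable M (count_space UNIV)"
proof -
  have N: "N (h + d * real i) \<in> measurable M (count_space UNIV)" for i
    using assms by (intro measurable_N) simp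
  have pred: "Measurable.pred M (\<lambda>\<omega>. N (h + d * real (Suc i)) \<omega> - N (h + d * real i) \<omega> = j)" for i j
  proof -
    have "Measurable.pred M (\<lambda>\<omega>. f \<omega> - g \<omega> = j)"
      if [measurable]: "f \<in> measurable M (count_space UNIV)" "g \<in> measurable M (count_space UNIV)"
      for f g :: "'a \<Rightarrow> nat" by measurable
    from this[OF N N] show ?thesis .
  qed
  have eq: "(\<lambda>\<omega>. increments (\<lambda>t. N t \<omega>) h d K) -` {v} \<inter> space M =
    {\<omega>\<in>space M. length v = K \<and>
      (\<forall>i<K. N (h + d * real (Suc i)) \<omega> - N (h + d * real i) \<omega> = v ! i)}" for v
    by (auto simp only: increments_eq_iff vimage_def Int_def singleton_iff mem_Collect_eq)
  have "{\<omega>\<in>space M. length v = K \<and>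
      (\<forall>i<K. N (h + d * real (Suc i)) \<omega> - N (h + d * real i) \<omega> = v ! i)} \<in> sets M" for v
    unfolding pred_def[symmetric] by (intro pred_intros_logic pred_intros_countable pred measurable_const) simp_all
  then have "(\<lambda>\<omega>. increments (\<lambda>t. N t \<omega>) h d K) -` {v} \<inter> space M \<in> sets M" for v
    by (simp only: eq)
  then show ?thesis
    by (subst measurable_count_space_eq2_countable) auto
qed

text \<open>The finite-dimensional law accounts for the counts and independence of the two generated
  sigma-algebras for the claims; the claim probability therefore stands outside the integral over
  the rate.\<close>

lemma emeasure_skeleton_singleton:
  assumes "0 \<le> h" "0 \<le> d" and [measurable]: "A \<in> sets (PiM UNIV (\<lambda>_. borel))"
    and v: "length v = K"
  shows "emeasure M {\<omega>\<in>space M. N h \<omega> = k \<and> increments (\<lambda>t. N t \<omega>) h d K = v \<and> (\<lambda>i. X i \<omega>) \<in> A}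
    = (\<integral>\<^sup>+l. ennreal (poisson_weight (l * h) k) * ennreal (list_weight (l * d) v) \<partial>G)
      * emeasure (claims_law F) A"
proof -
  \<comment> \<open>Prefixing the grid with time 0 turns \<open>N h = k\<close> into its first
    increment, because paths start at 0.\<close>
  define t where "t = case_nat 0 (\<lambda>i. h + d * real i)"
  define \<kappa> where "\<kappa> = case_nat k (\<lambda>i. v ! i)"
  define SN where "SN = {N t -` A \<inter> space M | t A. 0 \<le> t}"
  define SX where "SX = {X i -` A \<inter> space M | i A. A \<in> sets borel}"
  define E where "E = {\<omega>\<in>space M. N h \<omega> = k \<and> increments (\<lambda>t. N t \<omega>) h d K = v}"
  have grid: "time_grid (Suc K) t"
    using assms by (auto simp: time_grid_def t_def mult_left_mono split: nat.split)
  \<comment> \<open>Monotonicity makes the truncated subtraction in \<open>increments\<close>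
    equivalent to the additive form in \<open>fdd\<close>.\<close>
  have mono: "N (h + d * real i) \<omega> \<le> N (h + d * real (Suc i)) \<omega>" if "\<omega> \<in> space M" for i \<omega>
    using regular_paths[OF that] assms
    by (auto simp: regular_path_def mult_left_mono intro: mono_onD)
  have E: "E = {\<omega>\<in>space M. \<forall>i<Suc K. N (t (Suc i)) \<omega> = N (t i) \<omega> + \<kappa> i}"
  proof -
    have "N 0 \<omega> = 0" if "\<omega> \<in> space M" for \<omega>
      using regular_paths[OF that] by (simp add: regular_path_def)
    moreover have "increments (\<lambda>t. N t \<omega>) h d K = v \<longleftrightarrow>
        (\<forall>i<K. N (h + d * real (Suc i)) \<omega> = N (h + d * real i) \<omega> + v ! i)" if "\<omega> \<in> space M" for \<omega>
    proof -
      have "N (h + d * real (Suc i)) \<omega> - N (h + d * real i) \<omega> = v ! i \<longleftrightarrow>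
          N (h + d * real (Suc i)) \<omega> = N (h + d * real i) \<omega> + v ! i" for i
        using mono[OF that, of i] by linarith
      then show ?thesis using v by (simp only: increments_eq_iff) simp
    qed
    ultimately show ?thesis
      unfolding E_def by (auto simp: All_less_Suc2 t_def \<kappa>_def)
  qed
  have SN: "SN \<subseteq> Pow (space M)" and SX: "SX \<subseteq> Pow (space M)" by (auto simp: SN_def SX_def)
  have indep: "indep_set (sigma_sets (space M) SN) (sigma_sets (space M) SX)"
    using indep unfolding independent_of_claims_def SN_def SX_def .
  \<comment> \<open>Independence concerns the sigma-algebras generated by the counts and by the
    claims, so both events have to be located there and not merely in \<open>M\<close>.\<close>
  have NS: "N s \<in> measurable (sigma (space M) SN) (count_space UNIV)" if "0 \<le> s" for s
    using that SN by (auto simp: measurable_def SN_def intro!: sigma_sets.Basic)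
  have tpos: "0 \<le> t i" for i using assms by (auto simp: t_def split: nat.split)
  have "{\<omega>\<in>space (sigma (space M) SN). \<forall>i<Suc K. N (t (Suc i)) \<omega> = N (t i) \<omega> + \<kappa> i}
      \<in> sets (sigma (space M) SN)"
  proof -
    have "Measurable.pred (sigma (space M) SN) (\<lambda>\<omega>. N (t (Suc i)) \<omega> = N (t i) \<omega> + \<kappa> i)" for i
    proof -
      have "Measurable.pred M' (\<lambda>\<omega>. f \<omega> = g \<omega> + j)"
        if [measurable]: "f \<in> measurable M' (count_space UNIV)" "g \<in> measurable M' (count_space UNIV)"
        for f g :: "'a \<Rightarrow> nat" and M' j
      proof -
        have "(\<lambda>\<omega>. f \<omega> = g \<omega> + j) = (\<lambda>\<omega>. \<exists>m. g \<omega> = m \<and> f \<omega> = m + j)" by auto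
        then show ?thesis by (simp only:) measurable
      qed
      from this[OF NS[OF tpos] NS[OF tpos]] show ?thesis .
    qed
    then show ?thesis
      unfolding pred_def[symmetric] by (intro pred_intros_logic pred_intros_countable measurable_const) simp_all
  qed
  then have E_in: "E \<in> sigma_sets (space M) SN"
    using SN by (simp add: E)
  have "X i \<in> measurable (sigma (space M) SX) borel" for i
    using SX by (auto simp: measurable_def SX_def intro!: sigma_sets.Basic)
  then have "(\<lambda>\<omega> i. X i \<omega>) \<in> measurable (sigma (space M) SX) (PiM UNIV (\<lambda>_. borel))"
    by (intro measurable_PiM_single') auto
  from measurable_sets[OF this assms(3)]
  have A_in: "{\<omega>\<in>space M. (\<lambda>i. X i \<omega>) \<in> A} \<in> sigma_sets (space M) SX"
    using SX by (simp add: vimage_def Int_def conj_commute)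
  have "{\<omega>\<in>space M. N h \<omega> = k \<and> increments (\<lambda>t. N t \<omega>) h d K = v \<and> (\<lambda>i. X i \<omega>) \<in> A}
      = E \<inter> {\<omega>\<in>space M. (\<lambda>i. X i \<omega>) \<in> A}" by (auto simp: E_def)
  then have "emeasure M {\<omega>\<in>space M. N h \<omega> = k \<and> increments (\<lambda>t. N t \<omega>) h d K = v \<and> (\<lambda>i. X i \<omega>) \<in> A}
      = ennreal (prob E) * emeasure M {\<omega>\<in>space M. (\<lambda>i. X i \<omega>) \<in> A}"
    using indep_setD[OF indep E_in A_in] by (simp add: emeasure_eq_measure ennreal_mult)
  also have "prob E = (LINT l|G. poisson_increments l (Suc K) t \<kappa>)"
    unfolding E by (rule fdd[OF grid])
  also have "\<dots> = (LINT l|G. poisson_weight (l * h) k * list_weight (l * d) v)"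
    unfolding poisson_increments_def prod.lessThan_Suc_shift
    by (simp add: t_def \<kappa>_def list_weight_def v poisson_weight_def algebra_simps)
  also have "ennreal \<dots> = (\<integral>\<^sup>+l. ennreal (poisson_weight (l * h) k * list_weight (l * d) v) \<partial>G)"
  proof (rule nn_integral_eq_integral[symmetric])
    show "AE l in G. 0 \<le> poisson_weight (l * h) k * list_weight (l * d) v"
      using nonneg_G by eventually_elim (simp add: assms poisson_weight_nonneg list_weight_nonneg)
    show "integrable G (\<lambda>l. poisson_weight (l * h) k * list_weight (l * d) v)"
    proof (rule mix.integrable_const_bound[where B=1])
      show "AE l in G. norm (poisson_weight (l * h) k * list_weight (l * d) v) \<le> 1"
        using nonneg_G by eventually_elim
          (auto simp: abs_mult assms intro!: mult_le_one
            simp: abs_of_nonneg poisson_weight_nonneg list_weight_nonneg poisson_weight_le_1 list_weight_le_1)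
    qed measurable
  qed
  also have "\<dots> = (\<integral>\<^sup>+l. ennreal (poisson_weight (l * h) k) * ennreal (list_weight (l * d) v) \<partial>G)"
    using nonneg_G assms by (intro nn_integral_cong_AE) (auto elim!: eventually_mono
      simp: ennreal_mult poisson_weight_nonneg list_weight_nonneg)
  finally show ?thesis by (simp add: emeasure_claims)
qed

text \<open>Decomposing by the value of the increment vector allows the claim event to depend on it;
  there are countably many values, and Tonelli moves the sum inside the integral over the
  rate.\<close>

lemma emeasure_skeleton:
  fixes k K :: nat
  assumes "0 \<le> h" "0 \<le> d" and Z: "\<And>v. Z v \<in> sets (PiM UNIV (\<lambda>_. borel))"
  defines "S \<equiv> {\<omega>\<in>space M. N h \<omega> = k \<and> (\<lambda>i. X i \<omega>) \<in> Z (increments (\<lambda>t. N t \<omega>) h d K)}"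
  shows "S \<in> sets M"
    and "emeasure M S = (\<integral>\<^sup>+l. ennreal (poisson_weight (l * h) k) * skeleton_prob F (l * d) K Z \<partial>G)"
proof -
  define T where "T v = {\<omega>\<in>space M. N h \<omega> = k \<and> increments (\<lambda>t. N t \<omega>) h d K = v \<and> (\<lambda>i. X i \<omega>) \<in> Z v}" for v
  note [measurable] = Z measurable_increments[OF assms(1,2)] measurable_N[OF assms(1)]
  have T[measurable]: "T v \<in> sets M" for v
    unfolding T_def by measurable
  have S: "S = (\<Union>v\<in>{v. length v = K}. T v)"
    by (auto simp: S_def T_def increments_def)
  have "disjoint_family_on T {v. length v = K}" by (auto simp: disjoint_family_on_def T_def)
  then have "emeasure M S = (\<integral>\<^sup>+v. emeasure M (T v) \<partial>count_space {v. length v = K})"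
    unfolding S by (intro emeasure_UN_countable) auto
  also have "\<dots> = (\<integral>\<^sup>+v. (\<integral>\<^sup>+l. ennreal (poisson_weight (l * h) k) * ennreal (list_weight (l * d) v) *
      emeasure (claims_law F) (Z v) \<partial>G) \<partial>count_space {v. length v = K})"
    unfolding T_def
    by (intro nn_integral_cong, subst emeasure_skeleton_singleton)
      (use assms in \<open>auto simp: nn_integral_multc\<close>)
  also have "\<dots> = (\<integral>\<^sup>+l. (\<integral>\<^sup>+v. ennreal (poisson_weight (l * h) k) * ennreal (list_weight (l * d) v) *
      emeasure (claims_law F) (Z v) \<partial>count_space {v. length v = K}) \<partial>G)"
    by (rule nn_integral_count_space_nn_integral[symmetric]) auto
  also have "\<dots> = (\<integral>\<^sup>+l. ennreal (poisson_weight (l * h) k) * skeleton_prob F (l * d) K Z \<partial>G)"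
    unfolding skeleton_prob_def by (simp add: nn_integral_cmult mult.assoc)
  finally show "emeasure M S = (\<integral>\<^sup>+l. ennreal (poisson_weight (l * h) k) * skeleton_prob F (l * d) K Z \<partial>G)" .
  show "S \<in> sets M" unfolding S by (intro sets.countable_UN'') auto
qed

end

section \<open>Probabilities of falling below a level\<close>

lemma pred_grid_falls_below[measurable]:
  assumes [measurable]: "f \<in> borel_measurable M" "g \<in> measurable M (PiM UNIV (\<lambda>_. borel))"
  shows "Measurable.pred M (\<lambda>\<omega>. grid_falls_below c d K s (g \<omega>) (f \<omega>) y)"
proof -
  have [measurable]: "(\<lambda>\<omega>. g \<omega> i) \<in> borel_measurable M" for i
    using measurable_compose[OF assms(2) measurable_component_singleton[of i UNIV "\<lambda>_. borel"]] by simp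
  have [measurable]: "(\<lambda>\<omega>. f \<omega> + c * (d * real k) - (\<Sum>i<s k. g \<omega> i)) \<in> borel_measurable M" for k
    by measurable
  have 1: "Measurable.pred M (\<lambda>\<omega>. f \<omega> + c * (d * real k) - (\<Sum>i<s k. g \<omega> i) < - y)" for k
    by measurable
  have 2: "Measurable.pred M (\<lambda>\<omega>. 0 \<le> f \<omega> + c * (d * real k) - (\<Sum>i<s k. g \<omega> i))" for k
    by measurable
  show ?thesis
    unfolding grid_falls_below_def
    by (intro pred_intros_logic pred_intros_countable pred_intros_countable_bounded 1 2 measurable_const) simp_all
qed

lemma grid_falls_below_cong:
  assumes "\<And>k. k \<le> K \<Longrightarrow> s k = s' k"
  shows "grid_falls_below c d K s x u y = grid_falls_below c d K s' x u y"
  unfolding grid_falls_below_def using assms by auto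

text \<open>Pointwise eventual agreement makes \<open>B\<close> the lower limit of the
  \<open>A j\<close>, hence measurable without any completion; dominated convergence of the
  indicators does the rest.\<close>

lemma (in prob_space) eventually_iff_prob_tendsto:
  fixes A :: "nat \<Rightarrow> 'a set"
  assumes A[measurable]: "\<And>j. A j \<in> events" and "B \<subseteq> space M"
    and ev: "\<And>\<omega>. \<omega> \<in> space M \<Longrightarrow> \<forall>\<^sub>F j in sequentially. \<omega> \<in> A j \<longleftrightarrow> \<omega> \<in> B"
  shows "B \<in> events" "(\<lambda>j. prob (A j)) \<longlonglongrightarrow> prob B"
proof -
  have "B = (\<Union>n. \<Inter>j\<in>{n..}. A j)"
  proof (intro equalityI subsetI)
    fix \<omega> assume "\<omega> \<in> B"
    then show "\<omega> \<in> (\<Union>n. \<Inter>j\<in>{n..}. A j)"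
      using ev[of \<omega>] \<open>B \<subseteq> space M\<close> by (auto simp: eventually_sequentially)
  next
    fix \<omega> assume "\<omega> \<in> (\<Union>n. \<Inter>j\<in>{n..}. A j)"
    then obtain n where n: "\<And>j. j \<ge> n \<Longrightarrow> \<omega> \<in> A j" by auto
    then have "\<omega> \<in> space M" using sets.sets_into_space[OF A, of n] by auto
    then obtain m where "\<And>j. j \<ge> m \<Longrightarrow> \<omega> \<in> A j \<longleftrightarrow> \<omega> \<in> B"
      using ev by (auto simp: eventually_sequentially)
    then show "\<omega> \<in> B" using n[of "max n m"] by auto
  qed
  then show B[measurable]: "B \<in> events" by simp
  have "(\<lambda>j. LINT \<omega>|M. indicator (A j) \<omega>) \<longlonglongrightarrow> (LINT \<omega>|M. indicator B \<omega> :: real)"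
  proof (rule integral_dominated_convergence[where w = "\<lambda>_. 1"])
    show "AE \<omega> in M. (\<lambda>j. indicator (A j) \<omega>) \<longlonglongrightarrow> (indicator B \<omega> :: real)"
    proof (rule AE_I2)
      fix \<omega> assume "\<omega> \<in> space M"
      from ev[OF this] show "(\<lambda>j. indicator (A j) \<omega>) \<longlonglongrightarrow> (indicator B \<omega> :: real)"
        by (intro tendsto_eventually) (auto elim!: eventually_mono simp: indicator_def)
    qed
  qed (auto simp: indicator_def)
  then show "(\<lambda>j. prob (A j)) \<longlonglongrightarrow> prob B" by simp
qed

definition fall_event ::
    "'a measure \<Rightarrow> real \<Rightarrow> (real \<Rightarrow> 'a \<Rightarrow> nat) \<Rightarrow> (nat \<Rightarrow> 'a \<Rightarrow> real) \<Rightarrow> real \<Rightarrow> real \<Rightarrow> 'a set" where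
  "fall_event M c N X u y = {\<omega>\<in>space M. falls_below c (\<lambda>t. N t \<omega>) (\<lambda>i. X i \<omega>) u y}"

definition grid_set :: "real \<Rightarrow> real \<Rightarrow> real \<Rightarrow> nat \<Rightarrow> nat list \<Rightarrow> (nat \<Rightarrow> real) set" where
  "grid_set c u y j v =
     {x. grid_falls_below c (grid_width j) (grid_steps j) (\<lambda>i. sum_list (take i v)) x u y}"

text \<open>A Borel function of the rate in which no space carrying the process occurs: the common
  expression through which \<open>M\<close> and the spaces \<open>Q l\<close> are compared.\<close>

definition grid_prob :: "(real \<Rightarrow> real) \<Rightarrow> real \<Rightarrow> real \<Rightarrow> real \<Rightarrow> nat \<Rightarrow> real \<Rightarrow> ennreal" where
  "grid_prob F c u y j l = skeleton_prob F (l * grid_width j) (grid_steps j) (grid_set c u y j)"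

lemma borel_measurable_grid_prob[measurable]: "grid_prob F c u y j \<in> borel_measurable borel"
  unfolding grid_prob_def by measurable

lemma sets_grid_set[measurable]: "grid_set c u y j v \<in> sets (PiM UNIV (\<lambda>_. borel))"
proof -
  have "{x\<in>space (PiM UNIV (\<lambda>_. borel)). grid_falls_below c (grid_width j) (grid_steps j)
      (\<lambda>i. sum_list (take i v)) x u y} \<in> sets (PiM UNIV (\<lambda>_. borel :: real measure))"
    unfolding pred_def[symmetric] by (rule pred_grid_falls_below) auto
  then show ?thesis by (simp add: grid_set_def space_PiM)
qed

context mixture_model
begin

text \<open>The claim count \<open>k\<close>, the condition \<open>P\<close> on the claims and the
  restart capital \<open>w\<close> are kept general to cover three cases: the unshifted event with
  \<open>h = 0\<close>, no claim up to \<open>h\<close>, and exactly one claim up to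
  \<open>h\<close> that does not cause ruin.\<close>

lemma shifted_fall:
  fixes k :: nat and w :: "(nat \<Rightarrow> real) \<Rightarrow> real"
  assumes "c > 0" "h \<ge> 0" "y \<ge> 0"
    and [measurable]: "Measurable.pred (PiM UNIV (\<lambda>_. borel)) P" "w \<in> borel_measurable (PiM UNIV (\<lambda>_. borel))"
  defines "S \<equiv> {\<omega>\<in>space M. N h \<omega> = k \<and> P (\<lambda>i. X i \<omega>) \<and>
      falls_below c (\<lambda>t. N (h + t) \<omega> - N h \<omega>) (\<lambda>i. X (k + i) \<omega>) (w (\<lambda>i. X i \<omega>)) y}"
    and "Z \<equiv> \<lambda>j v. {x. P x \<and> grid_falls_below c (grid_width j) (grid_steps j)
      (\<lambda>i. sum_list (take i v)) (\<lambda>i. x (k + i)) (w x) y}"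
  shows "S \<in> events"
    and "(\<lambda>j. enn2real (\<integral>\<^sup>+l. ennreal (poisson_weight (l * h) k) *
      skeleton_prob F (l * grid_width j) (grid_steps j) (Z j) \<partial>G)) \<longlonglongrightarrow> prob S"
    and "(\<integral>\<^sup>+l. ennreal (poisson_weight (l * h) k) *
      skeleton_prob F (l * grid_width j) (grid_steps j) (Z j) \<partial>G) \<le> 1"
proof -
  define A where "A j = {\<omega>\<in>space M. N h \<omega> = k \<and>
      (\<lambda>i. X i \<omega>) \<in> Z j (increments (\<lambda>t. N t \<omega>) h (grid_width j) (grid_steps j))}" for j
  have Z: "Z j v \<in> sets (PiM UNIV (\<lambda>_. borel))" for j v
  proof -
    have "(\<lambda>x i. x (k + i)) \<in> measurable (PiM UNIV (\<lambda>_. borel)) (PiM UNIV (\<lambda>_. borel :: real measure))"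
      by (rule measurable_PiM_single') (auto intro!: measurable_component_singleton)
    note [measurable] = this
    have "{x\<in>space (PiM UNIV (\<lambda>_. borel)). P x \<and> grid_falls_below c (grid_width j) (grid_steps j)
      (\<lambda>i. sum_list (take i v)) (\<lambda>i. x (k + i)) (w x) y} \<in> sets (PiM UNIV (\<lambda>_. borel :: real measure))"
      unfolding pred_def[symmetric] by (intro pred_intros_logic pred_grid_falls_below) measurable
    then show ?thesis by (simp add: Z_def space_PiM)
  qed
  have d: "0 \<le> grid_width j" for j by (simp add: grid_width_def)
  have A: "A j \<in> events"
    "emeasure M (A j) = (\<integral>\<^sup>+l. ennreal (poisson_weight (l * h) k) *
      skeleton_prob F (l * grid_width j) (grid_steps j) (Z j) \<partial>G)" for j
    unfolding A_def by (rule emeasure_skeleton[OF \<open>h \<ge> 0\<close> d Z])+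
  have iff: "\<forall>\<^sub>F j in sequentially. \<omega> \<in> A j \<longleftrightarrow> \<omega> \<in> S" if "\<omega> \<in> space M" for \<omega>
  proof -
    note reg = regular_paths[OF that]
    have eq: "grid_falls_below c (grid_width j) (grid_steps j)
        (\<lambda>i. sum_list (take i (increments (\<lambda>t. N t \<omega>) h (grid_width j) (grid_steps j)))) x u y \<longleftrightarrow>
      grid_falls_below c (grid_width j) (grid_steps j) (\<lambda>i. N (h + grid_width j * real i) \<omega> - N h \<omega>) x u y"
      for j x u
      using reg \<open>h \<ge> 0\<close> grid_width_pos[of j]
      by (intro grid_falls_below_cong sum_list_take_increments) (auto simp: regular_path_def)
    show ?thesis
      using eventually_grid_falls_below_iff[OF regular_path_shift[OF reg \<open>h \<ge> 0\<close>] \<open>c > 0\<close> \<open>y \<ge> 0\<close>,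
        of "\<lambda>i. X (k + i) \<omega>" "w (\<lambda>i. X i \<omega>)"]
      by eventually_elim (simp add: A_def S_def Z_def that eq)
  qed
  have "S \<subseteq> space M" by (auto simp: S_def)
  note lim = eventually_iff_prob_tendsto[of A, OF A(1) this iff]
  show "S \<in> events" by (rule lim)
  show "(\<lambda>j. enn2real (\<integral>\<^sup>+l. ennreal (poisson_weight (l * h) k) *
      skeleton_prob F (l * grid_width j) (grid_steps j) (Z j) \<partial>G)) \<longlonglongrightarrow> prob S"
    using lim(2) unfolding A(2)[symmetric] by (simp add: measure_def)
  show "(\<integral>\<^sup>+l. ennreal (poisson_weight (l * h) k) *
      skeleton_prob F (l * grid_width j) (grid_steps j) (Z j) \<partial>G) \<le> 1"
    unfolding A(2)[symmetric] by (rule emeasure_le_1)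
qed

lemma fall_event_limit:
  assumes "c > 0" "y \<ge> 0"
  shows "fall_event M c N X u y \<in> events"
    and "(\<lambda>j. enn2real (\<integral>\<^sup>+l. grid_prob F c u y j l \<partial>G)) \<longlonglongrightarrow> prob (fall_event M c N X u y)"
    and "(\<integral>\<^sup>+l. grid_prob F c u y j l \<partial>G) \<le> 1"
proof -
  have "N 0 \<omega> = 0" if "\<omega> \<in> space M" for \<omega>
    using regular_paths[OF that] by (simp add: regular_path_def)
  then have *: "fall_event M c N X u y = {\<omega>\<in>space M. N 0 \<omega> = 0 \<and> True \<and>
      falls_below c (\<lambda>t. N (0 + t) \<omega> - N 0 \<omega>) (\<lambda>i. X (0 + i) \<omega>) ((\<lambda>_. u) (\<lambda>i. X i \<omega>)) y}"
    by (auto simp: fall_event_def)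
  note lim = shifted_fall[where h = 0 and k = 0 and P = "\<lambda>_. True" and w = "\<lambda>_. u", OF assms(1) order_refl assms(2),
    folded *]
  show "fall_event M c N X u y \<in> events" by (rule lim) auto
  have eq: "(\<integral>\<^sup>+l. grid_prob F c u y j l \<partial>G) = (\<integral>\<^sup>+l. ennreal (poisson_weight (l * 0) 0) *
      skeleton_prob F (l * grid_width j) (grid_steps j) (\<lambda>v. {x. True \<and> grid_falls_below c (grid_width j) (grid_steps j)
      (\<lambda>i. sum_list (take i v)) (\<lambda>i. x (0 + i)) u y}) \<partial>G)" for j
    by (simp add: poisson_weight_def grid_prob_def grid_set_def[abs_def])
  show "(\<lambda>j. enn2real (\<integral>\<^sup>+l. grid_prob F c u y j l \<partial>G)) \<longlonglongrightarrow> prob (fall_event M c N X u y)"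
    unfolding eq by (rule lim) auto
  show "(\<integral>\<^sup>+l. grid_prob F c u y j l \<partial>G) \<le> 1"
    unfolding eq by (rule lim) auto
qed

end

section \<open>Restarting the process at a fixed rate\<close>

locale pure_model = mixture_model M "return borel l" F N X
  for M :: "'a measure" and l :: real and F N X +
  assumes l_nonneg: "0 \<le> l"
begin

lemma grid_prob_limit:
  assumes "c > 0" "y \<ge> 0"
  shows "(\<lambda>j. enn2real (grid_prob F c u y j l)) \<longlonglongrightarrow> prob (fall_event M c N X u y)"
    and "grid_prob F c u y j l \<le> 1"
  using fall_event_limit(2,3)[OF assms, of u] by (simp_all add: nn_integral_return)

text \<open>On every grid the shifted event has \<open>exp (- (l * h))\<close> times the probability
  of the unshifted one, so uniqueness of limits gives the Markov property without conditional
  probabilities.\<close>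

lemma prob_shifted_fall_0:
  assumes "c > 0" "h \<ge> 0" "y \<ge> 0"
  shows "{\<omega>\<in>space M. N h \<omega> = 0 \<and> falls_below c (\<lambda>t. N (h + t) \<omega> - N h \<omega>) (\<lambda>i. X i \<omega>) u y} \<in> events"
      (is "?S \<in> _")
    and "prob {\<omega>\<in>space M. N h \<omega> = 0 \<and> falls_below c (\<lambda>t. N (h + t) \<omega> - N h \<omega>) (\<lambda>i. X i \<omega>) u y} =
      exp (- (l * h)) * prob (fall_event M c N X u y)"
proof -
  note lim = shifted_fall[where k = 0 and P = "\<lambda>_. True" and w = "\<lambda>_. u", OF assms]
  show "?S \<in> events" using lim(1) by simp
  have "(\<lambda>j. enn2real (\<integral>\<^sup>+l. ennreal (poisson_weight (l * h) 0) * grid_prob F c u y j l \<partial>return borel l))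
      \<longlonglongrightarrow> prob ?S"
    using lim(2) by (simp add: grid_prob_def grid_set_def[abs_def])
  then have "(\<lambda>j. exp (- (l * h)) * enn2real (grid_prob F c u y j l)) \<longlonglongrightarrow> prob ?S"
    by (simp add: nn_integral_return enn2real_mult poisson_weight_def)
  moreover have "(\<lambda>j. exp (- (l * h)) * enn2real (grid_prob F c u y j l))
      \<longlonglongrightarrow> exp (- (l * h)) * prob (fall_event M c N X u y)"
    by (intro tendsto_intros grid_prob_limit assms)
  ultimately show "prob ?S = exp (- (l * h)) * prob (fall_event M c N X u y)"
    by (rule LIMSEQ_unique)
qed

text \<open>An i.i.d. sequence is its first member followed by an independent copy of
  itself.\<close>

lemma emeasure_claims_law_case_nat:
  assumes A: "A \<in> sets (PiM UNIV (\<lambda>_. borel))"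
  shows "emeasure (claims_law F) A =
    (\<integral>\<^sup>+s. emeasure (claims_law F) {x. case_nat s x \<in> A} \<partial>interval_measure F)"
proof -
  interpret S: sequence_space "interval_measure F"
    by unfold_locales
  interpret P: prob_space "claims_law F"
    unfolding claims_law_def by (intro prob_space_PiM claim.prob_space_axioms)
  have A': "A \<in> sets (claims_law F)" using A by (simp add: sets_claims_law)
  have m: "(\<lambda>(s, \<omega>). case_nat s \<omega>) \<in> measurable (interval_measure F \<Otimes>\<^sub>M claims_law F) (claims_law F)"
    unfolding claims_law_def by measurable
  have eq: "claims_law F = distr (interval_measure F \<Otimes>\<^sub>M claims_law F) (claims_law F) (\<lambda>(s, \<omega>). case_nat s \<omega>)"
    using S.PiM_iter unfolding claims_law_def by simp
  have sp: "space (claims_law F) = UNIV" by (simp add: claims_law_def space_PiM)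
  have "emeasure (claims_law F) A = emeasure (interval_measure F \<Otimes>\<^sub>M claims_law F)
      ((\<lambda>(s, \<omega>). case_nat s \<omega>) -` A \<inter> space (interval_measure F \<Otimes>\<^sub>M claims_law F))"
    by (subst eq, rule emeasure_distr[OF m A'])
  also have "\<dots> = (\<integral>\<^sup>+s. emeasure (claims_law F) (Pair s -`
      ((\<lambda>(s, \<omega>). case_nat s \<omega>) -` A \<inter> space (interval_measure F \<Otimes>\<^sub>M claims_law F))) \<partial>interval_measure F)"
    by (rule P.emeasure_pair_measure_alt[OF measurable_sets[OF m A']])
  also have "\<dots> = (\<integral>\<^sup>+s. emeasure (claims_law F) {x. case_nat s x \<in> A} \<partial>interval_measure F)"
    by (intro nn_integral_cong arg_cong[where f="emeasure _"])
      (auto simp: space_pair_measure sp)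
  finally show ?thesis .
qed

lemma borel_measurable_emeasure_grid_set[measurable]:
  "(\<lambda>s. emeasure (claims_law F) (grid_set c (a - s) y j v)) \<in> borel_measurable borel"
proof -
  interpret S: sequence_space "interval_measure F"
    by unfold_locales
  interpret P: prob_space "claims_law F"
    unfolding claims_law_def by (intro prob_space_PiM claim.prob_space_axioms)
  have sp: "space (claims_law F) = UNIV" by (simp add: claims_law_def space_PiM)
  define B where "B = {p\<in>space (borel \<Otimes>\<^sub>M claims_law F). grid_falls_below c (grid_width j) (grid_steps j)
      (\<lambda>i. sum_list (take i v)) (snd p) (a - fst p) y}"
  have "B \<in> sets (borel \<Otimes>\<^sub>M claims_law F)"
    unfolding B_def pred_def[symmetric]
  proof (rule pred_grid_falls_below)
    show "snd \<in> borel \<Otimes>\<^sub>M claims_law F \<rightarrow>\<^sub>M PiM UNIV (\<lambda>_. borel)"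
      using measurable_snd[of borel "claims_law F"] by (simp add: measurable_cong_sets[OF refl sets_claims_law])
  qed measurable
  from P.measurable_emeasure_Pair[OF this]
  show ?thesis by (simp add: B_def vimage_def space_pair_measure sp grid_set_def)
qed

text \<open>Once the first claim \<open>s\<close> is split off, the remaining claims have the
  original law, so the grid probability is that of a fall from capital \<open>a - s\<close>. The
  third fact is recorded here because measurability in the capital comes out of the same
  limit.\<close>

lemma prob_shifted_fall_1:
  assumes "c > 0" "h \<ge> 0" "y \<ge> 0"
  shows "{\<omega>\<in>space M. N h \<omega> = 1 \<and> X 0 \<omega> \<le> u \<and>
      falls_below c (\<lambda>t. N (h + t) \<omega> - N h \<omega>) (\<lambda>i. X (1 + i) \<omega>) (a - X 0 \<omega>) y} \<in> events"
      (is "?S \<in> _")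
    and "prob {\<omega>\<in>space M. N h \<omega> = 1 \<and> X 0 \<omega> \<le> u \<and>
      falls_below c (\<lambda>t. N (h + t) \<omega> - N h \<omega>) (\<lambda>i. X (1 + i) \<omega>) (a - X 0 \<omega>) y} =
      l * h * exp (- (l * h)) *
      (LINT s|interval_measure F. indicator {..u} s * prob (fall_event M c N X (a - s) y))"
    and "(\<lambda>s. prob (fall_event M c N X (a - s) y)) \<in> borel_measurable borel"
proof -
  define Z where "Z j v = {x. x 0 \<le> u \<and> grid_falls_below c (grid_width j) (grid_steps j)
      (\<lambda>i. sum_list (take i v)) (\<lambda>i. x (1 + i)) (a - x 0) y}" for j v
  have m0: "(\<lambda>x. x 0) \<in> borel_measurable (PiM UNIV (\<lambda>_::nat. borel :: real measure))"
    by (rule measurable_component_singleton) simp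
  note lim = shifted_fall[where k = 1 and P = "\<lambda>x. x 0 \<le> u" and w = "\<lambda>x. a - x 0", OF assms,
      folded Z_def]
  have P: "Measurable.pred (PiM UNIV (\<lambda>_::nat. borel)) (\<lambda>x. x 0 \<le> u)"
    and w: "(\<lambda>x. a - x 0) \<in> borel_measurable (PiM UNIV (\<lambda>_::nat. borel :: real measure))"
    using m0 by measurable
  show "?S \<in> events" using lim(1)[OF P w] by simp
  have Z: "Z j v \<in> sets (PiM UNIV (\<lambda>_. borel))" for j v
  proof -
    have "(\<lambda>x i. x (1 + i)) \<in> measurable (PiM UNIV (\<lambda>_. borel)) (PiM UNIV (\<lambda>_. borel :: real measure))"
      by (rule measurable_PiM_single') (auto intro!: measurable_component_singleton)
    then have "{x\<in>space (PiM UNIV (\<lambda>_. borel)). x 0 \<le> u \<and> grid_falls_below c (grid_width j) (grid_steps j)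
      (\<lambda>i. sum_list (take i v)) (\<lambda>i. x (1 + i)) (a - x 0) y} \<in> sets (PiM UNIV (\<lambda>_. borel :: real measure))"
      unfolding pred_def[symmetric] by (intro pred_intros_logic pred_grid_falls_below P w)
    then show ?thesis by (simp add: Z_def space_PiM)
  qed
  have meas: "(\<lambda>s. grid_prob F c (a - s) y j l) \<in> borel_measurable borel" for j
  proof -
    interpret sigma_finite_measure "count_space {v::nat list. length v = K}" for K
      by (rule sigma_finite_measure_count_space_countable) auto
    have "(\<lambda>(s, v). ennreal (list_weight (l * grid_width j) v) * emeasure (claims_law F) (grid_set c (a - s) y j v))
      \<in> borel_measurable (borel \<Otimes>\<^sub>M count_space {v. length v = grid_steps j})"
      by (subst measurable_pair_swap_iff, rule measurable_pair_measure_countable1) auto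
    then show ?thesis unfolding grid_prob_def skeleton_prob_def by measurable
  qed
  have skel: "skeleton_prob F (l * grid_width j) (grid_steps j) (Z j) =
      (\<integral>\<^sup>+s. indicator {..u} s * grid_prob F c (a - s) y j l \<partial>interval_measure F)" for j
  proof -
    have "emeasure (claims_law F) (Z j v) =
        (\<integral>\<^sup>+s. indicator {..u} s * emeasure (claims_law F) (grid_set c (a - s) y j v) \<partial>interval_measure F)" for v
      by (subst emeasure_claims_law_case_nat[OF Z], intro nn_integral_cong)
        (auto simp: Z_def grid_set_def indicator_def)
    then have "skeleton_prob F (l * grid_width j) (grid_steps j) (Z j) =
        (\<integral>\<^sup>+v. (\<integral>\<^sup>+s. ennreal (list_weight (l * grid_width j) v) *
          (indicator {..u} s * emeasure (claims_law F) (grid_set c (a - s) y j v)) \<partial>interval_measure F)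
          \<partial>count_space {v. length v = grid_steps j})"
      unfolding skeleton_prob_def by (simp add: nn_integral_cmult)
    also have "\<dots> = (\<integral>\<^sup>+s. (\<integral>\<^sup>+v. ennreal (list_weight (l * grid_width j) v) *
          (indicator {..u} s * emeasure (claims_law F) (grid_set c (a - s) y j v))
          \<partial>count_space {v. length v = grid_steps j}) \<partial>interval_measure F)"
      by (rule nn_integral_count_space_nn_integral[symmetric]) auto
    also have "\<dots> = (\<integral>\<^sup>+s. indicator {..u} s * grid_prob F c (a - s) y j l \<partial>interval_measure F)"
      unfolding grid_prob_def skeleton_prob_def
      by (simp add: nn_integral_cmult[symmetric] mult.left_commute)
    finally show ?thesis .
  qed
  define r where "r j s = enn2real (grid_prob F c (a - s) y j l)" for j s
  have r: "grid_prob F c (a - s) y j l = ennreal (r j s)" "0 \<le> r j s" "r j s \<le> 1" for j s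
  proof -
    have le: "grid_prob F c (a - s) y j l \<le> 1" by (rule grid_prob_limit(2)[OF assms(1,3)])
    then have "grid_prob F c (a - s) y j l < top" using le_less_trans by fastforce
    then show "grid_prob F c (a - s) y j l = ennreal (r j s)" by (simp add: r_def)
    show "0 \<le> r j s" by (simp add: r_def)
    show "r j s \<le> 1" using enn2real_mono[OF le] by (simp add: r_def)
  qed
  have [measurable]: "r j \<in> borel_measurable borel" for j
    unfolding r_def using meas[of j] by measurable
  have rlim: "(\<lambda>j. r j s) \<longlonglongrightarrow> prob (fall_event M c N X (a - s) y)" for s
    unfolding r_def by (rule grid_prob_limit(1)[OF assms(1,3)])
  show meas_prob[measurable]: "(\<lambda>s. prob (fall_event M c N X (a - s) y)) \<in> borel_measurable borel"
    by (rule borel_measurable_LIMSEQ_real[OF rlim]) simp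
  have int: "enn2real (\<integral>\<^sup>+s. indicator {..u} s * grid_prob F c (a - s) y j l \<partial>interval_measure F) =
      (LINT s|interval_measure F. indicator {..u} s * r j s)" for j
  proof -
    have "integrable (interval_measure F) (\<lambda>s. indicator {..u} s * r j s)"
      by (rule claim.integrable_const_bound[where B=1]) (auto simp: indicator_def r)
    then have "(\<integral>\<^sup>+s. ennreal (indicator {..u} s * r j s) \<partial>interval_measure F) =
        ennreal (LINT s|interval_measure F. indicator {..u} s * r j s)"
      by (intro nn_integral_eq_integral) (auto simp: r)
    moreover have "(\<integral>\<^sup>+s. indicator {..u} s * grid_prob F c (a - s) y j l \<partial>interval_measure F) =
        (\<integral>\<^sup>+s. ennreal (indicator {..u} s * r j s) \<partial>interval_measure F)"
      by (intro nn_integral_cong) (auto simp: r(1) indicator_def)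
    ultimately show ?thesis
      by (simp add: r(2) Bochner_Integration.integral_nonneg)
  qed
  have "(\<lambda>j. l * h * exp (- (l * h)) * (LINT s|interval_measure F. indicator {..u} s * r j s)) \<longlonglongrightarrow>
      l * h * exp (- (l * h)) *
      (LINT s|interval_measure F. indicator {..u} s * prob (fall_event M c N X (a - s) y))"
  proof (intro tendsto_intros integral_dominated_convergence[where w = "\<lambda>_. 1"])
    show "AE s in interval_measure F. (\<lambda>j. indicator {..u} s * r j s)
        \<longlonglongrightarrow> indicator {..u} s * prob (fall_event M c N X (a - s) y)"
      by (intro AE_I2 tendsto_intros rlim)
  qed (auto simp: indicator_def r)
  moreover have "(\<lambda>j. l * h * exp (- (l * h)) * (LINT s|interval_measure F. indicator {..u} s * r j s))
      \<longlonglongrightarrow> prob ?S"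
  proof -
    have "enn2real (\<integral>\<^sup>+l. ennreal (poisson_weight (l * h) 1) *
      skeleton_prob F (l * grid_width j) (grid_steps j) (Z j) \<partial>return borel l) =
      l * h * exp (- (l * h)) * (LINT s|interval_measure F. indicator {..u} s * r j s)" for j
      using l_nonneg \<open>h \<ge> 0\<close>
      by (subst nn_integral_return) (auto simp: enn2real_mult skel int poisson_weight_def)
    then show ?thesis using lim(2)[OF P w] by simp
  qed
  ultimately show "prob ?S = l * h * exp (- (l * h)) *
      (LINT s|interval_measure F. indicator {..u} s * prob (fall_event M c N X (a - s) y))"
    by (rule LIMSEQ_unique[rotated])
qed

end

text \<open>Both sides are limits of expressions in the same \<open>grid_prob\<close>, bounded by 1,
  so the limit passes under the integral. Measurability in \<open>l\<close> is obtained as that of a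
  pointwise limit. The indicator is present because \<open>Q l\<close> is a model for nonnegative
  rates.\<close>

lemma (in mixture_model) prob_fall_event_mixture:
  fixes Q :: "real \<Rightarrow> 'b measure"
  assumes "c > 0" "y \<ge> 0"
    and pure: "\<And>l. l \<ge> 0 \<Longrightarrow> pure_model (Q l) l F (K l) (Y l)"
  shows "(\<lambda>l. indicator {0..} l * measure (Q l) (fall_event (Q l) c (K l) (Y l) u y)) \<in> borel_measurable borel"
    and "prob (fall_event M c N X u y) =
      (LINT l|G. indicator {0..} l * measure (Q l) (fall_event (Q l) c (K l) (Y l) u y))"
proof -
  define r where "r j l = indicator {0..} l * enn2real (grid_prob F c u y j l)" for j l
  define p where "p l = indicator {0..} l * measure (Q l) (fall_event (Q l) c (K l) (Y l) u y)" for l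
  have [measurable]: "r j \<in> borel_measurable borel" for j
    unfolding r_def by measurable
  have le: "grid_prob F c u y j l \<le> 1" if "0 \<le> l" for j l
    by (rule pure_model.grid_prob_limit(2)[OF pure[OF that] assms(1,2)])
  have r: "0 \<le> r j l" "r j l \<le> 1" for j l
    using enn2real_mono[OF le[of l j]] by (auto simp: r_def indicator_def)
  have rlim: "(\<lambda>j. r j l) \<longlonglongrightarrow> p l" for l
  proof (cases "0 \<le> l")
    case True
    then show ?thesis using pure_model.grid_prob_limit(1)[OF pure[OF True] assms(1,2), of u]
      by (simp add: r_def p_def)
  qed (simp add: r_def p_def)
  show meas: "p \<in> borel_measurable borel"
    by (rule borel_measurable_LIMSEQ_real[OF rlim]) simp
  have "(\<lambda>j. LINT l|G. r j l) \<longlonglongrightarrow> (LINT l|G. p l)"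
    by (rule integral_dominated_convergence[where w = "\<lambda>_. 1"])
      (auto simp: r rlim meas measurable_cong_sets[OF sets_G refl])
  moreover have "(LINT l|G. r j l) = enn2real (\<integral>\<^sup>+l. grid_prob F c u y j l \<partial>G)" for j
  proof -
    have "(\<integral>\<^sup>+l. ennreal (r j l) \<partial>G) = ennreal (LINT l|G. r j l)"
      by (intro nn_integral_eq_integral mix.integrable_const_bound[where B=1]) (auto simp: r measurable_cong_sets[OF sets_G refl])
    moreover have "(\<integral>\<^sup>+l. ennreal (r j l) \<partial>G) = (\<integral>\<^sup>+l. grid_prob F c u y j l \<partial>G)"
    proof (intro nn_integral_cong_AE)
      show "AE l in G. ennreal (r j l) = grid_prob F c u y j l"
        using nonneg_G
      proof eventually_elim
        case (elim l)
        have "grid_prob F c u y j l < top" by (rule le_less_trans[OF le[OF elim]]) simp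
        then show ?case using elim by (simp add: r_def)
      qed
    qed
    ultimately show ?thesis
      by (metis enn2real_ennreal Bochner_Integration.integral_nonneg r(1))
  qed
  ultimately show "prob (fall_event M c N X u y) = (LINT l|G. p l)"
    using fall_event_limit(2)[OF assms(1,2), of u] by (simp add: LIMSEQ_unique)
qed

section \<open>Defective renewal equations\<close>

lemma filterlim_add_const_at_top: "filterlim (\<lambda>u::real. u + t) at_top at_top"
proof -
  have "filterlim (\<lambda>u::real. t + u) at_top at_top"
    by (rule filterlim_tendsto_add_at_top[OF tendsto_const filterlim_ident])
  then show ?thesis by (simp add: add.commute)
qed

text \<open>A fundamental theorem for a Lipschitz function whose quotients are controlled from the
  right and along the steps \<open>c / real (Suc n)\<close> only. The integrated quotient telescopes
  into quotients of an antiderivative at the two end points, and these converge because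
  \<open>m\<close> is continuous.\<close>

lemma increment_quotient_integral:
  fixes m g :: "real \<Rightarrow> real"
  assumes "c > 0" "U \<ge> 0" "L \<ge> 0"
    and lip: "\<And>v t. t \<ge> 0 \<Longrightarrow> \<bar>m (v + t) - m v\<bar> \<le> L * t"
    and lim: "\<And>v. 0 \<le> v \<Longrightarrow> v \<le> U \<Longrightarrow>
      (\<lambda>n. real (Suc n) * (m (v + c / real (Suc n)) - m v)) \<longlonglongrightarrow> g v"
    and [measurable]: "g \<in> borel_measurable borel"
  shows "c * (m U - m 0) = (LINT v|lborel. indicator {0..U} v * g v)"
proof -
  have cont: "continuous_on UNIV m"
  proof (rule lipschitz_on_continuous_on)
    show "L-lipschitz_on UNIV m"
    proof (rule lipschitz_onI)
      fix x y :: real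
      show "dist (m x) (m y) \<le> L * dist x y"
        using lip[of "y - x" x] lip[of "x - y" y] by (cases "x \<le> y") (auto simp: dist_real_def abs_minus_commute)
    qed (rule \<open>L \<ge> 0\<close>)
  qed
  then have [measurable]: "m \<in> borel_measurable borel" by (rule borel_measurable_continuous_onI)
  \<comment> \<open>Starting at -1 makes 0 an interior point, so the antiderivative is
    differentiable there.\<close>
  define \<Phi> where "\<Phi> x = integral {-1..x} m" for x
  have deriv: "(\<Phi> has_real_derivative m x) (at x)" if "-1 < x" for x
  proof -
    have "(\<Phi> has_vector_derivative m x) (at x within {-1..x+1})"
      unfolding \<Phi>_def using that cont
      by (intro integral_has_vector_derivative) (auto intro: continuous_on_subset)
    moreover have "at x within {-1..x+1} = at x"
      using that by (intro at_within_interior) auto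
    ultimately show ?thesis by (simp add: has_real_derivative_iff_has_vector_derivative)
  qed
  define d where "d n = c / real (Suc n)" for n
  have d: "d n > 0" for n using \<open>c > 0\<close> by (simp add: d_def)
  have d0: "d \<longlonglongrightarrow> 0"
    unfolding d_def using tendsto_mult[OF tendsto_const[of c] LIMSEQ_inverse_real_of_nat]
    by (simp add: divide_inverse)
  have int: "(LINT v|lborel. indicator {0..U} v * m (v + e)) = \<Phi> (U + e) - \<Phi> e" if "e \<ge> 0" for e
  proof -
    have c: "continuous_on {0..U} (\<lambda>v. m (v + e))"
      by (intro continuous_on_compose2[OF cont] continuous_intros) auto
    have "((\<lambda>v. m (v + e)) has_integral (\<Phi> (U + e) - \<Phi> (0 + e))) {0..U}"
    proof (rule fundamental_theorem_of_calculus[OF \<open>U \<ge> 0\<close>])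
      fix x assume "x \<in> {0..U}"
      then have "(\<Phi> has_real_derivative m (x + e)) (at (x + e))" using that by (intro deriv) auto
      then have "((\<lambda>v. \<Phi> (v + e)) has_real_derivative m (x + e)) (at x)"
        by (simp add: DERIV_shift)
      then show "((\<lambda>v. \<Phi> (v + e)) has_vector_derivative m (x + e)) (at x within {0..U})"
        unfolding has_real_derivative_iff_has_vector_derivative by (rule has_vector_derivative_at_within)
    qed
    moreover have "set_integrable lborel {0..U} (\<lambda>v. m (v + e))"
      by (rule borel_integrable_atLeastAtMost') (rule c)
    then have "(LINT v:{0..U}|lborel. m (v + e)) = integral {0..U} (\<lambda>v. m (v + e))"
      by (rule set_borel_integral_eq_integral)
    ultimately show ?thesis by (simp add: set_lebesgue_integral_def integral_unique)
  qed
  have intble: "integrable lborel (\<lambda>v. indicator {0..U} v * m (v + e))" for e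
  proof -
    have "set_integrable lborel {0..U} (\<lambda>v. m (v + e))"
      by (rule borel_integrable_atLeastAtMost') (intro continuous_on_compose2[OF cont] continuous_intros, auto)
    then show ?thesis by (simp add: set_integrable_def)
  qed
  define q where "q n v = real (Suc n) * (m (v + d n) - m v)" for n v
  have "(\<lambda>n. LINT v|lborel. indicator {0..U} v * q n v) \<longlonglongrightarrow> (LINT v|lborel. indicator {0..U} v * g v)"
  \<comment> \<open>The Lipschitz bound \<open>L * d n\<close>, multiplied by
    \<open>real (Suc n)\<close>, is the constant \<open>L * c\<close>.\<close>
  proof (rule integral_dominated_convergence[where w = "\<lambda>v. indicator {0..U} v * (L * c)"])
    show "AE v in lborel. (\<lambda>n. indicator {0..U} v * q n v) \<longlonglongrightarrow> indicator {0..U} v * g v"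
      using lim by (auto simp: q_def d_def indicator_def)
    show "AE v in lborel. norm (indicator {0..U} v * q n v) \<le> indicator {0..U} v * (L * c)" for n
    proof (rule AE_I2)
      fix v
      have "\<bar>q n v\<bar> \<le> real (Suc n) * (L * d n)"
        unfolding q_def abs_mult using lip[of "d n" v] d[of n] by (intro mult_mono) auto
      also have "\<dots> = L * c" by (simp add: d_def)
      finally show "norm (indicator {0..U} v * q n v) \<le> indicator {0..U} v * (L * c)"
        by (auto simp: indicator_def)
    qed
    have "set_integrable lborel {0..U} (\<lambda>v. L * c)"
      by (rule borel_integrable_atLeastAtMost') (rule continuous_on_const)
    then show "integrable lborel (\<lambda>v. indicator {0..U} v * (L * c))" by (simp only: set_integrable_def real_scaleR_def)
  qed (auto simp: q_def)
  moreover have "(LINT v|lborel. indicator {0..U} v * q n v) =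
      c * ((\<Phi> (U + d n) - \<Phi> U) / d n) - c * ((\<Phi> (0 + d n) - \<Phi> 0) / d n)" for n
  proof -
    have "(LINT v|lborel. indicator {0..U} v * q n v) =
        (LINT v|lborel. real (Suc n) * (indicator {0..U} v * m (v + d n) - indicator {0..U} v * m (v + 0)))"
      by (intro Bochner_Integration.integral_cong) (auto simp: q_def indicator_def)
    also have "\<dots> = real (Suc n) * ((\<Phi> (U + d n) - \<Phi> (d n)) - (\<Phi> (U + 0) - \<Phi> 0))"
      using intble[of "d n"] intble[of 0] int[of "d n"] int[of 0] d[of n] by simp
    also have "real (Suc n) = c / d n" using \<open>c > 0\<close> by (simp add: d_def)
    finally show ?thesis by (simp add: field_simps diff_divide_distrib[symmetric])
  qed
  moreover have "(\<lambda>n. c * ((\<Phi> (U + d n) - \<Phi> U) / d n) - c * ((\<Phi> (0 + d n) - \<Phi> 0) / d n))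
      \<longlonglongrightarrow> c * m U - c * m 0"
  proof -
    have *: "(\<lambda>n. (\<Phi> (x + d n) - \<Phi> x) / d n) \<longlonglongrightarrow> m x" if "0 \<le> x" for x
    proof -
      have "((\<lambda>h. (\<Phi> (x + h) - \<Phi> x) / h) \<longlongrightarrow> m x) (at 0)"
        using deriv[of x] that by (simp add: DERIV_def)
      moreover have "filterlim d (at 0) sequentially"
        using d0 d by (auto simp: filterlim_at less_imp_neq[symmetric])
      ultimately show ?thesis by (rule filterlim_compose)
    qed
    show ?thesis by (intro tendsto_intros *[OF \<open>U \<ge> 0\<close>] *[OF order_refl])
  qed
  ultimately show ?thesis using LIMSEQ_unique by (simp add: right_diff_distrib)
qed

locale renewal_kernel =
  fixes k :: "real \<Rightarrow> real"
  assumes k_measurable[measurable]: "k \<in> borel_measurable borel"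
    and k_nonneg: "0 \<le> k z"
    and k_neg: "z < 0 \<Longrightarrow> k z = 0"
    and k_integrable: "integrable lborel k"
    and k_mass: "(LINT z|lborel. k z) < 1"
begin

definition mass :: real where "mass = (LINT z|lborel. k z)"

definition tail :: "real \<Rightarrow> real" where "tail y = (LINT z|lborel. indicator {y..} z * k z)"

definition conv :: "(real \<Rightarrow> real) \<Rightarrow> real \<Rightarrow> real" where
  "conv f u = (LINT z|lborel. k z * f (u - z))"

lemma mass_nonneg: "0 \<le> mass" unfolding mass_def by (intro Bochner_Integration.integral_nonneg k_nonneg)

lemma mass_less_1: "mass < 1" using k_mass by (simp add: mass_def)

lemma integrable_k_mult:
  assumes [measurable]: "f \<in> borel_measurable borel" and "\<And>x. \<bar>f x\<bar> \<le> B"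
  shows "integrable lborel (\<lambda>z. k z * f z)"
proof (rule Bochner_Integration.integrable_bound)
  show "integrable lborel (\<lambda>z. k z * B)" using k_integrable by simp
  show "AE z in lborel. norm (k z * f z) \<le> norm (k z * B)"
  proof (rule AE_I2)
    fix z
    have "k z * \<bar>f z\<bar> \<le> k z * \<bar>B\<bar>" using assms(2)[of z] k_nonneg by (intro mult_left_mono) auto
    then show "norm (k z * f z) \<le> norm (k z * B)" using k_nonneg[of z] by (simp add: abs_mult)
  qed
qed simp

lemma integrable_indicator_k[simp]: "A \<in> sets borel \<Longrightarrow> integrable lborel (\<lambda>z. indicator A z * k z)"
  using integrable_k_mult[of "indicator A" 1] by (simp add: mult.commute indicator_def)

lemma tail_nonneg: "0 \<le> tail y"
  unfolding tail_def by (intro Bochner_Integration.integral_nonneg) (simp add: k_nonneg)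

lemma borel_measurable_conv[measurable]:
  assumes [measurable]: "f \<in> borel_measurable borel"
  shows "conv f \<in> borel_measurable borel"
  unfolding conv_def by measurable

lemma conv_bound:
  assumes [measurable]: "f \<in> borel_measurable borel" and "\<And>x. \<bar>f x\<bar> \<le> B"
  shows "\<bar>conv f u\<bar> \<le> mass * B"
proof -
  have i: "integrable lborel (\<lambda>z. k z * f (u - z))"
    by (rule integrable_k_mult) (use assms in auto)
  have "\<bar>conv f u\<bar> \<le> (LINT z|lborel. \<bar>k z * f (u - z)\<bar>)"
    unfolding conv_def by (rule integral_abs_bound)
  also have "\<dots> \<le> (LINT z|lborel. k z * B)"
    using k_integrable k_nonneg assms(2)
    by (intro integral_mono integrable_abs i integrable_mult_left) (auto simp: abs_mult intro!: mult_left_mono)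
  finally show ?thesis by (simp add: mass_def)
qed

text \<open>Defectiveness makes convolution a contraction with factor \<open>mass\<close> in the
  supremum norm; iterating the equation squeezes \<open>f\<close> to 0.\<close>

lemma conv_fixpoint_eq_0:
  assumes [measurable]: "f \<in> borel_measurable borel" and B: "\<And>x. \<bar>f x\<bar> \<le> B"
    and fp: "\<And>u. f u = conv f u"
  shows "f u = 0"
proof -
  have "\<bar>f x\<bar> \<le> mass ^ n * B" for n x
  proof (induction n arbitrary: x)
    case (Suc n)
    have "\<bar>conv f x\<bar> \<le> mass * (mass ^ n * B)" using Suc by (intro conv_bound) auto
    then show ?case using fp[of x] by simp
  qed (use B in simp)
  moreover have "(\<lambda>n. mass ^ n * B) \<longlonglongrightarrow> 0 * B"
    using mass_nonneg mass_less_1 by (intro tendsto_intros LIMSEQ_power_zero) auto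
  ultimately have "\<bar>f u\<bar> \<le> 0"
    by (intro LIMSEQ_le_const[where X = "\<lambda>n. mass ^ n * B" and x = 0]) auto
  then show ?thesis by simp
qed

lemma tail_interval:
  assumes "y \<le> y'"
  shows "(LINT z|lborel. indicator {y..y'} z * k z) = tail y - tail y'"
proof -
  have "tail y - tail y' = (LINT z|lborel. indicator {y..} z * k z - indicator {y'..} z * k z)"
    unfolding tail_def by simp
  also have "\<dots> = (LINT z|lborel. indicator {y..y'} z * k z)"
  proof (rule integral_cong_AE)
    show "AE z in lborel. indicator {y..} z * k z - indicator {y'..} z * k z = indicator {y..y'} z * k z"
      using AE_lborel_singleton[of y'] by eventually_elim (use assms in \<open>auto simp: indicator_def\<close>)
  qed auto
  finally show ?thesis ..
qed

lemma tail_0: "tail 0 = mass"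
  unfolding tail_def mass_def
  by (intro Bochner_Integration.integral_cong) (auto simp: indicator_def k_neg)

lemma tail_tendsto_0: "(tail \<longlongrightarrow> 0) at_top"
proof -
  have "((\<lambda>y. LINT z|lborel. indicator {y..} z * k z) \<longlongrightarrow> (LINT z::real|lborel. 0)) at_top"
  proof (rule integral_dominated_convergence_at_top[where w = k and f = "\<lambda>_. 0" and s = "\<lambda>y z. indicator {y..} z * k z"])
    show "AE z in lborel. ((\<lambda>y. indicator {y..} z * k z) \<longlongrightarrow> 0) at_top"
    proof (rule AE_I2, rule tendsto_eventually)
      fix z :: real
      show "\<forall>\<^sub>F y in at_top. indicator {y..} z * k z = 0"
        using eventually_gt_at_top[of z] by eventually_elim (simp add: indicator_def)
    qed
  qed (auto simp: k_integrable indicator_def k_nonneg)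
  then show ?thesis by (simp add: tail_def[abs_def])
qed

lemma conv_neg:
  assumes "\<And>x. x < 0 \<Longrightarrow> f x = 0" "u < 0"
  shows "conv f u = 0"
proof -
  have "k z * f (u - z) = 0" for z using assms k_neg[of z] by (cases "z < 0") auto
  then have "(\<lambda>z. k z * f (u - z)) = (\<lambda>z. 0)" by blast
  then show ?thesis unfolding conv_def by (simp only: Bochner_Integration.integral_zero)
qed

text \<open>The increment equation fixes \<open>m\<close> only up to its value at 0. As
  \<open>u\<close> grows, \<open>m\<close>, its convolution and \<open>tail\<close> vanish, and what
  is left reads \<open>m 0 = tail y\<close>.\<close>

lemma renewal_equation_of_increments:
  assumes [measurable]: "m \<in> borel_measurable borel" and B: "\<And>x. \<bar>m x\<bar> \<le> B"
    and lim: "(m \<longlongrightarrow> 0) at_top"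
    and eq: "\<And>u. 0 \<le> u \<Longrightarrow> m u - m 0 = conv m u - (tail y - tail (u + y))"
    and "0 \<le> u"
  shows "m u = conv m u + tail (u + y)"
proof -
  have conv0: "(conv m \<longlongrightarrow> 0) at_top"
  proof -
    have "((\<lambda>u. LINT z|lborel. k z * m (u - z)) \<longlongrightarrow> (LINT z::real|lborel. 0)) at_top"
    proof (rule integral_dominated_convergence_at_top[where w = "\<lambda>z. k z * B" and f = "\<lambda>_. 0"])
      show "AE z in lborel. ((\<lambda>u. k z * m (u - z)) \<longlongrightarrow> 0) at_top"
      proof (rule AE_I2)
        fix z :: real
        have "filterlim (\<lambda>u. u + (- z)) at_top at_top"
          by (rule filterlim_add_const_at_top) 
        from tendsto_mult[OF tendsto_const[of "k z"] filterlim_compose[OF lim this]]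
        show "((\<lambda>u. k z * m (u - z)) \<longlongrightarrow> 0) at_top" by simp
      qed
      show "\<forall>\<^sub>F u in at_top. AE z in lborel. norm (k z * m (u - z)) \<le> k z * B"
        by (intro always_eventually allI AE_I2) (auto simp: abs_mult k_nonneg B intro!: mult_left_mono)
    qed (auto simp: k_integrable)
    then show ?thesis by (simp add: conv_def[abs_def])
  qed
  have "((\<lambda>u. conv m u - (tail y - tail (u + y))) \<longlongrightarrow> 0 - (tail y - 0)) at_top"
    by (intro tendsto_intros conv0 filterlim_compose[OF tail_tendsto_0] filterlim_add_const_at_top)
  moreover have "((\<lambda>u. conv m u - (tail y - tail (u + y))) \<longlongrightarrow> 0 - m 0) at_top"
    by (rule Lim_transform_eventually[OF tendsto_diff[OF lim tendsto_const[of "m 0"]]])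
      (use eventually_ge_at_top[of 0] in \<open>eventually_elim, simp add: eq\<close>)
  ultimately have "m 0 = tail y" using tendsto_unique[OF trivial_limit_at_top_linorder] by fastforce
  then show ?thesis using eq[OF \<open>0 \<le> u\<close>] by simp
qed

section \<open>The deficit in terms of the ruin probability\<close>

context
  fixes \<psi> H :: "real \<Rightarrow> real" and y :: real
  assumes y: "0 \<le> y"
    and [measurable]: "\<psi> \<in> borel_measurable borel" "H \<in> borel_measurable borel"
    and \<psi>: "\<And>u. 0 \<le> \<psi> u" "\<And>u. \<psi> u \<le> 1" "\<And>u. u < 0 \<Longrightarrow> \<psi> u = 0"
    and H: "\<And>u. 0 \<le> H u" "\<And>u. H u \<le> 1" "\<And>u. u < 0 \<Longrightarrow> H u = 0"
    and \<psi>_eq: "\<And>u. 0 \<le> u \<Longrightarrow> \<psi> u = conv \<psi> u + tail u"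
    and H_eq: "\<And>u. 0 \<le> u \<Longrightarrow> H u = conv H u + tail (u + y)"
begin

text \<open>Divided by \<open>1 - mass\<close> this is the renewal function of the kernel, the sum
  of the masses that its convolution powers give to the interval from 0 to \<open>u\<close>; its
  renewal equation is \<open>conv_surv\<close>.\<close>

definition surv :: "real \<Rightarrow> real" where "surv u = indicator {0..} u * (1 - \<psi> u)"

definition shifted_conv :: "(real \<Rightarrow> real) \<Rightarrow> real \<Rightarrow> real" where
  "shifted_conv f u = (LINT w|lborel. indicator {0..} w * k (y + w) * f (u - w))"

lemma surv: "0 \<le> surv u" "surv u \<le> 1" "u < 0 \<Longrightarrow> surv u = 0"
  and surv_measurable[measurable]: "surv \<in> borel_measurable borel"
  using \<psi> unfolding surv_def by (auto simp: indicator_def)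

lemma integrable_shifted: "integrable lborel (\<lambda>w. indicator {0..} w * k (y + w))"
proof -
  have "integrable lborel (\<lambda>w. k (y + w))"
    using lborel_integrable_real_affine[OF k_integrable, of 1 y] by simp
  then show ?thesis
    by (rule Bochner_Integration.integrable_bound) (auto simp: indicator_def)
qed

lemma integrable_shifted_mult:
  assumes [measurable]: "f \<in> borel_measurable borel" and "\<And>x. \<bar>f x\<bar> \<le> B"
  shows "integrable lborel (\<lambda>w. indicator {0..} w * k (y + w) * f w)"
proof (rule Bochner_Integration.integrable_bound[OF integrable_mult_left[OF integrable_shifted, of B]])
  show "AE w in lborel. norm (indicator {0..} w * k (y + w) * f w) \<le> norm (indicator {0..} w * k (y + w) * B)"
  proof (rule AE_I2)
    fix w
    have "k (y + w) * \<bar>f w\<bar> \<le> k (y + w) * \<bar>B\<bar>"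
      using assms(2)[of w] k_nonneg by (intro mult_left_mono) auto
    then show "norm (indicator {0..} w * k (y + w) * f w) \<le> norm (indicator {0..} w * k (y + w) * B)"
      using k_nonneg[of "y + w"] by (auto simp: abs_mult indicator_def)
  qed
qed simp

lemma integral_shifted_upto:
  assumes "0 \<le> u"
  shows "(LINT w|lborel. indicator {0..} w * k (y + w) * indicator {0..} (u - w)) = tail y - tail (u + y)"
proof -
  have "(LINT w|lborel. indicator {0..} w * k (y + w) * indicator {0..} (u - w)) =
      (LINT w|lborel. indicator {y..u + y} (y + 1 * w) * k (y + 1 * w))"
    by (intro Bochner_Integration.integral_cong) (auto simp: indicator_def)
  also have "\<dots> = (LINT z|lborel. indicator {y..u + y} z * k z)"
    using lborel_integral_real_affine[of 1 "\<lambda>z. indicator {y..u + y} z * k z" y] by simp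
  also have "\<dots> = tail y - tail (u + y)" using assms by (intro tail_interval) simp
  finally show ?thesis .
qed

lemma conv_surv:
  "conv surv u = surv u - (1 - mass) * indicator {0..} u"
proof (cases "0 \<le> u")
  case True
  have "conv surv u = (LINT z|lborel. indicator {0..u} z * k z - k z * \<psi> (u - z))"
    unfolding conv_def
    by (intro Bochner_Integration.integral_cong) (auto simp: surv_def indicator_def k_neg \<psi>(3) algebra_simps)
  also have "\<dots> = (LINT z|lborel. indicator {0..u} z * k z) - conv \<psi> u"
    unfolding conv_def
    by (intro Bochner_Integration.integral_diff integrable_k_mult[where B=1]) (auto simp: \<psi> abs_of_nonneg)
  also have "(LINT z|lborel. indicator {0..u} z * k z) = mass - tail u"
    using True by (simp add: tail_interval tail_0)
  finally have "conv surv u = mass - tail u - conv \<psi> u" .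
  moreover have "surv u = 1 - \<psi> u" using True by (simp add: surv_def)
  ultimately show ?thesis using True \<psi>_eq[OF True] by simp
next
  case False
  then show ?thesis using conv_neg[of surv u] surv(3) by auto
qed

lemma borel_measurable_shifted_conv[measurable]:
  assumes [measurable]: "f \<in> borel_measurable borel"
  shows "shifted_conv f \<in> borel_measurable borel"
  unfolding shifted_conv_def by measurable

text \<open>Both operators are convolutions with integrable kernels, hence they commute by
  Fubini.\<close>

lemma conv_shifted_conv:
  "conv (shifted_conv surv) u = shifted_conv (conv surv) u"
proof -
  have "conv (shifted_conv surv) u =
      (LINT z|lborel. LINT w|lborel. k z * (indicator {0..} w * k (y + w) * surv (u - z - w)))"
    unfolding conv_def shifted_conv_def by simp
  also have "\<dots> = (LINT w|lborel. LINT z|lborel. k z * (indicator {0..} w * k (y + w) * surv (u - z - w)))"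
  proof (rule lborel_pair.Fubini_integral[symmetric])
    have "integrable (lborel \<Otimes>\<^sub>M lborel) (\<lambda>(z, w). k z * (indicator {0..} w * k (y + w)))"
      using k_integrable integrable_shifted
      by (intro lborel_pair.Fubini_integrable) (auto simp: abs_mult)
    then show "integrable (lborel \<Otimes>\<^sub>M lborel) (\<lambda>(z, w). k z * (indicator {0..} w * k (y + w) * surv (u - z - w)))"
    proof (rule Bochner_Integration.integrable_bound)
      show "AE x in lborel \<Otimes>\<^sub>M lborel. norm (case x of (z, w) \<Rightarrow> k z * (indicator {0..} w * k (y + w) * surv (u - z - w)))
        \<le> norm (case x of (z, w) \<Rightarrow> k z * (indicator {0..} w * k (y + w)))"
        by (rule AE_I2) (auto simp: abs_mult indicator_def k_nonneg surv intro!: mult_left_mono mult_left_le)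
    qed measurable
  qed
  also have "\<dots> = shifted_conv (conv surv) u"
    unfolding conv_def shifted_conv_def
    by (intro Bochner_Integration.integral_cong refl, subst integral_mult_right_zero[symmetric])
      (auto intro!: Bochner_Integration.integral_cong simp: algebra_simps)
  finally show ?thesis .
qed

text \<open>
  The difference of the two sides is a bounded fixed point of \<^const>\<open>conv\<close>, hence zero.
\<close>

lemma renewal_formula:
  assumes u: "0 \<le> u"
  shows "(1 - mass) * H u = surv u * tail y - shifted_conv surv u"
proof -
  \<comment> \<open>Origin of the right-hand side: renewal theory represents \<open>H u\<close> as
    the integral of \<open>tail (u + y - z)\<close> against the renewal measure in \<open>z\<close>.
    Integration by parts turns this into a boundary term and an integral of the renewal function
    against \<open>k (y + w)\<close>.\<close>
  define f where "f u = (1 - mass) * H u - surv u * tail y + shifted_conv surv u" for u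
  have shifted_bound: "\<bar>shifted_conv surv u\<bar> \<le> (LINT w|lborel. indicator {0..} w * k (y + w))" for u
  proof -
    have "\<bar>shifted_conv surv u\<bar> \<le> (LINT w|lborel. \<bar>indicator {0..} w * k (y + w) * surv (u - w)\<bar>)"
      unfolding shifted_conv_def by (rule integral_abs_bound)
    also have "\<dots> \<le> (LINT w|lborel. indicator {0..} w * k (y + w))"
      using integrable_shifted_mult[of "\<lambda>w. surv (u - w)" 1] surv k_nonneg
      by (intro integral_mono integrable_shifted)
        (auto simp: abs_mult indicator_def intro!: mult_left_le)
    finally show ?thesis .
  qed
  have [measurable]: "f \<in> borel_measurable borel" unfolding f_def by measurable
  have bound: "\<bar>f u\<bar> \<le> 1 + tail y + (LINT w|lborel. indicator {0..} w * k (y + w))" for u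
  proof -
    have "\<bar>(1 - mass) * H u\<bar> \<le> 1"
      using mass_nonneg mass_less_1 H by (auto simp: abs_mult intro!: mult_le_one)
    moreover have "\<bar>surv u * tail y\<bar> \<le> tail y"
      using surv tail_nonneg by (auto simp: abs_mult intro!: mult_left_le_one_le)
    ultimately show ?thesis using shifted_bound[of u] unfolding f_def by linarith
  qed
  have "f u = conv f u" for u
  proof (cases "0 \<le> u")
    case False
    have f0: "f x = 0" if "x < 0" for x
    proof -
      have "shifted_conv surv x = (LINT w::real|lborel. 0)"
        unfolding shifted_conv_def using that
        by (intro Bochner_Integration.integral_cong) (auto simp: indicator_def surv)
      then show ?thesis using that by (simp add: f_def surv H)
    qed
    then show ?thesis using False conv_neg[of f u] by simp
  next
    case True
    have i1: "integrable lborel (\<lambda>z. k z * H (u - z))" "integrable lborel (\<lambda>z. k z * surv (u - z))"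
      by (rule integrable_k_mult[where B=1]; use H surv in \<open>auto simp: abs_of_nonneg\<close>)+
    have i2: "integrable lborel (\<lambda>z. k z * shifted_conv surv (u - z))"
      by (rule integrable_k_mult[OF _ shifted_bound]) measurable
    have "conv f u = (LINT z|lborel. (1 - mass) * (k z * H (u - z)) - tail y * (k z * surv (u - z))
        + k z * shifted_conv surv (u - z))"
      unfolding conv_def f_def by (intro Bochner_Integration.integral_cong) (auto simp: algebra_simps)
    also have "\<dots> = (1 - mass) * conv H u - tail y * conv surv u + conv (shifted_conv surv) u"
      unfolding conv_def using i1 i2 by simp
    \<comment> \<open>The indicator term of \<open>conv_surv\<close> produces
      \<open>tail y - tail (u + y)\<close> here; these tails cancel against those contributed by the
      equations for \<open>H\<close> and \<open>surv\<close>.\<close>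
    also have "conv (shifted_conv surv) u = shifted_conv surv u - (1 - mass) * (tail y - tail (u + y))"
    proof -
      have "shifted_conv (conv surv) u = (LINT w|lborel. indicator {0..} w * k (y + w) * surv (u - w) -
          (1 - mass) * (indicator {0..} w * k (y + w) * indicator {0..} (u - w)))"
        unfolding shifted_conv_def conv_surv
        by (intro Bochner_Integration.integral_cong) (auto simp: algebra_simps)
      also have "\<dots> = shifted_conv surv u - (1 - mass) * (tail y - tail (u + y))"
        unfolding integral_shifted_upto[OF True, symmetric] shifted_conv_def
        using integrable_shifted_mult[of "\<lambda>w. surv (u - w)" 1]
          integrable_shifted_mult[of "\<lambda>w. indicator {0..} (u - w)" 1] surv
        by (subst Bochner_Integration.integral_diff) (auto simp: abs_of_nonneg)
      finally show ?thesis by (simp add: conv_shifted_conv)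
    qed
    also have "conv H u = H u - tail (u + y)" using H_eq[OF True] by simp
    also have "conv surv u = surv u - (1 - mass)" using True by (simp add: conv_surv)
    also have "(1 - mass) * (H u - tail (u + y)) - tail y * (surv u - (1 - mass)) +
        (shifted_conv surv u - (1 - mass) * (tail y - tail (u + y))) = f u"
      unfolding f_def by (simp add: algebra_simps)
    finally show ?thesis ..
  qed
  from conv_fixpoint_eq_0[OF _ bound this]
  have "f u = 0" by simp
  then show ?thesis by (simp add: f_def)
qed

text \<open>The subtracted convolution is nonnegative and survival is at most 1. The bound is
  uniform in \<open>u\<close>; it later confines the deficits to the range of the claim
  sizes.\<close>

lemma deficit_bound:
  assumes "0 \<le> u"
  shows "(1 - mass) * H u \<le> tail y"
proof -
  have "0 \<le> shifted_conv surv u"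
    unfolding shifted_conv_def using surv k_nonneg by (intro Bochner_Integration.integral_nonneg) simp
  then have "(1 - mass) * H u \<le> surv u * tail y" using renewal_formula[OF assms] by simp
  also have "\<dots> \<le> tail y" using surv tail_nonneg by (intro mult_left_le_one_le) auto
  finally show ?thesis .
qed

text \<open>The renewal equation of \<open>\<psi>\<close> at \<open>u + y\<close> trades the
  integral over \<open>z \<ge> y\<close> for one over \<open>z < y\<close>. The gain is that every
  remaining argument \<open>u + y - z\<close> exceeds \<open>u\<close>, so the asymptotics of
  \<open>\<psi>\<close> apply throughout.\<close>

lemma deficit_formula:
  assumes u: "0 \<le> u"
  shows "(1 - mass) * H u =
    \<psi> (u + y) - \<psi> u * tail y - (LINT z|lborel. indicator {..<y} z * k z * \<psi> (u + y - z))"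
proof -
  have i: "integrable lborel (\<lambda>w. indicator {0..} w * k (y + w) * indicator {0..} (u - w))"
      "integrable lborel (\<lambda>w. indicator {0..} w * k (y + w) * \<psi> (u - w))"
    by (rule integrable_shifted_mult[where B=1]; use \<psi> in \<open>auto simp: abs_of_nonneg\<close>)+
  have "shifted_conv surv u = (LINT w|lborel. indicator {0..} w * k (y + w) * indicator {0..} (u - w)
      - indicator {0..} w * k (y + w) * \<psi> (u - w))"
    unfolding shifted_conv_def
    by (intro Bochner_Integration.integral_cong) (auto simp: surv_def indicator_def \<psi>(3) algebra_simps)
  also have "\<dots> = tail y - tail (u + y) - (LINT w|lborel. indicator {0..} w * k (y + w) * \<psi> (u - w))"
    using i by (simp add: integral_shifted_upto[OF u])
  also have "(LINT w|lborel. indicator {0..} w * k (y + w) * \<psi> (u - w)) =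
      (LINT w|lborel. indicator {y..} (y + 1 * w) * k (y + 1 * w) * \<psi> (u + y - (y + 1 * w)))"
    by (intro Bochner_Integration.integral_cong) (auto simp: indicator_def)
  also have "\<dots> = (LINT z|lborel. indicator {y..} z * k z * \<psi> (u + y - z))"
    using lborel_integral_real_affine[of 1 "\<lambda>z. indicator {y..} z * k z * \<psi> (u + y - z)" y] by simp
  also have "\<dots> = (LINT z|lborel. k z * \<psi> (u + y - z) - indicator {..<y} z * k z * \<psi> (u + y - z))"
    by (intro Bochner_Integration.integral_cong) (auto simp: indicator_def)
  also have "\<dots> = conv \<psi> (u + y) - (LINT z|lborel. indicator {..<y} z * k z * \<psi> (u + y - z))"
  proof -
    have "integrable lborel (\<lambda>z. k z * \<psi> (u + y - z))"
      by (rule integrable_k_mult[where B=1]) (auto simp: \<psi> abs_of_nonneg)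
    moreover have "integrable lborel (\<lambda>z. k z * (indicator {..<y} z * \<psi> (u + y - z)))"
      by (rule integrable_k_mult[where B=1]) (auto simp: \<psi> abs_of_nonneg indicator_def)
    ultimately show ?thesis
      unfolding conv_def by (simp add: mult.left_commute mult.assoc)
  qed
  finally have "shifted_conv surv u = tail y - tail (u + y) -
      (conv \<psi> (u + y) - (LINT z|lborel. indicator {..<y} z * k z * \<psi> (u + y - z)))" .
  then show ?thesis
    using renewal_formula[OF u] \<psi>_eq[of "u + y"] u y by (simp add: surv_def algebra_simps)
qed

lemma deficit_asymptotics:
  assumes R: "R > 0" and \<psi>_lim: "((\<lambda>u. exp (R * u) * \<psi> u) \<longlongrightarrow> a) at_top"
  shows "((\<lambda>u. exp (R * u) * H u) \<longlongrightarrow>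
    a * ((exp (- R * y) - tail y - (LINT z|lborel. indicator {..<y} z * k z * exp (- R * (y - z)))) / (1 - mass))) at_top"
proof -
  have shift: "((\<lambda>u. exp (R * u) * \<psi> (u + t)) \<longlongrightarrow> a * exp (- R * t)) at_top" for t
  proof -
    have "((\<lambda>u. exp (R * (u + t)) * \<psi> (u + t)) \<longlongrightarrow> a) at_top"
      by (rule filterlim_compose[OF \<psi>_lim filterlim_add_const_at_top])
    from tendsto_mult[OF this tendsto_const[of "exp (- R * t)"]]
    show ?thesis by (simp add: algebra_simps exp_add[symmetric])
  qed
  have "((\<lambda>u. LINT z|lborel. indicator {..<y} z * k z * (exp (R * u) * \<psi> (u + y - z))) \<longlongrightarrow>
      (LINT z|lborel. indicator {..<y} z * k z * (a * exp (- R * (y - z))))) at_top"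
  \<comment> \<open>For \<open>z < y\<close> the factor \<open>exp (R * u)\<close> is at most
    \<open>exp (R * (u + y - z))\<close>, and the scaled ruin probability stays below
    \<open>a + 1\<close> from some capital on.\<close>
  proof (rule integral_dominated_convergence_at_top[where w = "\<lambda>z. k z * (a + 1)"])
    show "AE z in lborel. ((\<lambda>u. indicator {..<y} z * k z * (exp (R * u) * \<psi> (u + y - z))) \<longlongrightarrow>
        indicator {..<y} z * k z * (a * exp (- R * (y - z)))) at_top"
    proof (rule AE_I2)
      fix z
      show "((\<lambda>u. indicator {..<y} z * k z * (exp (R * u) * \<psi> (u + y - z))) \<longlongrightarrow>
        indicator {..<y} z * k z * (a * exp (- R * (y - z)))) at_top"
        using tendsto_mult_left[OF shift[of "y - z"], of "indicator {..<y} z * k z"]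
        by (simp only: add_diff_eq)
    qed
    have "\<forall>\<^sub>F v in at_top. exp (R * v) * \<psi> v < a + 1" using \<psi>_lim by (rule order_tendstoD) simp
    then obtain v0 where v0: "\<And>v. v \<ge> v0 \<Longrightarrow> exp (R * v) * \<psi> v < a + 1"
      by (auto simp: eventually_at_top_linorder)
    show "\<forall>\<^sub>F u in at_top. AE z in lborel.
        norm (indicator {..<y} z * k z * (exp (R * u) * \<psi> (u + y - z))) \<le> k z * (a + 1)"
      using eventually_ge_at_top[of v0]
    proof eventually_elim
      case (elim u)
      show ?case
      proof (rule AE_I2)
        fix z
        have "0 \<le> a + 1" using v0[of v0] \<psi>(1)[of v0] by (smt (verit) exp_ge_zero mult_nonneg_nonneg order_refl)
        moreover have "exp (R * u) * \<psi> (u + y - z) \<le> a + 1" if "z < y"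
        proof -
          have "exp (R * u) * \<psi> (u + y - z) \<le> exp (R * (u + y - z)) * \<psi> (u + y - z)"
            using R that \<psi>(1) by (intro mult_right_mono) auto
          also have "\<dots> < a + 1" using elim that by (intro v0) auto
          finally show ?thesis by simp
        qed
        ultimately show "norm (indicator {..<y} z * k z * (exp (R * u) * \<psi> (u + y - z))) \<le> k z * (a + 1)"
          using k_nonneg[of z] \<psi>(1) by (auto simp: abs_mult indicator_def intro!: mult_left_mono)
      qed
    qed
  qed (auto simp: k_integrable)
  then have int: "((\<lambda>u. exp (R * u) * (LINT z|lborel. indicator {..<y} z * k z * \<psi> (u + y - z))) \<longlongrightarrow>
      a * (LINT z|lborel. indicator {..<y} z * k z * exp (- R * (y - z)))) at_top"
    by (simp add: mult.left_commute)
  have "((\<lambda>u. (exp (R * u) * \<psi> (u + y) - exp (R * u) * \<psi> u * tail y -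
      exp (R * u) * (LINT z|lborel. indicator {..<y} z * k z * \<psi> (u + y - z))) / (1 - mass)) \<longlongrightarrow>
    (a * exp (- R * y) - a * tail y -
      a * (LINT z|lborel. indicator {..<y} z * k z * exp (- R * (y - z)))) / (1 - mass)) at_top"
    using mass_less_1 by (intro tendsto_intros shift int \<psi>_lim) auto
  then have "((\<lambda>u. exp (R * u) * H u) \<longlongrightarrow> (a * exp (- R * y) - a * tail y -
      a * (LINT z|lborel. indicator {..<y} z * k z * exp (- R * (y - z)))) / (1 - mass)) at_top"
  proof (rule Lim_transform_eventually)
    show "\<forall>\<^sub>F u in at_top. (exp (R * u) * \<psi> (u + y) - exp (R * u) * \<psi> u * tail y -
      exp (R * u) * (LINT z|lborel. indicator {..<y} z * k z * \<psi> (u + y - z))) / (1 - mass) = exp (R * u) * H u"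
      using eventually_ge_at_top[of 0]
    proof eventually_elim
      case (elim u)
      from arg_cong[OF deficit_formula[OF elim], of "\<lambda>x. exp (R * u) * x / (1 - mass)"] mass_less_1
      show ?case by (simp add: right_diff_distrib mult.assoc)
    qed
  qed
  then show ?thesis by (simp add: right_diff_distrib)
qed

end

end

section \<open>The integral equation at a fixed rate\<close>

text \<open>The exact time of the claim is unknown, but it affects the level by at most
  \<open>c * h\<close>. Outside two windows of that length, above \<open>u\<close> and above
  \<open>u + y\<close>, neither ruin nor the comparison of the deficit with \<open>y\<close> depends
  on it.\<close>

lemma falls_below_single_claim:
  assumes n: "regular_path n" "n h = 1" and "c > 0" "h \<ge> 0" "u \<ge> 0" "y \<ge> 0"
    and x: "u < x 0" "x 0 \<notin> {u<..u + c * h}" "x 0 \<notin> {u + y<..u + y + c * h}"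
  shows "falls_below c n x u y \<longleftrightarrow> u + y < x 0"
proof -
  have "level c n x u h < 0" using x n by (simp add: level_def)
  then obtain t where t: "0 \<le> t" "t \<le> h" "level c n x u t < 0"
      "\<And>r. 0 \<le> r \<Longrightarrow> r < t \<Longrightarrow> 0 \<le> level c n x u r"
    using first_passage[OF n(1) \<open>c > 0\<close> \<open>h \<ge> 0\<close>] by metis
  have "n t \<le> 1" using n t(1,2) by (auto simp: regular_path_def dest: mono_onD[of _ _ t h])
  moreover have "n t \<noteq> 0"
  proof
    assume "n t = 0"
    then have "level c n x u t = u + c * t" by (simp add: level_def)
    moreover have "0 \<le> c * t" using t(1) \<open>c > 0\<close> by simp
    ultimately show False using t(3) \<open>u \<ge> 0\<close> by simp
  qed
  ultimately have "n t = 1" by simp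
  then have lev: "level c n x u t = u + c * t - x 0" by (simp add: level_def)
  have "c * t \<le> c * h" "0 \<le> c * t" using t assms by auto
  then show ?thesis
    using falls_below_iff_first_passage[OF t(1,3,4) \<open>y \<ge> 0\<close>] lev x by auto
qed

lemma exp_minus_bounds:
  fixes a :: real
  assumes "0 \<le> a"
  shows "1 - a \<le> exp (- a)" "exp (- a) \<le> 1 - a + a\<^sup>2"
    and "1 - exp (- a) - a * exp (- a) \<le> a\<^sup>2"
proof -
  show 1: "1 - a \<le> exp (- a)" using exp_ge_add_one_self[of "- a"] by simp
  have "exp (- a) * (1 + a) \<le> exp (- a) * exp a"
    using exp_ge_add_one_self[of a] by (intro mult_left_mono) auto
  then have "exp (- a) * (1 + a) \<le> 1" by (simp add: exp_minus)
  also have "\<dots> \<le> (1 - a + a\<^sup>2) * (1 + a)" using assms by (simp add: algebra_simps power2_eq_square)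
  finally show "exp (- a) \<le> 1 - a + a\<^sup>2" using assms by simp
  have "(1 - a) * (1 + a) \<le> exp (- a) * (1 + a)" using 1 assms by (intro mult_right_mono) auto
  then show "1 - exp (- a) - a * exp (- a) \<le> a\<^sup>2" by (simp add: algebra_simps power2_eq_square)
qed

section \<open>The claim size distribution and its integrated tail\<close>

context mixture_model
begin

lemma claim_pos: "AE x in interval_measure F. 0 < x"
proof -
  have "AE \<omega> in M. 0 < X 0 \<omega>" using claims by (simp add: claim_sizes_def)
  then have "AE x in distr M borel (X 0). 0 < x" by (subst AE_distr_iff) auto
  then show ?thesis by (simp only: distr_X)
qed

lemma F_eq: "F x = measure (interval_measure F) {..x}"
  using fun_cong[OF cdf_claim, of x] by (simp add: cdf_def)

lemma F_bounds: "0 \<le> F x" "F x \<le> 1"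
  by (auto simp: F_eq)

lemma F_mono: "x \<le> y \<Longrightarrow> F x \<le> F y"
  using claim.cdf_nondecreasing[of x y] by (simp add: cdf_claim)

lemma F_0: "x \<le> 0 \<Longrightarrow> F x = 0"
proof -
  assume "x \<le> 0"
  have "measure (interval_measure F) {..0} = 0"
    by (subst claim.prob_eq_0) (use claim_pos in \<open>auto elim!: eventually_mono\<close>)
  then have "F 0 = 0" by (simp add: F_eq)
  then show ?thesis using F_mono[OF \<open>x \<le> 0\<close>] F_bounds(1)[of x] by simp
qed

lemma F_measurable[measurable]: "F \<in> borel_measurable borel"
  by (rule borel_measurable_mono) (auto intro: monoI F_mono)

lemma F_right_cont:
  assumes "F y < 1" obtains e where "e > 0" "\<And>z. z < y + e \<Longrightarrow> F z < 1"
proof -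
  have "(F \<longlongrightarrow> F y) (at_right y)"
    using claim.cdf_is_right_cont[of y] by (simp add: cdf_claim continuous_within)
  from order_tendstoD(2)[OF this assms] obtain b where b: "b > y" "\<And>z. y < z \<Longrightarrow> z < b \<Longrightarrow> F z < 1"
    by (auto simp: eventually_at_right_field)
  have "F z < 1" if "z < y + (b - y)" for z
  proof (cases "z \<le> y")
    case True then show ?thesis using F_mono[of z y] assms by simp
  next
    case False then show ?thesis using b(2)[of z] that by simp
  qed
  then show ?thesis using b(1) by (intro that[of "b - y"]) auto
qed

lemma measure_claim_greater: "measure (interval_measure F) {x<..} = 1 - F x"
proof -
  have "measure (interval_measure F) (UNIV - {..x}) = 1 - F x"
    using claim.prob_compl[of "{..x}"] by (simp add: F_eq)
  moreover have "UNIV - {..x} = {x<..}" by auto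
  ultimately show ?thesis by simp
qed

lemma measure_claim_interval: "x \<le> y \<Longrightarrow> measure (interval_measure F) {x<..y} = F y - F x"
proof -
  assume "x \<le> y"
  have "measure (interval_measure F) ({..y} - {..x}) = F y - F x"
    using \<open>x \<le> y\<close> by (subst claim.finite_measure_Diff) (auto simp: F_eq)
  moreover have "{..y} - {..x} = {x<..y}" by auto
  ultimately show ?thesis by simp
qed

text \<open>Both integrals measure the region \<open>0 \<le> z < x\<close> under the product of
  Lebesgue measure and the claim law.\<close>

lemma integral_tail:
  assumes "integrable (interval_measure F) (\<lambda>x. x)"
  shows "integrable lborel (\<lambda>z. indicator {0..} z * (1 - F z))"
    and "(LINT z|lborel. indicator {0..} z * (1 - F z)) = (LINT x|interval_measure F. x)"
proof -
  interpret P: pair_sigma_finite lborel "interval_measure F" ..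
  have pos: "0 \<le> (LINT x|interval_measure F. x)"
    using claim_pos by (intro integral_nonneg_AE) (auto elim!: eventually_mono)
  have "(\<integral>\<^sup>+z. ennreal (indicator {0..} z * (1 - F z)) \<partial>lborel) =
      (\<integral>\<^sup>+z. \<integral>\<^sup>+x. indicator {0..} z * indicator {z<..} x \<partial>interval_measure F \<partial>lborel)"
  proof (intro nn_integral_cong)
    fix z :: real
    show "ennreal (indicator {0..} z * (1 - F z)) =
      (\<integral>\<^sup>+x. indicator {0..} z * indicator {z<..} x \<partial>interval_measure F)"
      by (subst nn_integral_cmult)
        (auto simp: claim.emeasure_eq_measure measure_claim_greater indicator_def)
  qed
  also have "\<dots> = (\<integral>\<^sup>+x. \<integral>\<^sup>+z. indicator {0..} z * indicator {z<..} x \<partial>lborel \<partial>interval_measure F)"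
    by (rule P.Fubini'[symmetric]) (unfold indicator_def greaterThan_iff, measurable)
  also have "\<dots> = (\<integral>\<^sup>+x. ennreal x \<partial>interval_measure F)"
  proof (rule nn_integral_cong_AE)
    show "AE x in interval_measure F. (\<integral>\<^sup>+z. indicator {0..} z * indicator {z<..} x \<partial>lborel) = ennreal x"
      using claim_pos
    proof eventually_elim
      case (elim x)
      have "(\<integral>\<^sup>+z. indicator {0..} z * indicator {z<..} x \<partial>lborel) = (\<integral>\<^sup>+z. indicator {0..<x} z \<partial>lborel)"
        by (intro nn_integral_cong) (auto simp: indicator_def)
      then show ?case using elim by simp
    qed
  qed
  also have "\<dots> = ennreal (LINT x|interval_measure F. x)"
    using assms claim_pos by (intro nn_integral_eq_integral) (auto elim!: eventually_mono)
  finally have *: "(\<integral>\<^sup>+z. ennreal (indicator {0..} z * (1 - F z)) \<partial>lborel) =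
      ennreal (LINT x|interval_measure F. x)" .
  show "integrable lborel (\<lambda>z. indicator {0..} z * (1 - F z))"
    by (rule integrableI_nn_integral_finite[OF _ _ *]) (auto simp: F_bounds indicator_def)
  then show "(LINT z|lborel. indicator {0..} z * (1 - F z)) = (LINT x|interval_measure F. x)"
    using * pos by (subst integral_eq_nn_integral) (auto simp: F_bounds indicator_def)
qed

end

text \<open>For a Poisson model of rate \<open>l\<close> with positive safety loading this is the
  density of the first drop of the surplus below its initial value, the ladder height; its mass is
  \<open>l * \<mu> / c\<close>.\<close>

definition ladder_kernel :: "real \<Rightarrow> (real \<Rightarrow> real) \<Rightarrow> real \<Rightarrow> real \<Rightarrow> real" where
  "ladder_kernel c F l z = indicator {0..} z * (l / c * (1 - F z))"

context pure_model
begin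

text \<open>A grid without steps leaves only the condition at time \<open>h\<close>.\<close>

lemma prob_count_first_claim:
  assumes "0 \<le> h" and [measurable]: "A \<in> sets borel"
  shows "prob {\<omega>\<in>space M. N h \<omega> = k \<and> X 0 \<omega> \<in> A} =
    poisson_weight (l * h) k * measure (interval_measure F) A"
proof -
  define Z where "Z = (\<lambda>v::nat list. {x::nat \<Rightarrow> real. x 0 \<in> A})"
  have "{x\<in>space (PiM UNIV (\<lambda>_. borel)). x 0 \<in> A} \<in> sets (PiM UNIV (\<lambda>_::nat. borel :: real measure))"
    by measurable
  then have Z: "Z v \<in> sets (PiM UNIV (\<lambda>_. borel))" for v
    by (simp add: Z_def space_PiM)
  have sk: "skeleton_prob F a 0 Z = emeasure (interval_measure F) A" for a
  proof -
    have "{v::nat list. length v = 0} = {[]}" by auto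
    then have "skeleton_prob F a 0 Z = emeasure (claims_law F) (Z [])"
      by (simp add: skeleton_prob_def list_weight_def nn_integral_count_space_finite)
    also have "\<dots> = emeasure M {\<omega>\<in>space M. X 0 \<omega> \<in> A}"
      using emeasure_claims[OF Z] by (simp add: Z_def)
    also have "\<dots> = emeasure (distr M borel (X 0)) A"
      by (subst emeasure_distr) (auto intro!: arg_cong[where f="emeasure M"])
    finally show ?thesis by (simp add: distr_X)
  qed
  have "emeasure M {\<omega>\<in>space M. N h \<omega> = k \<and> (\<lambda>i. X i \<omega>) \<in> Z (increments (\<lambda>t. N t \<omega>) h 0 0)}
      = ennreal (poisson_weight (l * h) k) * emeasure (interval_measure F) A"
    by (subst emeasure_skeleton(2)[where Z = Z and h = h and d = 0 and k = k and K = 0, OF \<open>0 \<le> h\<close> order_refl Z])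
      (simp add: sk nn_integral_return)
  then have "emeasure M {\<omega>\<in>space M. N h \<omega> = k \<and> X 0 \<omega> \<in> A} =
      ennreal (poisson_weight (l * h) k * measure (interval_measure F) A)"
    using l_nonneg assms by (simp add: Z_def claim.emeasure_eq_measure ennreal_mult poisson_weight_nonneg)
  then show ?thesis
    using l_nonneg assms by (simp add: measure_def poisson_weight_nonneg)
qed

lemma prob_count:
  assumes "0 \<le> h"
  shows "prob {\<omega>\<in>space M. N h \<omega> = k} = poisson_weight (l * h) k"
  using prob_count_first_claim[OF assms, of UNIV k] claim.prob_space by simp

lemma prob_count_ge_2:
  assumes "0 \<le> h"
  shows "prob {\<omega>\<in>space M. 2 \<le> N h \<omega>} \<le> (l * h)\<^sup>2"
proof -
  note [measurable] = measurable_N[OF assms]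
  have a: "0 \<le> l * h" using l_nonneg assms by simp
  have "{\<omega>\<in>space M. 2 \<le> N h \<omega>} = space M - ({\<omega>\<in>space M. N h \<omega> = 0} \<union> {\<omega>\<in>space M. N h \<omega> = 1})"
    by auto
  then have "prob {\<omega>\<in>space M. 2 \<le> N h \<omega>} = 1 - prob ({\<omega>\<in>space M. N h \<omega> = 0} \<union> {\<omega>\<in>space M. N h \<omega> = 1})"
    by (simp only:) (rule prob_compl, measurable)
  also have "prob ({\<omega>\<in>space M. N h \<omega> = 0} \<union> {\<omega>\<in>space M. N h \<omega> = 1}) =
      poisson_weight (l * h) 0 + poisson_weight (l * h) 1"
    by (subst finite_measure_Union) (auto simp: prob_count[OF assms])
  finally show ?thesis using exp_minus_bounds(3)[OF a] by (simp add: poisson_weight_def)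
qed

context
  fixes c y :: real
  assumes c: "c > 0" and y: "y \<ge> 0"
begin

definition fall_prob :: "real \<Rightarrow> real" where "fall_prob u = prob (fall_event M c N X u y)"

lemma fall_prob_bounds: "0 \<le> fall_prob u" "fall_prob u \<le> 1"
  by (auto simp: fall_prob_def)

lemma fall_event_measurable[measurable]: "fall_event M c N X u y \<in> events"
  by (rule fall_event_limit[OF c y])

lemma fall_prob_measurable[measurable]: "fall_prob \<in> borel_measurable borel"
proof -
  \<comment> \<open>Measurability in the capital is inherited from the one-claim formula; taking
    \<open>a = 0\<close> makes the capital \<open>- s\<close>.\<close>
  have "(\<lambda>s. prob (fall_event M c N X (0 - s) y)) \<in> borel_measurable borel"
    by (rule prob_shifted_fall_1(3)[OF c order_refl y])
  then have "(\<lambda>s. fall_prob (- s)) \<in> borel_measurable borel" by (simp add: fall_prob_def)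
  then have "(\<lambda>s. fall_prob (- (- s))) \<in> borel_measurable borel"
    by (rule measurable_compose_rev) measurable
  then show ?thesis by simp
qed

text \<open>\<open>E0\<close>, \<open>E1\<close> and \<open>E2\<close> are the fall after no claim,
  the fall after one claim covered by \<open>u\<close>, and one claim above \<open>u + y\<close>.
  They differ from the fall event only inside \<open>B0\<close>, \<open>B1\<close>,
  \<open>B2\<close>: several claims, of order \<open>a\<^sup>2\<close>, or a single claim in a
  window of length \<open>c * h\<close>, of order \<open>a\<close> times an increment of
  \<open>F\<close>.\<close>

lemma fall_prob_one_step:
  assumes u: "u \<ge> 0" and h: "h \<ge> 0"
  defines "a \<equiv> l * h"
    and "I \<equiv> (LINT s|interval_measure F. indicator {..u} s * fall_prob (u + c * h - s))"
  shows "\<bar>fall_prob u - exp (- a) * (fall_prob (u + c * h) + a * I + a * (1 - F (u + y)))\<bar>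
    \<le> a\<^sup>2 + a * ((F (u + c * h) - F u) + (F (u + y + c * h) - F (u + y)))"
    and "\<bar>fall_prob u - fall_prob (u + c * h)\<bar> \<le> a"
proof -
  have a: "0 \<le> a" using h l_nonneg by (simp add: a_def)
  have ch: "0 \<le> c * h" using c h by simp
  define A where "A = fall_event M c N X u y"
  define E0 where "E0 = {\<omega>\<in>space M. N h \<omega> = 0 \<and>
    falls_below c (\<lambda>t. N (h + t) \<omega> - N h \<omega>) (\<lambda>i. X i \<omega>) (u + c * h) y}"
  define E1 where "E1 = {\<omega>\<in>space M. N h \<omega> = 1 \<and> X 0 \<omega> \<le> u \<and>
    falls_below c (\<lambda>t. N (h + t) \<omega> - N h \<omega>) (\<lambda>i. X (1 + i) \<omega>) (u + c * h - X 0 \<omega>) y}"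
  define E2 where "E2 = {\<omega>\<in>space M. N h \<omega> = 1 \<and> X 0 \<omega> \<in> {u + y<..}}"
  define B0 where "B0 = {\<omega>\<in>space M. 2 \<le> N h \<omega>}"
  define B1 where "B1 = {\<omega>\<in>space M. N h \<omega> = 1 \<and> X 0 \<omega> \<in> {u<..u + c * h}}"
  define B2 where "B2 = {\<omega>\<in>space M. N h \<omega> = 1 \<and> X 0 \<omega> \<in> {u + y<..u + y + c * h}}"
  note [measurable] = measurable_N[OF h]
  have [measurable]: "A \<in> events" unfolding A_def by (rule fall_event_measurable)
  have [measurable]: "E0 \<in> events" unfolding E0_def by (rule prob_shifted_fall_0(1)[OF c h y])
  have [measurable]: "E1 \<in> events" unfolding E1_def by (rule prob_shifted_fall_1(1)[OF c h y])
  have [measurable]: "E2 \<in> events" "B0 \<in> events" "B1 \<in> events" "B2 \<in> events"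
    unfolding E2_def B0_def B1_def B2_def by measurable
  have E0: "prob E0 = exp (- a) * fall_prob (u + c * h)"
    unfolding E0_def fall_prob_def a_def by (rule prob_shifted_fall_0(2)[OF c h y])
  have E1: "prob E1 = a * exp (- a) * I"
    unfolding E1_def fall_prob_def a_def I_def by (rule prob_shifted_fall_1(2)[OF c h y])
  have E2: "prob E2 = a * exp (- a) * (1 - F (u + y))"
    unfolding E2_def by (subst prob_count_first_claim[OF h])
      (auto simp: measure_claim_greater poisson_weight_def a_def)
  have B: "prob B0 \<le> a\<^sup>2" "prob B1 \<le> a * (F (u + c * h) - F u)"
      "prob B2 \<le> a * (F (u + y + c * h) - F (u + y))"
  proof -
    show "prob B0 \<le> a\<^sup>2" unfolding B0_def a_def by (rule prob_count_ge_2[OF h])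
    have w: "poisson_weight a 1 \<le> a" using a by (simp add: poisson_weight_def mult_left_le)
    have "F u \<le> F (u + c * h)" "F (u + y) \<le> F (u + y + c * h)" using ch by (auto intro: F_mono)
    moreover have "prob B1 = poisson_weight a 1 * (F (u + c * h) - F u)"
    proof -
      have "prob B1 = poisson_weight a 1 * measure (interval_measure F) {u<..u + c * h}"
        unfolding B1_def a_def by (rule prob_count_first_claim[OF h]) simp
      then show ?thesis using ch by (simp add: measure_claim_interval)
    qed
    moreover have "prob B2 = poisson_weight a 1 * (F (u + y + c * h) - F (u + y))"
    proof -
      have "prob B2 = poisson_weight a 1 * measure (interval_measure F) {u + y<..u + y + c * h}"
        unfolding B2_def a_def by (rule prob_count_first_claim[OF h]) simp
      then show ?thesis using ch by (simp add: measure_claim_interval)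
    qed
    ultimately show "prob B1 \<le> a * (F (u + c * h) - F u)" "prob B2 \<le> a * (F (u + y + c * h) - F (u + y))"
      using w by (auto intro!: mult_right_mono)
  qed
  have char0: "\<omega> \<in> A \<longleftrightarrow> \<omega> \<in> E0" if "\<omega> \<in> space M" "N h \<omega> = 0" for \<omega>
  proof -
    note reg = regular_paths[OF that(1)]
    have "N s \<omega> = 0" if "0 \<le> s" "s \<le> h" for s
      using reg that \<open>N h \<omega> = 0\<close> by (auto simp: regular_path_def dest: mono_onD[of _ _ s h])
    then have lev: "level c (\<lambda>t. N t \<omega>) (\<lambda>i. X i \<omega>) u s = u + c * s" if "0 \<le> s" "s \<le> h" for s
      using that by (simp add: level_def)
    have "falls_below c (\<lambda>t. N t \<omega>) (\<lambda>i. X i \<omega>) u y \<longleftrightarrow>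
      falls_below c (\<lambda>t. N (h + t) \<omega> - N h \<omega>) (\<lambda>i. X (N h \<omega> + i) \<omega>) (level c (\<lambda>t. N t \<omega>) (\<lambda>i. X i \<omega>) u h) y"
      using c u by (intro falls_below_shift reg h y) (simp add: lev)
    then show ?thesis using that lev[OF h order_refl] by (simp add: A_def E0_def fall_event_def)
  qed
  have char1: "\<omega> \<in> A \<longleftrightarrow> \<omega> \<in> E1" if "\<omega> \<in> space M" "N h \<omega> = 1" "X 0 \<omega> \<le> u" for \<omega>
  proof -
    note reg = regular_paths[OF that(1)]
    have "0 \<le> level c (\<lambda>t. N t \<omega>) (\<lambda>i. X i \<omega>) u s" if "0 \<le> s" "s \<le> h" for s
    proof -
      have "N s \<omega> \<le> 1"
        using reg that \<open>N h \<omega> = 1\<close> by (auto simp: regular_path_def dest: mono_onD[of _ _ s h])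
      then have "N s \<omega> = 0 \<or> N s \<omega> = 1" by auto
      then have "level c (\<lambda>t. N t \<omega>) (\<lambda>i. X i \<omega>) u s = u + c * s \<or>
          level c (\<lambda>t. N t \<omega>) (\<lambda>i. X i \<omega>) u s = u + c * s - X 0 \<omega>"
        by (auto simp: level_def)
      moreover have "0 \<le> c * s" using that c by simp
      ultimately show ?thesis using u \<open>X 0 \<omega> \<le> u\<close> by linarith
    qed
    then have "falls_below c (\<lambda>t. N t \<omega>) (\<lambda>i. X i \<omega>) u y \<longleftrightarrow>
      falls_below c (\<lambda>t. N (h + t) \<omega> - N h \<omega>) (\<lambda>i. X (N h \<omega> + i) \<omega>) (level c (\<lambda>t. N t \<omega>) (\<lambda>i. X i \<omega>) u h) y"
      by (intro falls_below_shift reg h y)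
    moreover have "level c (\<lambda>t. N t \<omega>) (\<lambda>i. X i \<omega>) u h = u + c * h - X 0 \<omega>"
      using that by (simp add: level_def)
    ultimately show ?thesis using that by (simp add: A_def E1_def fall_event_def)
  qed
  have char2: "\<omega> \<in> A \<longleftrightarrow> \<omega> \<in> E2"
    if "\<omega> \<in> space M" "N h \<omega> = 1" "u < X 0 \<omega>" "\<omega> \<notin> B1" "\<omega> \<notin> B2" for \<omega>
    using falls_below_single_claim[where n = "\<lambda>t. N t \<omega>" and x = "\<lambda>i. X i \<omega>" and h = h,
        OF regular_paths[OF that(1)] that(2) c h u y that(3)] that
    by (simp add: A_def E2_def B1_def B2_def fall_event_def)
  have cases: "N h \<omega> = 0 \<or> N h \<omega> = 1 \<and> X 0 \<omega> \<le> u \<or> N h \<omega> = 1 \<and> u < X 0 \<omega> \<or> \<omega> \<in> B0"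
    if "\<omega> \<in> space M" for \<omega>
    using that by (auto simp: B0_def)
  have sub1: "A \<subseteq> (E0 \<union> E1 \<union> E2) \<union> (B0 \<union> B1 \<union> B2)"
  proof
    fix \<omega> assume "\<omega> \<in> A"
    then have "\<omega> \<in> space M" by (simp add: A_def fall_event_def)
    with cases[OF this] char0[of \<omega>] char1[of \<omega>] char2[of \<omega>] \<open>\<omega> \<in> A\<close>
    show "\<omega> \<in> (E0 \<union> E1 \<union> E2) \<union> (B0 \<union> B1 \<union> B2)" by blast
  qed
  have sub2: "E0 \<union> E1 \<union> E2 \<subseteq> A \<union> (B0 \<union> B1 \<union> B2)"
  proof
    fix \<omega> assume *: "\<omega> \<in> E0 \<union> E1 \<union> E2"
    then consider "\<omega> \<in> E0" "\<omega> \<in> space M" "N h \<omega> = 0" | "\<omega> \<in> E1" "\<omega> \<in> space M" "N h \<omega> = 1" "X 0 \<omega> \<le> u"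
      | "\<omega> \<in> E2" "\<omega> \<in> space M" "N h \<omega> = 1" "u < X 0 \<omega>"
      using y by (auto simp: E0_def E1_def E2_def)
    then show "\<omega> \<in> A \<union> (B0 \<union> B1 \<union> B2)"
      by cases (use char0[of \<omega>] char1[of \<omega>] char2[of \<omega>] in blast)+
  qed
  have sum: "prob (E0 \<union> E1 \<union> E2) = prob E0 + prob E1 + prob E2"
  proof -
    have "E0 \<inter> E1 = {}" "(E0 \<union> E1) \<inter> E2 = {}"
      using y by (auto simp: E0_def E1_def E2_def)
    then show ?thesis by (simp add: finite_measure_Union)
  qed
  have bad: "prob (B0 \<union> B1 \<union> B2) \<le> a\<^sup>2 + a * ((F (u + c * h) - F u) + (F (u + y + c * h) - F (u + y)))"
    using measure_Un_le[of "B0 \<union> B1" M B2] measure_Un_le[of B0 M B1] B by (simp add: algebra_simps)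
  have "prob A \<le> prob (E0 \<union> E1 \<union> E2) + prob (B0 \<union> B1 \<union> B2)"
    using finite_measure_mono[OF sub1] measure_Un_le[of "E0 \<union> E1 \<union> E2" M "B0 \<union> B1 \<union> B2"] by simp
  moreover have "prob (E0 \<union> E1 \<union> E2) \<le> prob A + prob (B0 \<union> B1 \<union> B2)"
    using finite_measure_mono[OF sub2] measure_Un_le[of A M "B0 \<union> B1 \<union> B2"] by simp
  ultimately have "\<bar>prob A - (prob E0 + prob E1 + prob E2)\<bar> \<le>
      a\<^sup>2 + a * ((F (u + c * h) - F u) + (F (u + y + c * h) - F (u + y)))"
    using bad unfolding sum by linarith
  then show "\<bar>fall_prob u - exp (- a) * (fall_prob (u + c * h) + a * I + a * (1 - F (u + y)))\<bar>
    \<le> a\<^sup>2 + a * ((F (u + c * h) - F u) + (F (u + y + c * h) - F (u + y)))"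
    by (simp add: E0 E1 E2 A_def fall_prob_def algebra_simps)

  \<comment> \<open>For the Lipschitz bound it is enough to separate the event of no claim up to
    \<open>h\<close>; everything else has probability \<open>1 - exp (- a)\<close>.\<close>
  have "A \<subseteq> E0 \<union> {\<omega>\<in>space M. N h \<omega> \<noteq> 0}"
    using char0 by (auto simp: A_def fall_event_def)
  then have "prob A \<le> prob E0 + prob {\<omega>\<in>space M. N h \<omega> \<noteq> 0}"
    by (rule order_trans[OF finite_measure_mono measure_Un_le]; measurable)
  moreover have "prob {\<omega>\<in>space M. N h \<omega> \<noteq> 0} = 1 - exp (- a)"
  proof -
    have "{\<omega>\<in>space M. N h \<omega> \<noteq> 0} = space M - {\<omega>\<in>space M. N h \<omega> = 0}" by auto
    then show ?thesis using prob_count[OF h, of 0]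
      by (simp only:) (subst prob_compl, auto simp: poisson_weight_def a_def)
  qed
  moreover have "prob E0 \<le> prob A"
    using char0 by (intro finite_measure_mono) (auto simp: E0_def)
  moreover have "exp (- a) * fall_prob (u + c * h) \<le> fall_prob (u + c * h)"
    using fall_prob_bounds a by (intro mult_left_le_one_le) auto
  moreover have "(1 - exp (- a)) * fall_prob (u + c * h) \<le> (1 - exp (- a)) * 1"
    using fall_prob_bounds a by (intro mult_left_mono) auto
  moreover have "prob A = fall_prob u" by (simp add: A_def fall_prob_def)
  ultimately show "\<bar>fall_prob u - fall_prob (u + c * h)\<bar> \<le> a"
    using E0 exp_minus_bounds(1)[OF a] by (simp add: algebra_simps abs_le_iff)
qed

lemma fall_prob_lipschitz:
  assumes "u \<ge> 0" "t \<ge> 0"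
  shows "\<bar>fall_prob (u + t) - fall_prob u\<bar> \<le> l / c * t"
  using fall_prob_one_step(2)[of u "t / c"] assms c by (simp add: abs_minus_commute)

text \<open>During a time step \<open>1 / real (Suc n)\<close> premiums raise the capital by
  \<open>c / real (Suc n)\<close>, so the limit is \<open>c\<close> times a right derivative. The
  window terms vanish by right continuity of \<open>F\<close>, which is why increments to the right
  are considered.\<close>

lemma fall_prob_derivative:
  assumes u: "u \<ge> 0"
  shows "(\<lambda>n. real (Suc n) * (fall_prob (u + c / real (Suc n)) - fall_prob u)) \<longlonglongrightarrow>
    l * (fall_prob u - (LINT s|interval_measure F. indicator {..u} s * fall_prob (u - s)) - (1 - F (u + y)))"
proof -
  define h where "h n = 1 / real (Suc n)" for n
  have h: "h n > 0" for n by (simp add: h_def)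
  have h0: "h \<longlonglongrightarrow> 0"
    unfolding h_def using LIMSEQ_inverse_real_of_nat by (simp add: inverse_eq_divide)
  have ch0: "(\<lambda>n. x + c * h n) \<longlonglongrightarrow> x" for x
    using tendsto_add[OF tendsto_const[of x] tendsto_mult[OF tendsto_const[of c] h0]] by simp
  define I where "I n = (LINT s|interval_measure F. indicator {..u} s * fall_prob (u + c * h n - s))" for n
  define J where "J = (LINT s|interval_measure F. indicator {..u} s * fall_prob (u - s))"
  define e where "e n = (F (u + c * h n) - F u) + (F (u + y + c * h n) - F (u + y))" for n
  have fall_lim: "(\<lambda>n. fall_prob (x + c * h n)) \<longlonglongrightarrow> fall_prob x" if "0 \<le> x" for x
  proof -
    have "(\<lambda>n. fall_prob (x + c * h n) - fall_prob x) \<longlonglongrightarrow> 0"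
    proof (rule Lim_null_comparison)
      show "\<forall>\<^sub>F n in sequentially. norm (fall_prob (x + c * h n) - fall_prob x) \<le> l / c * (c * h n)"
        using fall_prob_lipschitz[OF that mult_nonneg_nonneg[OF less_imp_le[OF c] less_imp_le[OF h]]]
        by (intro always_eventually allI) simp
      show "(\<lambda>n. l / c * (c * h n)) \<longlonglongrightarrow> 0"
        using tendsto_mult[OF tendsto_const[of l] h0] c by simp
    qed
    then show ?thesis by (simp add: LIM_zero_iff)
  qed
  have I_lim: "I \<longlonglongrightarrow> J"
    unfolding I_def J_def
  proof (rule integral_dominated_convergence[where w = "\<lambda>_. 1"])
    show "AE s in interval_measure F. (\<lambda>n. indicator {..u} s * fall_prob (u + c * h n - s))
        \<longlonglongrightarrow> indicator {..u} s * fall_prob (u - s)"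
    proof (rule AE_I2)
      fix s
      show "(\<lambda>n. indicator {..u} s * fall_prob (u + c * h n - s)) \<longlonglongrightarrow> indicator {..u} s * fall_prob (u - s)"
        using fall_lim[of "u - s"] by (cases "s \<le> u") (auto simp: algebra_simps)
    qed
  qed (auto simp: indicator_def fall_prob_bounds abs_of_nonneg)
  have F_lim: "(\<lambda>n. F (x + c * h n)) \<longlonglongrightarrow> F x" for x
  proof -
    have "(F \<longlongrightarrow> F x) (at_right x)"
      using claim.cdf_is_right_cont[of x] by (simp add: cdf_claim continuous_within)
    moreover have "filterlim (\<lambda>n. x + c * h n) (at_right x) sequentially"
      using ch0 c h less_imp_neq[OF h, symmetric] by (auto simp: filterlim_at)
    ultimately show ?thesis by (rule filterlim_compose)
  qed
  have e_lim: "e \<longlonglongrightarrow> 0"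
  proof -
    have "e \<longlonglongrightarrow> (F u - F u) + (F (u + y) - F (u + y))"
      unfolding e_def by (intro tendsto_intros F_lim)
    then show ?thesis by simp
  qed
  have I01: "0 \<le> I n" "I n \<le> 1" for n
  proof -
    show "0 \<le> I n" unfolding I_def by (intro Bochner_Integration.integral_nonneg) (simp add: fall_prob_bounds)
    have "I n \<le> (LINT s|interval_measure F. 1)"
      unfolding I_def
      by (intro integral_mono claim.integrable_const_bound[where B=1]) (auto simp: indicator_def fall_prob_bounds)
    then show "I n \<le> 1" using claim.prob_space by simp
  qed
  define r where "r n = real (Suc n) * (fall_prob (u + c * h n) - fall_prob u) -
      l * (fall_prob (u + c * h n) - I n - (1 - F (u + y)))" for n
  \<comment> \<open>The factor 4 collects one square from the one-step estimate, one from replacing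
    \<open>exp (- a)\<close> by \<open>1 - a\<close>, and two from replacing it by 1 in front of
    \<open>a * (I n + q)\<close>, where \<open>I n + q \<le> 2\<close>.\<close>
  have r_bound: "\<bar>r n\<bar> \<le> 4 * l\<^sup>2 * h n + l * e n" for n
  proof -
    define a where "a = l * h n"
    define p where "p = fall_prob (u + c * h n)"
    define q where "q = 1 - F (u + y)"
    have a: "0 \<le> a" using h[of n] l_nonneg by (simp add: a_def)
    have pq: "0 \<le> p" "p \<le> 1" "0 \<le> q" "q \<le> 1" using fall_prob_bounds F_bounds by (auto simp: p_def q_def)
    have *: "\<bar>fall_prob u - exp (- a) * (p + a * I n + a * q)\<bar> \<le> a\<^sup>2 + a * e n"
      using fall_prob_one_step(1)[OF u less_imp_le[OF h]] unfolding a_def p_def q_def I_def e_def .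
    note eb = exp_minus_bounds(1,2)[OF a]
    have "\<bar>(exp (- a) - (1 - a)) * p\<bar> \<le> a\<^sup>2 * 1"
      unfolding abs_mult using pq eb by (intro mult_mono) auto
    moreover have "\<bar>(exp (- a) - 1) * (a * (I n + q))\<bar> \<le> a * (a * 2)"
      unfolding abs_mult using pq eb a I01[of n] by (intro mult_mono) auto
    moreover have "p - fall_prob u - a * (p - I n - q) =
        - (fall_prob u - exp (- a) * (p + a * I n + a * q)) -
        (exp (- a) - (1 - a)) * p - (exp (- a) - 1) * (a * (I n + q))"
      by (simp add: algebra_simps)
    ultimately have "\<bar>p - fall_prob u - a * (p - I n - q)\<bar> \<le> 4 * a\<^sup>2 + a * e n"
      using * by (simp add: power2_eq_square)
    then have "real (Suc n) * \<bar>p - fall_prob u - a * (p - I n - q)\<bar> \<le> real (Suc n) * (4 * a\<^sup>2 + a * e n)"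
      by (intro mult_left_mono) auto
    moreover have "real (Suc n) * (4 * a\<^sup>2 + a * e n) = 4 * l\<^sup>2 * h n + l * e n"
    proof -
      have "real (Suc n) * (4 * a\<^sup>2 + a * e n) = (real (Suc n) * h n) * (4 * l\<^sup>2 * h n + l * e n)"
        by (simp add: a_def power2_eq_square algebra_simps)
      also have "real (Suc n) * h n = 1" by (simp add: h_def)
      finally show ?thesis by simp
    qed
    moreover have "real (Suc n) * \<bar>p - fall_prob u - a * (p - I n - q)\<bar> = \<bar>r n\<bar>"
    proof -
      have "r n = real (Suc n) * (p - fall_prob u - a * (p - I n - q))"
        by (simp add: r_def a_def p_def q_def h_def right_diff_distrib)
      then show ?thesis by (simp add: abs_mult)
    qed
    ultimately show ?thesis by (simp only:)
  qed
  have "r \<longlonglongrightarrow> 0"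
  proof (rule Lim_null_comparison)
    show "\<forall>\<^sub>F n in sequentially. norm (r n) \<le> 4 * l\<^sup>2 * h n + l * e n"
      using r_bound by (simp add: always_eventually)
    have "(\<lambda>n. 4 * l\<^sup>2 * h n + l * e n) \<longlonglongrightarrow> 4 * l\<^sup>2 * 0 + l * 0"
      by (intro tendsto_intros h0 e_lim)
    then show "(\<lambda>n. 4 * l\<^sup>2 * h n + l * e n) \<longlonglongrightarrow> 0" by simp
  qed
  then have "(\<lambda>n. r n + l * (fall_prob (u + c * h n) - I n - (1 - F (u + y)))) \<longlonglongrightarrow>
      0 + l * (fall_prob u - J - (1 - F (u + y)))"
    by (intro tendsto_intros fall_lim I_lim u)
  then show ?thesis by (simp add: r_def h_def J_def)
qed

lemma fall_prob_integrated:
  assumes U: "U \<ge> 0"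
  shows "c * (fall_prob U - fall_prob 0) =
    l * (LINT w|lborel. indicator {0..U} w * ((1 - F (U - w)) * fall_prob w)) -
    l * (LINT w|lborel. indicator {0..U} w * (1 - F (w + y)))"
proof -
  define D where "D = interval_measure F"
  interpret D: prob_space D unfolding D_def by (rule claim.prob_space_axioms)
  have sets_D[measurable_cong]: "sets D = sets borel" by (simp add: D_def)
  interpret P: pair_sigma_finite lborel D ..
  \<comment> \<open>Constant continuation to negative capital keeps the function Lipschitz on the
    whole line, as \<open>increment_quotient_integral\<close> demands.\<close>
  define p where "p v = fall_prob (max 0 v)" for v
  have [measurable]: "p \<in> borel_measurable borel" unfolding p_def by measurable
  have p: "0 \<le> p v" "p v \<le> 1" for v by (auto simp: p_def fall_prob_bounds)
  define J where "J v = (LINT s|D. indicator {..v} s * p (v - s))" for v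
  have [measurable]: "(\<lambda>(v, s). indicator {..v} s * p (v - s)) \<in> borel_measurable (borel \<Otimes>\<^sub>M D)"
    unfolding indicator_def atMost_iff by measurable
  have [measurable]: "J \<in> borel_measurable borel" unfolding J_def by measurable
  have J01: "0 \<le> J v" "J v \<le> 1" for v
  proof -
    show "0 \<le> J v" unfolding J_def by (intro Bochner_Integration.integral_nonneg) (simp add: p)
    have [measurable]: "(\<lambda>s. indicator {..v} s * p (v - s)) \<in> borel_measurable D" by measurable
    have "J v \<le> (LINT s|D. 1)"
      unfolding J_def by (intro integral_mono D.integrable_const_bound[where B=1]) (auto simp: indicator_def p)
    then show "J v \<le> 1" using D.prob_space by simp
  qed
  have int_bounded: "integrable lborel (\<lambda>v. indicator {0..U} v * f v)"
    if [measurable]: "f \<in> borel_measurable borel" and "\<And>v. \<bar>f v\<bar> \<le> 1" for f :: "real \<Rightarrow> real"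
  proof (rule Bochner_Integration.integrable_bound)
    show "integrable lborel (indicator {0..U} :: real \<Rightarrow> real)"
      by (rule integrable_real_indicator) (use U in auto)
    show "AE v in lborel. norm (indicator {0..U} v * f v) \<le> norm (indicator {0..U} v :: real)"
      using that(2) by (intro AE_I2) (auto simp: indicator_def)
  qed measurable
  have swap: "(LINT v|lborel. LINT s|D. indicator {0..U} v * f v s) =
      (LINT s|D. LINT v|lborel. indicator {0..U} v * f v s)"
    if [measurable]: "case_prod f \<in> borel_measurable (borel \<Otimes>\<^sub>M D)" and f: "\<And>v s. \<bar>f v s\<bar> \<le> 1"
    for f :: "real \<Rightarrow> real \<Rightarrow> real"
  proof (rule P.Fubini_integral[symmetric])
    have m: "(\<lambda>(v, s). indicator {0..U} v * f v s) \<in> borel_measurable (lborel \<Otimes>\<^sub>M D)"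
      by measurable
    have "integrable (lborel \<Otimes>\<^sub>M D) (\<lambda>(v, s). indicator {0..U} v :: real)"
    proof (rule P.Fubini_integrable)
      show "integrable lborel (\<lambda>x. LINT y|D. norm ((\<lambda>(v, s). indicator {0..U} v :: real) (x, y)))"
        using U by (simp add: D.prob_space integrable_real_indicator)
    qed auto
    then show "integrable (lborel \<Otimes>\<^sub>M D) (\<lambda>(v, s). indicator {0..U} v * f v s)"
      by (rule Bochner_Integration.integrable_bound[OF _ m]) (use f in \<open>auto simp: indicator_def\<close>)
  qed
  have "c * (p U - p 0) = (LINT v|lborel. indicator {0..U} v * (l * (p v - J v - (1 - F (v + y)))))"
  proof (rule increment_quotient_integral[OF c U, of "l / c"])
    show "0 \<le> l / c" using l_nonneg c by simp
    show "\<bar>p (v + t) - p v\<bar> \<le> l / c * t" if "0 \<le> t" for v t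
    proof (cases "0 \<le> v")
      case True
      then show ?thesis using fall_prob_lipschitz[of v t] that by (simp add: p_def)
    next
      case False
      then have "\<bar>p (v + t) - p v\<bar> \<le> l / c * max 0 (v + t)"
        using fall_prob_lipschitz[of 0 "max 0 (v + t)"] by (simp add: p_def)
      also have "\<dots> \<le> l / c * t" using False that l_nonneg c by (intro mult_left_mono) auto
      finally show ?thesis .
    qed
    show "(\<lambda>n. real (Suc n) * (p (v + c / real (Suc n)) - p v)) \<longlonglongrightarrow> l * (p v - J v - (1 - F (v + y)))"
      if "0 \<le> v" "v \<le> U" for v
    proof -
      have "J v = (LINT s|interval_measure F. indicator {..v} s * fall_prob (v - s))"
        unfolding J_def D_def by (intro Bochner_Integration.integral_cong) (auto simp: p_def indicator_def)
      moreover have "p (v + c / real (Suc n)) = fall_prob (v + c / real (Suc n))" for n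
        using that c by (simp add: p_def)
      ultimately show ?thesis using fall_prob_derivative[OF that(1)] that by (simp add: p_def)
    qed
  qed measurable
  also have "\<dots> = (LINT v|lborel. l * (indicator {0..U} v * p v) - l * (indicator {0..U} v * J v)
      - l * (indicator {0..U} v * (1 - F (v + y))))"
    by (intro Bochner_Integration.integral_cong) (auto simp: algebra_simps)
  also have "\<dots> = l * (LINT v|lborel. indicator {0..U} v * p v) - l * (LINT v|lborel. indicator {0..U} v * J v)
      - l * (LINT v|lborel. indicator {0..U} v * (1 - F (v + y)))"
    using int_bounded[of p] int_bounded[of J] int_bounded[of "\<lambda>v. 1 - F (v + y)"] p J01 F_bounds
    by (simp add: abs_of_nonneg)
  also have "(LINT v|lborel. indicator {0..U} v * J v) =
      (LINT v|lborel. LINT s|D. indicator {0..U} v * (indicator {..v} s * p (v - s)))"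
    by (simp add: J_def)
  also have "\<dots> = (LINT s|D. LINT v|lborel. indicator {0..U} v * (indicator {..v} s * p (v - s)))"
    by (intro swap) (auto simp: indicator_def p abs_of_nonneg)
  \<comment> \<open>For a fixed claim size \<open>s\<close> substitute \<open>v = s + w\<close>,
    where \<open>w\<close> is the capital left by the claim. Positivity of \<open>s\<close> turns
    the range into \<open>0 \<le> w\<close> and \<open>s \<le> U - w\<close>; a second exchange then
    integrates \<open>s\<close> out to \<open>F (U - w)\<close>.\<close>
  also have "\<dots> = (LINT s|D. LINT w|lborel. indicator {0..U} w * (indicator {..U - w} s * p w))"
  proof (rule integral_cong_AE)
    show "AE s in D. (LINT v|lborel. indicator {0..U} v * (indicator {..v} s * p (v - s))) =
        (LINT w|lborel. indicator {0..U} w * (indicator {..U - w} s * p w))"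
      using claim_pos[folded D_def]
    proof eventually_elim
      case (elim s)
      have "(LINT v|lborel. indicator {0..U} v * (indicator {..v} s * p (v - s))) =
          (LINT w|lborel. indicator {0..U} (s + 1 * w) * (indicator {..s + 1 * w} s * p (s + 1 * w - s)))"
        using lborel_integral_real_affine[of 1 "\<lambda>v. indicator {0..U} v * (indicator {..v} s * p (v - s))" s] by simp
      also have "\<dots> = (LINT w|lborel. indicator {0..U} w * (indicator {..U - w} s * p w))"
        using elim by (intro Bochner_Integration.integral_cong) (auto simp: indicator_def)
      finally show ?case .
    qed
  qed (unfold indicator_def atMost_iff, measurable)
  also have "\<dots> = (LINT w|lborel. LINT s|D. indicator {0..U} w * (indicator {..U - w} s * p w))"
  proof (rule swap[symmetric])
    show "(\<lambda>(w, s). indicator {..U - w} s * p w) \<in> borel_measurable (borel \<Otimes>\<^sub>M D)"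
      unfolding indicator_def atMost_iff by measurable
  qed (auto simp: indicator_def p abs_of_nonneg)
  also have "\<dots> = (LINT w|lborel. indicator {0..U} w * (F (U - w) * p w))"
    by (simp add: F_eq D_def sets_D)
  also have "l * (LINT v|lborel. indicator {0..U} v * p v) - l * (LINT w|lborel. indicator {0..U} w * (F (U - w) * p w)) =
      l * (LINT w|lborel. indicator {0..U} w * ((1 - F (U - w)) * p w))"
  proof -
    have "\<bar>F (U - w) * p w\<bar> \<le> 1" for w using F_bounds p by (auto simp: abs_mult intro!: mult_le_one)
    then have "(LINT v|lborel. indicator {0..U} v * p v) - (LINT w|lborel. indicator {0..U} w * (F (U - w) * p w)) =
        (LINT w|lborel. indicator {0..U} w * p w - indicator {0..U} w * (F (U - w) * p w))"
      using p by (intro Bochner_Integration.integral_diff[symmetric] int_bounded) (auto simp: abs_of_nonneg)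
    also have "\<dots> = (LINT w|lborel. indicator {0..U} w * ((1 - F (U - w)) * p w))"
      by (intro Bochner_Integration.integral_cong) (auto simp: algebra_simps)
    finally show ?thesis by (simp add: right_diff_distrib[symmetric])
  qed
  also have "(LINT w|lborel. indicator {0..U} w * ((1 - F (U - w)) * p w)) =
      (LINT w|lborel. indicator {0..U} w * ((1 - F (U - w)) * fall_prob w))"
    by (intro Bochner_Integration.integral_cong) (auto simp: p_def indicator_def)
  finally show ?thesis using U by (simp add: p_def)
qed

end

lemma renewal_kernel_ladder:
  assumes "c > 0" and int: "integrable (interval_measure F) (\<lambda>x. x)"
    and load: "l * (LINT x|interval_measure F. x) < c"
  shows "renewal_kernel (ladder_kernel c F l)"
    and "(LINT z|lborel. ladder_kernel c F l z) = l * (LINT x|interval_measure F. x) / c"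
proof -
  have eq: "ladder_kernel c F l = (\<lambda>z. l / c * (indicator {0..} z * (1 - F z)))"
    by (auto simp: ladder_kernel_def fun_eq_iff)
  show 1: "(LINT z|lborel. ladder_kernel c F l z) = l * (LINT x|interval_measure F. x) / c"
    by (simp only: eq integral_mult_right_zero integral_tail(2)[OF int]) simp
  show "renewal_kernel (ladder_kernel c F l)"
  proof
    show "ladder_kernel c F l \<in> borel_measurable borel" unfolding eq by measurable
    show "integrable lborel (ladder_kernel c F l)"
      unfolding eq using integral_tail(1)[OF int] by simp
    show "(LINT z|lborel. ladder_kernel c F l z) < 1" using 1 load \<open>c > 0\<close> by simp
  qed (use l_nonneg \<open>c > 0\<close> F_bounds in \<open>auto simp: ladder_kernel_def indicator_def\<close>)
qed

text \<open>Divided by \<open>c\<close>, the two integrals of the integrated equation are the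
  convolution with the ladder kernel and an increment of its tail. Convolution runs over the whole
  line, hence the cut at capital 0; the limit at infinity settles the value there.\<close>

lemma fall_prob_renewal:
  assumes "c > 0" "y \<ge> 0" and int: "integrable (interval_measure F) (\<lambda>x. x)"
    and load: "l * (LINT x|interval_measure F. x) < c"
    and lim: "(fall_prob c y \<longlongrightarrow> 0) at_top" and "u \<ge> 0"
  defines "m \<equiv> \<lambda>u. indicator {0..} u * fall_prob c y u"
  shows "m u = renewal_kernel.conv (ladder_kernel c F l) m u + renewal_kernel.tail (ladder_kernel c F l) (u + y)"
proof -
  interpret K: renewal_kernel "ladder_kernel c F l" by (rule renewal_kernel_ladder) fact+
  have [measurable]: "fall_prob c y \<in> borel_measurable borel" by (rule fall_prob_measurable) fact+
  note b = fall_prob_bounds[OF \<open>c > 0\<close> \<open>y \<ge> 0\<close>]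
  show ?thesis
  proof (rule K.renewal_equation_of_increments[where B = 1])
    show "m \<in> borel_measurable borel" unfolding m_def by measurable
    show "\<bar>m x\<bar> \<le> 1" for x using b by (auto simp: m_def indicator_def)
    show "(m \<longlongrightarrow> 0) at_top"
      by (rule Lim_transform_eventually[OF lim])
        (use eventually_ge_at_top[of 0] in \<open>eventually_elim, simp add: m_def\<close>)
    fix U :: real assume U: "0 \<le> U"
    have 1: "(LINT w|lborel. indicator {0..U} w * ((1 - F (U - w)) * fall_prob c y w)) * (l / c) = K.conv m U"
    proof -
      have "K.conv m U = (LINT z|lborel. ladder_kernel c F l (U + (- 1) * z) * m (U - (U + (- 1) * z)))"
        unfolding K.conv_def using lborel_integral_real_affine[of "- 1" "\<lambda>z. ladder_kernel c F l z * m (U - z)" U] by simp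
      also have "\<dots> = (LINT w|lborel. indicator {0..U} w * ((1 - F (U - w)) * fall_prob c y w) * (l / c))"
        by (intro Bochner_Integration.integral_cong) (auto simp: ladder_kernel_def m_def indicator_def)
      finally show ?thesis by simp
    qed
    have 2: "(LINT w|lborel. indicator {0..U} w * (1 - F (w + y))) * (l / c) = K.tail y - K.tail (U + y)"
    proof -
      have "K.tail y - K.tail (U + y) = (LINT z|lborel. indicator {y..U + y} z * ladder_kernel c F l z)"
        using U by (intro K.tail_interval[symmetric]) simp
      also have "\<dots> = (LINT z|lborel. indicator {y..U + y} (y + 1 * z) * ladder_kernel c F l (y + 1 * z))"
        using lborel_integral_real_affine[of 1 "\<lambda>z. indicator {y..U + y} z * ladder_kernel c F l z" y] by simp
      also have "\<dots> = (LINT w|lborel. indicator {0..U} w * (1 - F (w + y)) * (l / c))"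
        using \<open>y \<ge> 0\<close>
        by (intro Bochner_Integration.integral_cong) (auto simp: ladder_kernel_def indicator_def add.commute)
      finally show ?thesis by simp
    qed
    have "fall_prob c y U - fall_prob c y 0 = K.conv m U - (K.tail y - K.tail (U + y))"
      using fall_prob_integrated[OF \<open>c > 0\<close> \<open>y \<ge> 0\<close> U] \<open>c > 0\<close>
      unfolding 1[symmetric] 2[symmetric] by (simp add: field_simps)
    then show "m U - m 0 = K.conv m U - (K.tail y - K.tail (U + y))"
      using U by (simp add: m_def)
  qed fact
qed

end

section \<open>The law of the deficit\<close>

lemma mixture_model_mixed_poisson:
  assumes "mixed_poisson_model M \<Lambda> F N X"
  shows "mixture_model M (distr M borel \<Lambda>) F N X"
proof -
  have M: "prob_space M" "claim_sizes M F X" "independent_of_claims M N X" "counting_process M N"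
    and \<Lambda>[measurable]: "\<Lambda> \<in> borel_measurable M" and nonneg: "AE \<omega> in M. 0 \<le> \<Lambda> \<omega>"
    and fdd: "\<And>B n t k. B \<in> sets borel \<Longrightarrow> time_grid n t \<Longrightarrow>
        measure M {\<omega>\<in>space M. \<Lambda> \<omega> \<in> B \<and> (\<forall>i<n. N (t (Suc i)) \<omega> = N (t i) \<omega> + k i)}
          = (LINT l:B|distr M borel \<Lambda>. poisson_increments l n t k)"
    using assms by (auto simp: mixed_poisson_model_def mixed_poisson_process_def)
  interpret prob_space M by fact
  interpret G: prob_space "distr M borel \<Lambda>" by (rule prob_space_distr) simp
  show ?thesis
  proof
    show "AE l in distr M borel \<Lambda>. 0 \<le> l" using nonneg by (subst AE_distr_iff) auto
    fix n t k assume "time_grid n t"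
    from fdd[of UNIV, OF _ this]
    show "prob {\<omega>\<in>space M. \<forall>i<n. N (t (Suc i)) \<omega> = N (t i) \<omega> + k i} =
        (LINT l|distr M borel \<Lambda>. poisson_increments l n t k)"
      by (simp add: set_lebesgue_integral_def)
  qed (use M in auto)
qed

lemma pure_model_poisson:
  assumes "poisson_model M l F N X" "0 \<le> l"
  shows "pure_model M l F N X"
proof -
  have M: "prob_space M" "claim_sizes M F X" "independent_of_claims M N X" "counting_process M N"
    and fdd: "\<And>n t k. time_grid n t \<Longrightarrow>
        measure M {\<omega>\<in>space M. \<forall>i<n. N (t (Suc i)) \<omega> = N (t i) \<omega> + k i} = poisson_increments l n t k"
    using assms by (auto simp: poisson_model_def poisson_process_def)
  interpret prob_space M by fact
  interpret G: prob_space "return borel l" by (rule prob_space_return) simp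
  show ?thesis
  proof
    show "AE l in return borel l. 0 \<le> l" using \<open>0 \<le> l\<close> by (subst AE_return) auto
    fix n t k assume grid: "time_grid n t"
    have "(\<lambda>l. poisson_increments l n t k) \<in> borel_measurable borel"
      unfolding poisson_increments_def by measurable
    then show "prob {\<omega>\<in>space M. \<forall>i<n. N (t (Suc i)) \<omega> = N (t i) \<omega> + k i} =
        (LINT l|return borel l. poisson_increments l n t k)"
      by (subst integral_return) (auto simp: fdd[OF grid])
  qed (use M assms in auto)
qed

text \<open>The infimum in \<open>ruin_time\<close> is over positive times, the first passage over
  times \<open>\<ge> 0\<close>; they agree because the surplus starts at a nonnegative
  \<open>u\<close>.\<close>

lemma ruin_time_eq:
  assumes "N 0 \<omega> = 0" "0 \<le> u" and t: "0 \<le> t" "level c (\<lambda>t. N t \<omega>) (\<lambda>i. X i \<omega>) u t < 0"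
    "\<And>r. 0 \<le> r \<Longrightarrow> r < t \<Longrightarrow> 0 \<le> level c (\<lambda>t. N t \<omega>) (\<lambda>i. X i \<omega>) u r"
  shows "ruin_time c N X u \<omega> = ereal t"
  unfolding ruin_time_def level_eq_surplus
proof (rule antisym)
  have "t \<noteq> 0" using assms by (auto simp: level_def)
  then show "Inf (ereal ` {t. 0 < t \<and> level c (\<lambda>t. N t \<omega>) (\<lambda>i. X i \<omega>) u t < 0}) \<le> ereal t"
    using t(1,2) by (intro Inf_lower) auto
  show "ereal t \<le> Inf (ereal ` {t. 0 < t \<and> level c (\<lambda>t. N t \<omega>) (\<lambda>i. X i \<omega>) u t < 0})"
  proof (rule Inf_greatest, clarify)
    fix s assume "0 < s" "level c (\<lambda>t. N t \<omega>) (\<lambda>i. X i \<omega>) u s < 0"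
    then show "ereal t \<le> ereal s" using t(3)[of s] by (cases "s < t") auto
  qed
qed

context mixture_model
begin

context
  fixes c u :: real
  assumes c: "c > 0" and u: "u \<ge> 0"
begin

lemma ruin_event_eq: "ruin_event M c N X u = fall_event M c N X u 0"
proof -
  have "ruin_time c N X u \<omega> < \<infinity> \<longleftrightarrow> falls_below c (\<lambda>t. N t \<omega>) (\<lambda>i. X i \<omega>) u 0"
    if "\<omega> \<in> space M" for \<omega>
  proof -
    note reg = regular_paths[OF that]
    have "ruin_time c N X u \<omega> < \<infinity> \<longleftrightarrow> (\<exists>t>0. level c (\<lambda>t. N t \<omega>) (\<lambda>i. X i \<omega>) u t < 0)"
      unfolding ruin_time_def level_eq_surplus Inf_less_iff by auto
    also have "\<dots> \<longleftrightarrow> (\<exists>t\<ge>0. level c (\<lambda>t. N t \<omega>) (\<lambda>i. X i \<omega>) u t < 0)"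
    proof -
      have "\<not> level c (\<lambda>t. N t \<omega>) (\<lambda>i. X i \<omega>) u 0 < 0"
        using reg u by (simp add: level_def regular_path_def)
      then show ?thesis by (metis order_le_less)
    qed
    finally show ?thesis by (simp add: falls_below_zero_iff[OF reg c])
  qed
  then show ?thesis by (auto simp: ruin_event_def fall_event_def)
qed

definition surplus_at_ruin :: "'a \<Rightarrow> real" where
  "surplus_at_ruin \<omega> = surplus c N X u (real_of_ereal (ruin_time c N X u \<omega>)) \<omega>"

lemma surplus_at_ruin:
  assumes "\<omega> \<in> ruin_event M c N X u"
  shows "surplus_at_ruin \<omega> < 0"
    and "y \<ge> 0 \<Longrightarrow> surplus_at_ruin \<omega> < - y \<longleftrightarrow> \<omega> \<in> fall_event M c N X u y"
proof -
  have \<omega>: "\<omega> \<in> space M" "falls_below c (\<lambda>t. N t \<omega>) (\<lambda>i. X i \<omega>) u 0"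
    using assms by (auto simp: ruin_event_eq fall_event_def)
  then obtain t where t: "0 \<le> t" "level c (\<lambda>t. N t \<omega>) (\<lambda>i. X i \<omega>) u t < 0"
    "\<And>r. 0 \<le> r \<Longrightarrow> r < t \<Longrightarrow> 0 \<le> level c (\<lambda>t. N t \<omega>) (\<lambda>i. X i \<omega>) u r"
    by (auto simp: falls_below_def)
  have "N 0 \<omega> = 0" using regular_paths[OF \<omega>(1)] by (simp add: regular_path_def)
  then have "ruin_time c N X u \<omega> = ereal t" by (intro ruin_time_eq u t)
  then have eq: "surplus_at_ruin \<omega> = level c (\<lambda>t. N t \<omega>) (\<lambda>i. X i \<omega>) u t"
    by (simp add: surplus_at_ruin_def level_eq_surplus)
  show "surplus_at_ruin \<omega> < 0" using eq t(2) by simp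
  show "surplus_at_ruin \<omega> < - y \<longleftrightarrow> \<omega> \<in> fall_event M c N X u y" if "y \<ge> 0"
    unfolding eq using falls_below_iff_first_passage[OF t that] \<omega>(1) by (simp add: fall_event_def)
qed

lemma ruin_event_measurable[measurable]: "ruin_event M c N X u \<in> events"
  unfolding ruin_event_eq by (rule fall_event_limit[OF c order_refl])

text \<open>Inside the ruin event the sublevel sets for \<open>a \<le> 0\<close> are fall events,
  and for \<open>a > 0\<close> they are everything.\<close>

lemma surplus_at_ruin_measurable[measurable]:
  "surplus_at_ruin \<in> borel_measurable (restrict_space M (ruin_event M c N X u))"
proof (rule borel_measurableI_less)
  fix a :: real
  have sp: "space (restrict_space M (ruin_event M c N X u)) = ruin_event M c N X u"
    by (auto simp: space_restrict_space ruin_event_def)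
  show "{\<omega> \<in> space (restrict_space M (ruin_event M c N X u)). surplus_at_ruin \<omega> < a}
      \<in> sets (restrict_space M (ruin_event M c N X u))"
  proof (cases "a \<le> 0")
    case True
    have "{\<omega> \<in> ruin_event M c N X u. surplus_at_ruin \<omega> < a} =
        ruin_event M c N X u \<inter> fall_event M c N X u (- a)"
      using surplus_at_ruin(2)[of _ "- a"] True by auto
    moreover have "fall_event M c N X u (- a) \<in> events"
      using True by (intro fall_event_limit[OF c]) simp
    ultimately show ?thesis
      unfolding sp by (auto simp: sets_restrict_space_iff)
  next
    case False
    then have "{\<omega> \<in> ruin_event M c N X u. surplus_at_ruin \<omega> < a} = ruin_event M c N X u"
      using surplus_at_ruin(1) by force
    then show ?thesis unfolding sp by (auto simp: sets_restrict_space_iff)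
  qed
qed

lemma sets_deficit_law[measurable_cong]: "sets (deficit_law M c N X u) = sets borel"
  by (simp add: deficit_law_def)

lemma emeasure_deficit_law:
  assumes [measurable]: "A \<in> sets borel"
  shows "emeasure (deficit_law M c N X u) A =
    emeasure M {\<omega>\<in>ruin_event M c N X u. surplus_at_ruin \<omega> \<in> A}"
proof -
  have sub: "ruin_event M c N X u \<subseteq> space M" by (auto simp: ruin_event_def)
  have "emeasure (deficit_law M c N X u) A = emeasure (restrict_space M (ruin_event M c N X u))
      (surplus_at_ruin -` A \<inter> space (restrict_space M (ruin_event M c N X u)))"
    unfolding deficit_law_def surplus_at_ruin_def[abs_def, symmetric]
    by (rule emeasure_distr) auto
  also have "\<dots> = emeasure M (surplus_at_ruin -` A \<inter> ruin_event M c N X u)"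
    using sub by (subst emeasure_restrict_space)
      (auto simp: space_restrict_space Int_absorb2 Int_absorb1 intro!: arg_cong[where f="emeasure M"])
  finally show ?thesis by (simp add: vimage_def Int_def conj_commute)
qed

lemma emeasure_deficit_law_lessThan:
  assumes "y \<ge> 0"
  shows "emeasure (deficit_law M c N X u) {..<- y} = ennreal (prob (fall_event M c N X u y))"
proof -
  have "fall_event M c N X u y \<subseteq> ruin_event M c N X u"
    unfolding ruin_event_eq using assms by (auto simp: fall_event_def intro: falls_below_mono)
  then have "{\<omega>\<in>ruin_event M c N X u. surplus_at_ruin \<omega> \<in> {..<- y}} = fall_event M c N X u y"
    using surplus_at_ruin(2)[OF _ assms] by auto
  then show ?thesis by (simp add: emeasure_deficit_law emeasure_eq_measure)
qed

lemma emeasure_deficit_law_UNIV: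
  "emeasure (deficit_law M c N X u) UNIV = ennreal (prob (fall_event M c N X u 0))"
  by (simp add: emeasure_deficit_law ruin_event_eq emeasure_eq_measure)

lemma emeasure_deficit_law_nonneg: "emeasure (deficit_law M c N X u) {0..} = 0"
proof -
  have "{\<omega>\<in>ruin_event M c N X u. surplus_at_ruin \<omega> \<in> {0..}} = {}" using surplus_at_ruin(1) by force
  then show ?thesis using emeasure_deficit_law[of "{0..}"] by (simp only: emeasure_empty atLeast_borel)
qed

end

end

text \<open>Almost surely no claim has occurred by any integer time, hence by monotonicity none
  ever. Rate 0 is separate because the exponential bounds of the hypotheses concern positive
  rates.\<close>

lemma (in pure_model) no_fall_rate_0:
  assumes "l = 0" "c > 0" "u \<ge> 0" "y \<ge> 0"
  shows "prob (fall_event M c N X u y) = 0"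
proof -
  have "AE \<omega> in M. N (real n) \<omega> = 0" for n
  proof -
    have "prob {\<omega>\<in>space M. N (real n) \<omega> = 0} = 1"
      using prob_count[of "real n" 0] \<open>l = 0\<close> by (simp add: poisson_weight_def)
    moreover have "{\<omega>\<in>space M. N (real n) \<omega> = 0} \<in> events"
      using measurable_N[of "real n"] by measurable
    ultimately show ?thesis by (simp add: prob_eq_1)
  qed
  then have "AE \<omega> in M. \<forall>n. N (real n) \<omega> = 0" by (simp add: AE_all_countable)
  then have "AE \<omega> in M. \<omega> \<notin> fall_event M c N X u y"
  proof (rule AE_mp, intro AE_I2 impI notI)
    fix \<omega> assume \<omega>: "\<omega> \<in> space M" "\<forall>n. N (real n) \<omega> = 0" "\<omega> \<in> fall_event M c N X u y"
    have "N t \<omega> = 0" if t: "0 \<le> t" for t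
    proof -
      obtain n where "t \<le> real n" using real_arch_simple by blast
      then have "N t \<omega> \<le> N (real n) \<omega>"
        using regular_paths[OF \<omega>(1)] t by (auto simp: regular_path_def mono_on_def)
      then show ?thesis using \<omega>(2) by simp
    qed
    then have "0 \<le> level c (\<lambda>t. N t \<omega>) (\<lambda>i. X i \<omega>) u t" if "0 \<le> t" for t
      using assms that by (simp add: level_def)
    then show False using \<omega>(3) \<open>y \<ge> 0\<close> by (force simp: fall_event_def falls_below_def)
  qed
  then show ?thesis using fall_event_limit(1)[OF assms(2,4)] by (simp add: prob_eq_0)
qed

section \<open>Mixing over the rate\<close>

lemma exp_neg_tendsto_0:
  fixes r :: real assumes "0 < r"
  shows "((\<lambda>u. exp (- (r * u))) \<longlongrightarrow> 0) at_top"
proof -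
  have "filterlim (\<lambda>u. r * u) at_top at_top"
    using assms by (rule filterlim_tendsto_pos_mult_at_top[OF tendsto_const _ filterlim_ident])
  then show ?thesis
    by (intro filterlim_compose[OF exp_at_bot] filterlim_compose[OF filterlim_uminus_at_bot_at_top])
qed

text \<open>The hypotheses in working form: ruin at a fixed rate is a fall event with
  \<open>y = 0\<close>, free of the convention for \<open>l * \<mu> \<ge> c\<close>, and
  \<open>l1\<close> is an almost sure bound on the rate instead of an infimum.\<close>

locale mixed_ruin = mixture_model M G F N X
  for M :: "'a measure" and G :: "real measure" and F N X +
  fixes Q :: "real \<Rightarrow> 'b measure" and K Y and c \<mu> l1 c1 R1 :: real
  assumes premium: "c > 0"
    and pure: "\<And>l. 0 \<le> l \<Longrightarrow> pure_model (Q l) l F (K l) (Y l)"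
    and claim_int: "integrable (interval_measure F) (\<lambda>x. x)"
    and mean: "\<mu> = (LINT x|interval_measure F. x)"
    and support: "AE l in G. l \<le> l1"
    and l1: "0 < l1" "l1 * \<mu> < c"
    and atom: "measure G {l1} > 0"
    and constants: "c1 > 0" "R1 > 0"
    and cramer: "((\<lambda>u. exp (R1 * u) * measure (Q l1) (fall_event (Q l1) c (K l1) (Y l1) u 0)) \<longlongrightarrow> c1) at_top"
    and lundberg: "\<And>l. 0 < l \<Longrightarrow> l < l1 \<Longrightarrow>
      \<exists>R>R1. \<forall>u\<ge>0. measure (Q l) (fall_event (Q l) c (K l) (Y l) u 0) \<le> exp (- R * u)"
begin

definition given_fall :: "real \<Rightarrow> real \<Rightarrow> real \<Rightarrow> real" where
  "given_fall l u y = measure (Q l) (fall_event (Q l) c (K l) (Y l) u y)"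

definition mixed_fall :: "real \<Rightarrow> real \<Rightarrow> real" where
  "mixed_fall u y = prob (fall_event M c N X u y)"

definition claim_tail :: "real \<Rightarrow> real" where
  "claim_tail x = (LINT z:{x..}|lborel. 1 - F z)"

definition limit_tail :: "real \<Rightarrow> real" where
  "limit_tail x = 1 / (c - l1 * \<mu>) *
        (c * exp (- R1 * x)
         - l1 * (LINT z:{0..x}|lborel. exp (- R1 * (x - z)) * (1 - F z))
         - l1 * claim_tail x)"

lemma claim_tail_nonneg: "0 \<le> claim_tail x"
  unfolding claim_tail_def set_lebesgue_integral_def
  by (intro Bochner_Integration.integral_nonneg) (auto simp: F_bounds)

lemma mean_nonneg: "0 \<le> \<mu>"
  unfolding mean using claim_pos by (intro integral_nonneg_AE) (auto elim!: eventually_mono)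

lemma given_fall_bounds:
  assumes "0 \<le> l" shows "0 \<le> given_fall l u y" "given_fall l u y \<le> 1"
proof -
  interpret P: pure_model "Q l" l F "K l" "Y l" by (rule pure[OF assms])
  show "0 \<le> given_fall l u y" "given_fall l u y \<le> 1" by (auto simp: given_fall_def)
qed

lemma given_fall_mono:
  assumes "0 \<le> l" "0 \<le> y" "y \<le> y'"
  shows "given_fall l u y' \<le> given_fall l u y"
proof -
  interpret P: pure_model "Q l" l F "K l" "Y l" by (rule pure[OF assms(1)])
  show ?thesis
    unfolding given_fall_def using assms
    by (intro P.finite_measure_mono P.fall_event_limit[OF premium])
      (auto simp: fall_event_def intro: falls_below_mono)
qed

lemma given_fall_0: "0 \<le> u \<Longrightarrow> 0 \<le> y \<Longrightarrow> given_fall 0 u y = 0"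
  unfolding given_fall_def using pure_model.no_fall_rate_0[OF pure] premium by simp

text \<open>The gap \<open>R - R1\<close> gives exponential decay at each rate. It may shrink as the
  rate approaches \<open>l1\<close>, so the convergence is pointwise in \<open>l\<close>.\<close>

lemma exp_times_given_fall_tendsto_0:
  assumes "0 \<le> l" "l < l1" "0 \<le> y"
  shows "((\<lambda>u. exp (R1 * u) * given_fall l u y) \<longlongrightarrow> 0) at_top"
proof (cases "l = 0")
  case True
  show ?thesis
    by (rule tendsto_eventually)
      (use eventually_ge_at_top[of 0] in \<open>eventually_elim, simp add: True given_fall_0 assms\<close>)
next
  case False
  then obtain R where R: "R > R1" "\<And>u. u \<ge> 0 \<Longrightarrow> given_fall l u 0 \<le> exp (- R * u)"
    using lundberg[of l] assms by (auto simp: given_fall_def)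
  show ?thesis
  proof (rule Lim_null_comparison)
    show "((\<lambda>u. exp (- ((R - R1) * u))) \<longlongrightarrow> 0) at_top" using R by (intro exp_neg_tendsto_0) simp
    show "\<forall>\<^sub>F u in at_top. norm (exp (R1 * u) * given_fall l u y) \<le> exp (- ((R - R1) * u))"
      using eventually_ge_at_top[of 0]
    proof eventually_elim
      case (elim u)
      have "exp (R1 * u) * given_fall l u y \<le> exp (R1 * u) * exp (- R * u)"
        using given_fall_mono[of l 0 y u] R(2)[OF elim] assms by (intro mult_left_mono) auto
      also have "\<dots> = exp (- ((R - R1) * u))" by (simp add: exp_add[symmetric] algebra_simps)
      finally show ?case using given_fall_bounds assms by (simp add: abs_mult)
    qed
  qed
qed

text \<open>This is the boundary condition of the renewal equation, read off from the asymptotics at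
  \<open>l1\<close>, the exponential bounds below it and the absence of ruin at rate 0.\<close>

lemma given_fall_tendsto_0:
  assumes "0 \<le> l" "l \<le> l1" "0 \<le> y"
  shows "((\<lambda>u. given_fall l u y) \<longlongrightarrow> 0) at_top"
proof (rule Lim_null_comparison)
  show "\<forall>\<^sub>F u in at_top. norm (given_fall l u y) \<le> given_fall l u 0"
    using given_fall_bounds given_fall_mono[of l 0 y] assms by (auto intro!: always_eventually)
  have "((\<lambda>u. exp (R1 * u) * given_fall l u 0) \<longlongrightarrow> (if l = l1 then c1 else 0)) at_top"
    using exp_times_given_fall_tendsto_0[of l 0] assms cramer by (auto simp: given_fall_def)
  moreover have "((\<lambda>u. exp (- (R1 * u))) \<longlongrightarrow> 0) at_top"
    using constants by (intro exp_neg_tendsto_0)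
  ultimately have "((\<lambda>u. exp (- (R1 * u)) * (exp (R1 * u) * given_fall l u 0)) \<longlongrightarrow>
      0 * (if l = l1 then c1 else 0)) at_top"
    by (intro tendsto_mult)
  then show "((\<lambda>u. given_fall l u 0) \<longlongrightarrow> 0) at_top"
    by (simp add: mult.assoc[symmetric] exp_add[symmetric])
qed

lemma rate_less:
  assumes "0 \<le> l" "l \<le> l1"
  shows "l * \<mu> < c" "l * \<mu> / c \<le> l1 * \<mu> / c" "l1 * \<mu> / c < 1"
proof -
  have "l * \<mu> \<le> l1 * \<mu>" using assms mean_nonneg by (intro mult_right_mono)
  then show "l * \<mu> < c" "l * \<mu> / c \<le> l1 * \<mu> / c" using l1 premium by (auto simp: divide_right_mono)
  show "l1 * \<mu> / c < 1" using l1 premium by simp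
qed

lemma renewal_kernel_claims:
  assumes "0 \<le> l" "l \<le> l1"
  shows "renewal_kernel (ladder_kernel c F l)"
    and "renewal_kernel.mass (ladder_kernel c F l) = l * \<mu> / c"
    and "0 \<le> x \<Longrightarrow> renewal_kernel.tail (ladder_kernel c F l) x = l / c * claim_tail x"
proof -
  interpret P: pure_model "Q l" l F "K l" "Y l" by (rule pure[OF assms(1)])
  note rk = P.renewal_kernel_ladder[OF premium claim_int, folded mean, OF rate_less(1)[OF assms]]
  show 1: "renewal_kernel (ladder_kernel c F l)" by (rule rk)
  show "renewal_kernel.mass (ladder_kernel c F l) = l * \<mu> / c"
    using rk by (simp add: renewal_kernel.mass_def[OF 1])
  assume "0 \<le> x"
  have "renewal_kernel.tail (ladder_kernel c F l) x = (LINT z|lborel. l / c * (indicator {x..} z * (1 - F z)))"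
    unfolding renewal_kernel.tail_def[OF 1] ladder_kernel_def
    using \<open>0 \<le> x\<close> by (intro Bochner_Integration.integral_cong) (auto simp: indicator_def)
  then show "renewal_kernel.tail (ladder_kernel c F l) x = l / c * claim_tail x"
    by (simp add: claim_tail_def set_lebesgue_integral_def)
qed

text \<open>Set to 0 for negative capital, where a fall may occur at once, so that the renewal
  lemmas apply on the whole line.\<close>

definition fall_fun :: "real \<Rightarrow> real \<Rightarrow> real \<Rightarrow> real" where
  "fall_fun l y u = indicator {0..} u * given_fall l u y"

lemma fall_fun_properties:
  assumes l: "0 \<le> l" "l \<le> l1" and y: "0 \<le> y"
  shows "fall_fun l y \<in> borel_measurable borel"
    and "0 \<le> fall_fun l y u" "fall_fun l y u \<le> 1" "u < 0 \<Longrightarrow> fall_fun l y u = 0"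
    and "0 \<le> u \<Longrightarrow> fall_fun l y u =
      renewal_kernel.conv (ladder_kernel c F l) (fall_fun l y) u + renewal_kernel.tail (ladder_kernel c F l) (u + y)"
proof -
  interpret P: pure_model "Q l" l F "K l" "Y l" by (rule pure[OF l(1)])
  have eq2: "P.fall_prob c y u = given_fall l u y" for u
    by (simp add: P.fall_prob_def[OF premium y] given_fall_def)
  have eq3: "fall_fun l y = (\<lambda>u. indicator {0..} u * P.fall_prob c y u)"
    by (simp add: fun_eq_iff fall_fun_def eq2)
  have [measurable]: "P.fall_prob c y \<in> borel_measurable borel"
    by (rule P.fall_prob_measurable[OF premium y])
  show "fall_fun l y \<in> borel_measurable borel" unfolding eq3 by measurable
  show "0 \<le> fall_fun l y u" "fall_fun l y u \<le> 1" "u < 0 \<Longrightarrow> fall_fun l y u = 0"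
    using given_fall_bounds[OF l(1)] by (auto simp: fall_fun_def indicator_def)
  show "fall_fun l y u =
      renewal_kernel.conv (ladder_kernel c F l) (fall_fun l y) u + renewal_kernel.tail (ladder_kernel c F l) (u + y)"
    if "0 \<le> u"
    unfolding eq3
  proof (rule P.fall_prob_renewal[OF premium y claim_int _ _ that])
    show "l * (LINT x|interval_measure F. x) < c" using rate_less(1)[OF l] by (simp add: mean)
    have "P.fall_prob c y = (\<lambda>u. given_fall l u y)" by (simp add: fun_eq_iff eq2)
    then show "(P.fall_prob c y \<longlongrightarrow> 0) at_top"
      using given_fall_tendsto_0[OF l y] by simp
  qed
qed

text \<open>Replacing \<open>l\<close> by \<open>l1\<close> weakens both sides, so the bound becomes
  uniform over the rates up to \<open>l1\<close> as well as in \<open>u\<close>.\<close>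

lemma given_fall_le:
  assumes l: "0 \<le> l" "l \<le> l1" and y: "0 \<le> y" and u: "0 \<le> u"
  shows "(1 - l1 * \<mu> / c) * given_fall l u y \<le> l1 / c * claim_tail y"
proof -
  interpret R: renewal_kernel "ladder_kernel c F l" by (rule renewal_kernel_claims[OF l])
  have "(1 - l * \<mu> / c) * fall_fun l y u \<le> l / c * claim_tail y"
    using R.deficit_bound[of y "fall_fun l 0" "fall_fun l y" u]
      fall_fun_properties[OF l order_refl] fall_fun_properties[OF l y] y u renewal_kernel_claims[OF l] by simp
  then have "(1 - l * \<mu> / c) * given_fall l u y \<le> l / c * claim_tail y"
    using u by (simp add: fall_fun_def)
  moreover have "(1 - l1 * \<mu> / c) * given_fall l u y \<le> (1 - l * \<mu> / c) * given_fall l u y"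
    using rate_less[OF l] given_fall_bounds[OF l(1)] by (intro mult_right_mono) auto
  moreover have "l / c * claim_tail y \<le> l1 / c * claim_tail y"
    using l premium claim_tail_nonneg by (intro mult_right_mono divide_right_mono) auto
  ultimately show ?thesis by simp
qed

lemma given_fall_asymptotics:
  assumes y: "0 \<le> y"
  shows "((\<lambda>u. exp (R1 * u) * given_fall l1 u y) \<longlongrightarrow> c1 * limit_tail y) at_top"
proof -
  have l: "0 \<le> l1" "l1 \<le> l1" using l1 by auto
  interpret R: renewal_kernel "ladder_kernel c F l1" by (rule renewal_kernel_claims[OF l])
  have "((\<lambda>u. exp (R1 * u) * fall_fun l1 0 u) \<longlongrightarrow> c1) at_top"
    by (rule Lim_transform_eventually[OF cramer])
      (use eventually_ge_at_top[of 0] in \<open>eventually_elim, simp add: fall_fun_def given_fall_def\<close>)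
  then have "((\<lambda>u. exp (R1 * u) * fall_fun l1 y u) \<longlongrightarrow>
    c1 * ((exp (- R1 * y) - R.tail y - (LINT z|lborel. indicator {..<y} z * ladder_kernel c F l1 z * exp (- R1 * (y - z))))
      / (1 - R.mass))) at_top"
    using R.deficit_asymptotics[of y "fall_fun l1 0" "fall_fun l1 y" R1 c1] constants
      fall_fun_properties[OF l order_refl] fall_fun_properties[OF l y] y by simp
  also have "(exp (- R1 * y) - R.tail y - (LINT z|lborel. indicator {..<y} z * ladder_kernel c F l1 z * exp (- R1 * (y - z))))
      / (1 - R.mass) = limit_tail y"
  proof -
    have "(LINT z|lborel. indicator {..<y} z * ladder_kernel c F l1 z * exp (- R1 * (y - z))) =
        (LINT z|lborel. l1 / c * (indicator {0..y} z * (exp (- R1 * (y - z)) * (1 - F z))))"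
    proof (rule integral_cong_AE)
      show "AE z in lborel. indicator {..<y} z * ladder_kernel c F l1 z * exp (- R1 * (y - z)) =
          l1 / c * (indicator {0..y} z * (exp (- R1 * (y - z)) * (1 - F z)))"
        using AE_lborel_singleton[of y]
        by eventually_elim (auto simp: ladder_kernel_def indicator_def)
    qed measurable
    also have "\<dots> = l1 / c * (LINT z:{0..y}|lborel. exp (- R1 * (y - z)) * (1 - F z))"
      by (simp add: set_lebesgue_integral_def)
    finally show ?thesis
      using premium l1 y by (simp add: renewal_kernel_claims[OF l] limit_tail_def field_simps)
  qed
  finally show ?thesis
    by (rule Lim_transform_eventually)
      (use eventually_ge_at_top[of 0] in \<open>eventually_elim, simp add: fall_fun_def\<close>)
qed

lemma mixed_fall_eq:
  assumes "0 \<le> y"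
  shows "(\<lambda>l. indicator {0..} l * given_fall l u y) \<in> borel_measurable borel"
    and "mixed_fall u y = (LINT l|G. indicator {0..} l * given_fall l u y)"
  using prob_fall_event_mixture[OF premium assms pure] by (simp_all add: given_fall_def mixed_fall_def)

text \<open>After scaling by \<open>exp (R1 * u)\<close> only the atom contributes in the limit. The
  constant \<open>c1 + 1\<close> dominates: eventually at \<open>l1\<close>, and at smaller rates
  because the scaled probability is at most 1 when the exponent exceeds \<open>R1\<close>.\<close>

lemma mixed_fall_asymptotics:
  assumes y: "0 \<le> y"
  shows "((\<lambda>u. exp (R1 * u) * mixed_fall u y) \<longlongrightarrow> measure G {l1} * c1 * limit_tail y) at_top"
proof -
  note [measurable] = mixed_fall_eq(1)[OF y] sets_G
  have "((\<lambda>u. LINT l|G. exp (R1 * u) * (indicator {0..} l * given_fall l u y)) \<longlongrightarrow>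
      (LINT l|G. indicator {l1} l * (c1 * limit_tail y))) at_top"
  proof (rule integral_dominated_convergence_at_top[where w = "\<lambda>_. c1 + 1"])
    show "AE l in G. ((\<lambda>u. exp (R1 * u) * (indicator {0..} l * given_fall l u y)) \<longlongrightarrow>
        indicator {l1} l * (c1 * limit_tail y)) at_top"
      using support nonneg_G
    proof eventually_elim
      case (elim l)
      then show ?case
        using given_fall_asymptotics[OF y] exp_times_given_fall_tendsto_0[of l y] y by (cases "l = l1") auto
    qed
    have "\<forall>\<^sub>F u in at_top. exp (R1 * u) * given_fall l1 u 0 < c1 + 1"
      using cramer unfolding given_fall_def by (rule order_tendstoD) simp
    then show "\<forall>\<^sub>F u in at_top. AE l in G. norm (exp (R1 * u) * (indicator {0..} l * given_fall l u y)) \<le> c1 + 1"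
      using eventually_ge_at_top[of 0]
    proof eventually_elim
      case (elim u)
      show ?case
        using support nonneg_G
      proof eventually_elim
        fix l assume l: "l \<le> l1" "0 \<le> l"
        have "exp (R1 * u) * given_fall l u 0 \<le> c1 + 1"
        proof (cases "l = l1 \<or> l = 0")
          case True
          then show ?thesis using elim constants by (auto simp: given_fall_0)
        next
          case False
          then obtain R where R: "R > R1" "given_fall l u 0 \<le> exp (- R * u)"
            using lundberg[of l] l elim by (auto simp: given_fall_def)
          have "exp (R1 * u) * given_fall l u 0 \<le> exp (R1 * u) * exp (- R * u)"
            using R by (intro mult_left_mono) auto
          also have "\<dots> = exp (- ((R - R1) * u))" by (simp add: exp_add[symmetric] algebra_simps)
          also have "\<dots> \<le> 1" using R elim by simp
          finally show ?thesis using constants by simp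
        qed
        moreover have "exp (R1 * u) * given_fall l u y \<le> exp (R1 * u) * given_fall l u 0"
          using given_fall_mono[of l 0 y u] l y by (intro mult_left_mono) auto
        ultimately have "exp (R1 * u) * given_fall l u y \<le> c1 + 1" by linarith
        then show "norm (exp (R1 * u) * (indicator {0..} l * given_fall l u y)) \<le> c1 + 1"
          using given_fall_bounds[OF l(2)] l by (simp add: abs_mult)
      qed
    qed
  qed (auto simp: measurable_cong_sets[OF sets_G refl])
  moreover have "(LINT l|G. indicator {l1} l * (c1 * limit_tail y)) = measure G {l1} * c1 * limit_tail y"
    by (simp add: sets_G)
  ultimately show ?thesis by (simp add: mixed_fall_eq(2)[OF y] mult.assoc)
qed

section \<open>The limiting deficit law\<close>

lemma load_pos: "0 < c - l1 * \<mu>" using l1 by simp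

text \<open>Up to the positive factor \<open>c1\<close> the expression is a limit of scaled
  probabilities; its sign is not visible from the formula.\<close>

lemma limit_tail_nonneg:
  assumes "0 \<le> y" shows "0 \<le> limit_tail y"
proof -
  have "0 \<le> c1 * limit_tail y"
  proof (rule tendsto_lowerbound[OF given_fall_asymptotics[OF assms]])
    show "\<forall>\<^sub>F u in at_top. 0 \<le> exp (R1 * u) * given_fall l1 u y"
      using given_fall_bounds[of l1] l1 by (intro always_eventually) simp
  qed simp
  then show ?thesis using constants by (simp add: zero_le_mult_iff)
qed

lemma limit_tail_antimono:
  assumes "0 \<le> y" "y \<le> y'" shows "limit_tail y' \<le> limit_tail y"
proof -
  have "c1 * limit_tail y' \<le> c1 * limit_tail y"
  proof (rule tendsto_le[OF _ given_fall_asymptotics given_fall_asymptotics])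
    show "\<forall>\<^sub>F u in at_top. exp (R1 * u) * given_fall l1 u y' \<le> exp (R1 * u) * given_fall l1 u y"
      using given_fall_mono[of l1 y y'] l1 assms by (intro always_eventually) simp
  qed (use assms in auto)
  then show ?thesis using constants by simp
qed

lemma integrable_claim_tail: "integrable lborel (\<lambda>z. indicator {0..} z * (1 - F z))"
  by (rule integral_tail[OF claim_int])

lemma integrable_claim_tail_on:
  assumes "0 \<le> x" shows "integrable lborel (\<lambda>z. indicator {x..} z * (1 - F z))"
  by (rule Bochner_Integration.integrable_bound[OF integrable_claim_tail])
    (use assms in \<open>auto simp: indicator_def\<close>)

lemma claim_tail_pos:
  assumes "0 \<le> x" "F x < 1" shows "0 < claim_tail x"
proof -
  obtain e where e: "e > 0" "\<And>z. z < x + e \<Longrightarrow> F z < 1" using F_right_cont[OF assms(2)] by blast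
  define b where "b = x + e / 2"
  have "0 < (1 - F b) * (b - x)" using e by (simp add: b_def)
  also have "\<dots> = (LINT z|lborel. indicator {x..b} z * (1 - F b))" using e by (simp add: b_def)
  also have "\<dots> \<le> (LINT z|lborel. indicator {x..} z * (1 - F z))"
  proof (rule integral_mono)
    show "integrable lborel (\<lambda>z. indicator {x..b} z * (1 - F b))"
      by (intro integrable_mult_left integrable_real_indicator) (use e in \<open>auto simp: b_def\<close>)
    show "integrable lborel (\<lambda>z. indicator {x..} z * (1 - F z))"
      by (rule integrable_claim_tail_on[OF assms(1)])
  qed (use F_mono F_bounds in \<open>auto simp: indicator_def\<close>)
  finally show ?thesis by (simp add: claim_tail_def set_lebesgue_integral_def)
qed

text \<open>At 0 the discounted integral vanishes and the tail integral is the mean, so the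
  numerator is exactly the normalising constant \<open>c - l1 * \<mu>\<close>.\<close>

lemma limit_tail_0: "limit_tail 0 = 1"
proof -
  have "claim_tail 0 = \<mu>"
    unfolding claim_tail_def set_lebesgue_integral_def mean
    using integral_tail(2)[OF claim_int] by simp
  moreover have "(LINT z:{0..0}|lborel. exp (- R1 * (0 - z)) * (1 - F z)) = 0"
    unfolding set_lebesgue_integral_def
  proof (rule integral_eq_zero_AE)
    show "AE z in lborel. indicat_real {0..0} z *\<^sub>R (exp (- R1 * (0 - z)) * (1 - F z)) = 0"
      using AE_lborel_singleton[of 0] by eventually_elim (simp add: indicator_def)
  qed
  ultimately show ?thesis using load_pos by (simp add: limit_tail_def)
qed

lemma discounted_le:
  "norm (indicat_real {0..x} z *\<^sub>R (exp (- R1 * (x - z)) * (1 - F z))) \<le> indicator {0..} z * (1 - F z)"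
proof (cases "0 \<le> z \<and> z \<le> x")
  case True
  then have "exp (- R1 * (x - z)) \<le> 1" using constants by simp
  then have "exp (- R1 * (x - z)) * (1 - F z) \<le> 1 * (1 - F z)"
    using F_bounds[of z] by (intro mult_right_mono) auto
  then show ?thesis using True F_bounds[of z] by (simp add: abs_mult)
qed (use F_bounds[of z] in \<open>auto simp: indicator_def\<close>)

text \<open>Dominated convergence with \<open>1 - F\<close> on the positive half-line; the moving
  indicators converge except at the end point \<open>a\<close>, a null set.\<close>

lemma discounted_tail_tendsto:
  assumes x: "\<And>n::nat. 0 \<le> x n" and lim: "x \<longlonglongrightarrow> a"
  shows "(\<lambda>n. LINT z:{0..x n}|lborel. exp (- R1 * (x n - z)) * (1 - F z))
      \<longlonglongrightarrow> (LINT z:{0..a}|lborel. exp (- R1 * (a - z)) * (1 - F z))"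
    and "(\<lambda>n. claim_tail (x n)) \<longlonglongrightarrow> claim_tail a"
proof -
  have ind: "(\<lambda>n. indicator {x n..} z :: real) \<longlonglongrightarrow> indicator {a..} z"
    "(\<lambda>n. indicator {0..x n} z :: real) \<longlonglongrightarrow> indicator {0..a} z" if "z \<noteq> a" for z
  proof -
    have "\<forall>\<^sub>F n in sequentially. (z < x n \<longleftrightarrow> z < a) \<and> (x n < z \<longleftrightarrow> a < z)"
    proof (cases "z < a")
      case True
      with lim have "\<forall>\<^sub>F n in sequentially. z < x n" by (rule order_tendstoD)
      then show ?thesis by eventually_elim (use True in auto)
    next
      case False
      then have "a < z" using that by simp
      with lim have "\<forall>\<^sub>F n in sequentially. x n < z" by (rule order_tendstoD)
      then show ?thesis by eventually_elim (use \<open>a < z\<close> in auto)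
    qed
    then have "\<forall>\<^sub>F n in sequentially. indicator {x n..} z = (indicator {a..} z :: real)"
      "\<forall>\<^sub>F n in sequentially. indicator {0..x n} z = (indicator {0..a} z :: real)"
      by (eventually_elim, use that in \<open>auto simp: indicator_def\<close>)+
    then show "(\<lambda>n. indicator {x n..} z :: real) \<longlonglongrightarrow> indicator {a..} z"
      "(\<lambda>n. indicator {0..x n} z :: real) \<longlonglongrightarrow> indicator {0..a} z"
      by (auto intro: tendsto_eventually)
  qed
  show "(\<lambda>n. LINT z:{0..x n}|lborel. exp (- R1 * (x n - z)) * (1 - F z))
      \<longlonglongrightarrow> (LINT z:{0..a}|lborel. exp (- R1 * (a - z)) * (1 - F z))"
    unfolding set_lebesgue_integral_def
  proof (rule integral_dominated_convergence[OF _ _ integrable_claim_tail])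
    show "AE z in lborel. (\<lambda>n. indicat_real {0..x n} z *\<^sub>R (exp (- R1 * (x n - z)) * (1 - F z)))
        \<longlonglongrightarrow> indicat_real {0..a} z *\<^sub>R (exp (- R1 * (a - z)) * (1 - F z))"
      using AE_lborel_singleton[of a]
      by eventually_elim (intro tendsto_intros ind lim, assumption)
    show "AE z in lborel. norm (indicat_real {0..x n} z *\<^sub>R (exp (- R1 * (x n - z)) * (1 - F z)))
        \<le> indicator {0..} z * (1 - F z)" for n
      by (intro AE_I2 discounted_le)
  qed measurable
  show "(\<lambda>n. claim_tail (x n)) \<longlonglongrightarrow> claim_tail a"
    unfolding claim_tail_def set_lebesgue_integral_def
  proof (rule integral_dominated_convergence[OF _ _ integrable_claim_tail])
    show "AE z in lborel. (\<lambda>n. indicat_real {x n..} z *\<^sub>R (1 - F z)) \<longlonglongrightarrow> indicat_real {a..} z *\<^sub>R (1 - F z)"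
      using AE_lborel_singleton[of a]
      by eventually_elim (intro tendsto_intros ind, assumption)
    show "AE z in lborel. norm (indicat_real {x n..} z *\<^sub>R (1 - F z)) \<le> indicator {0..} z * (1 - F z)" for n
      using x[of n] F_bounds by (intro AE_I2) (auto simp: indicator_def)
  qed measurable
qed

lemma limit_tail_tendsto:
  assumes "\<And>n::nat. 0 \<le> x n" "x \<longlonglongrightarrow> a"
  shows "(\<lambda>n. limit_tail (x n)) \<longlonglongrightarrow> limit_tail a"
  unfolding limit_tail_def using load_pos
  by (intro tendsto_intros discounted_tail_tendsto assms) 

lemma limit_tail_at_top: "(limit_tail \<longlongrightarrow> 0) at_top"
proof (rule Lim_null_comparison)
  show "\<forall>\<^sub>F x in at_top. norm (limit_tail x) \<le> c / (c - l1 * \<mu>) * exp (- (R1 * x))"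
    using eventually_ge_at_top[of 0]
  proof eventually_elim
    case (elim x)
    have "0 \<le> l1 * (LINT z:{0..x}|lborel. exp (- R1 * (x - z)) * (1 - F z))" "0 \<le> l1 * claim_tail x"
      using l1 claim_tail_nonneg unfolding set_lebesgue_integral_def
      by (auto intro!: Bochner_Integration.integral_nonneg simp: F_bounds)
    then have "limit_tail x \<le> 1 / (c - l1 * \<mu>) * (c * exp (- R1 * x))"
      unfolding limit_tail_def using load_pos by (intro mult_left_mono) auto
    then show ?case using limit_tail_nonneg[OF elim] by simp
  qed
  have "((\<lambda>x. c / (c - l1 * \<mu>) * exp (- (R1 * x))) \<longlongrightarrow> c / (c - l1 * \<mu>) * 0) at_top"
    using constants by (intro tendsto_intros exp_neg_tendsto_0)
  then show "((\<lambda>x. c / (c - l1 * \<mu>) * exp (- (R1 * x))) \<longlongrightarrow> 0) at_top" by simp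
qed

text \<open>\<open>limit_tail\<close> is a tail in the size of the deficit while the law lives on
  the negative axis, hence the reflection; from 0 on the value is frozen at 1.\<close>

definition limit_cdf :: "real \<Rightarrow> real" where "limit_cdf a = limit_tail (max 0 (- a))"

lemma limit_cdf_continuous: "isCont limit_cdf a"
  unfolding continuous_at_sequentially comp_def limit_cdf_def
  by (intro allI impI limit_tail_tendsto tendsto_intros) auto

lemma limit_cdf_mono: "a \<le> b \<Longrightarrow> limit_cdf a \<le> limit_cdf b"
  unfolding limit_cdf_def by (intro limit_tail_antimono) auto

lemma limit_cdf_at_bot: "(limit_cdf \<longlongrightarrow> 0) at_bot"
proof -
  have "filterlim (\<lambda>a::real. max 0 (- a)) at_top at_bot"
    by (rule filterlim_at_top_mono[OF filterlim_uminus_at_top_at_bot]) (auto intro: always_eventually)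
  then show ?thesis unfolding limit_cdf_def[abs_def] by (rule filterlim_compose[OF limit_tail_at_top])
qed

lemma limit_cdf_nonneg_arg: "0 \<le> a \<Longrightarrow> limit_cdf a = 1"
  by (simp add: limit_cdf_def max_def limit_tail_0)

lemma limit_cdf_at_top: "(limit_cdf \<longlongrightarrow> 1) at_top"
  by (rule tendsto_eventually) (use eventually_ge_at_top[of 0] in \<open>eventually_elim, simp add: limit_cdf_nonneg_arg\<close>)

definition limit_law :: "real measure" where "limit_law = interval_measure limit_cdf"

sublocale limit: real_distribution limit_law
  unfolding limit_law_def
  by (rule real_distribution_interval_measure[OF limit_cdf_mono
      continuous_at_imp_continuous_at_within[OF limit_cdf_continuous] limit_cdf_at_bot limit_cdf_at_top])

lemma cdf_limit_law: "cdf limit_law = limit_cdf"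
  unfolding limit_law_def
  by (rule cdf_interval_measure[OF limit_cdf_mono
      continuous_at_imp_continuous_at_within[OF limit_cdf_continuous] limit_cdf_at_bot])

lemma limit_law_singleton: "measure limit_law {a} = 0"
  using limit.isCont_cdf[of a] limit_cdf_continuous by (simp add: cdf_limit_law)

lemma limit_law_atMost: "measure limit_law {..a} = limit_cdf a"
  using fun_cong[OF cdf_limit_law, of a] by (simp add: cdf_def)

lemma limit_law_negative: "measure limit_law {..<0} = 1"
proof -
  have "measure limit_law ({..0} - {0}) = measure limit_law {..0} - measure limit_law {0}"
    by (rule limit.finite_measure_Diff) auto
  moreover have "{..0} - {0} = {..<0::real}" by auto
  ultimately show ?thesis by (simp add: limit_law_atMost limit_law_singleton limit_cdf_nonneg_arg)
qed

lemma limit_deficit_measure_iff: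
  "limit_deficit_measure c \<mu> F l1 R1 \<nu> \<longleftrightarrow>
    prob_space \<nu> \<and> sets \<nu> = sets (restrict_space borel {..<0}) \<and>
    (\<forall>x\<ge>0. measure \<nu> ({..- x} \<inter> {..<0}) = limit_tail x)"
  by (simp add: limit_deficit_measure_def limit_tail_def claim_tail_def)

text \<open>Pushing a measure from the half-line to the real line makes it comparable with
  \<open>limit_law\<close> through distribution functions; uniqueness of the limiting measure rests
  on this.\<close>

lemma limit_deficit_measure_distr:
  assumes "limit_deficit_measure c \<mu> F l1 R1 \<nu>"
  shows "(\<lambda>x. x) \<in> borel_measurable \<nu>" "distr \<nu> borel (\<lambda>x. x) = limit_law"
proof -
  have \<nu>: "prob_space \<nu>" "sets \<nu> = sets (restrict_space borel {..<0})"
    "\<And>x. x \<ge> 0 \<Longrightarrow> measure \<nu> ({..- x} \<inter> {..<0}) = limit_tail x"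
    using assms by (auto simp: limit_deficit_measure_iff)
  interpret \<nu>: prob_space \<nu> by fact
  have sp: "space \<nu> = {..<0}" using sets_eq_imp_space_eq[OF \<nu>(2)] by (simp add: space_restrict_space)
  show m[measurable]: "(\<lambda>x. x) \<in> borel_measurable \<nu>"
    unfolding measurable_cong_sets[OF \<nu>(2) refl] by (rule measurable_restrict_space1) simp
  interpret D: real_distribution "distr \<nu> borel (\<lambda>x. x)" by (rule \<nu>.real_distribution_distr) simp
  show "distr \<nu> borel (\<lambda>x. x) = limit_law"
  proof (rule cdf_unique[OF D.real_distribution_axioms limit.real_distribution_axioms], rule ext)
    fix a
    have "cdf (distr \<nu> borel (\<lambda>x. x)) a = measure \<nu> ({..a} \<inter> {..<0})"
      unfolding cdf_def by (subst measure_distr) (auto simp: sp)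
    also have "\<dots> = limit_cdf a"
    proof (cases "a \<le> 0")
      case True
      then show ?thesis using \<nu>(3)[of "- a"] by (simp add: limit_cdf_def max_def)
    next
      case False
      then have "{..a} \<inter> {..<0} = space \<nu>" by (auto simp: sp)
      then show ?thesis using False \<nu>.prob_space by (simp add: limit_cdf_nonneg_arg)
    qed
    finally show "cdf (distr \<nu> borel (\<lambda>x. x)) a = cdf limit_law a" by (simp add: cdf_limit_law)
  qed
qed

lemma ex1_limit_deficit_measure: "\<exists>!\<nu>. limit_deficit_measure c \<mu> F l1 R1 \<nu>"
proof (rule ex1I)
  define \<nu> where "\<nu> = restrict_space limit_law {..<0}"
  have "prob_space \<nu>"
    unfolding \<nu>_def by (rule prob_space_restrict_space)
      (auto simp: limit_law_negative limit.emeasure_eq_measure)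
  moreover have "measure \<nu> ({..- x} \<inter> {..<0}) = limit_tail x" if "x \<ge> 0" for x
  proof -
    have "measure \<nu> ({..- x} \<inter> {..<0}) = measure limit_law ({..- x} \<inter> {..<0})"
      unfolding \<nu>_def by (rule measure_restrict_space) auto
    also have "\<dots> = measure limit_law {..- x}"
    proof (cases "x = 0")
      case True
      then have "{..- x} \<inter> {..<0} = {..<0::real}" by auto
      then show ?thesis using True
        by (simp add: limit_law_negative limit_law_atMost limit_cdf_nonneg_arg)
    next
      case False
      then have "{..- x} \<inter> {..<0} = {..- x}" using that by auto
      then show ?thesis by simp
    qed
    finally show ?thesis using that by (simp add: limit_law_atMost limit_cdf_def max_def)
  qed
  moreover have "sets \<nu> = sets (restrict_space borel {..<0})"
    unfolding \<nu>_def by (rule sets_restrict_space_cong) simp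
  ultimately show "limit_deficit_measure c \<mu> F l1 R1 \<nu>" by (simp add: limit_deficit_measure_iff)
  fix \<nu>' assume \<nu>': "limit_deficit_measure c \<mu> F l1 R1 \<nu>'"
  have sets: "sets \<nu>' = sets (restrict_space borel {..<0})" using \<nu>' by (simp add: limit_deficit_measure_iff)
  have sp: "space \<nu>' = {..<0}" using sets_eq_imp_space_eq[OF sets] by (simp add: space_restrict_space)
  show "\<nu>' = \<nu>"
  proof (rule measure_eqI)
    show "sets \<nu>' = sets \<nu>" by (simp add: sets \<open>sets \<nu> = _\<close>)
    fix A assume "A \<in> sets \<nu>'"
    then have A: "A \<in> sets borel" "A \<subseteq> {..<0}" by (auto simp: sets sets_restrict_space)
    have "emeasure \<nu>' A = emeasure (distr \<nu>' borel (\<lambda>x. x)) A"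
      using limit_deficit_measure_distr(1)[OF \<nu>'] A
      by (subst emeasure_distr) (auto simp: sp Int_absorb2)
    also have "\<dots> = emeasure limit_law A" by (simp add: limit_deficit_measure_distr(2)[OF \<nu>'])
    also have "\<dots> = emeasure \<nu> A" unfolding \<nu>_def using A by (simp add: emeasure_restrict_space)
    finally show "emeasure \<nu>' A = emeasure \<nu> A" .
  qed
qed

text \<open>Formally, \<open>exp (- R1 * t) * (c - l1 * I t) - l1 * claim_tail t\<close> has
  derivative \<open>- R1 * exp (- R1 * t) * (c - l1 * I t)\<close>, since the two terms in
  \<open>1 - F\<close> cancel. As \<open>F\<close> may jump, the argument is carried out with
  increments from \<open>x\<close> to \<open>x'\<close>. It shows that the limiting law charges
  every interval of deficits on which \<open>F\<close> is below 1.\<close>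

lemma limit_tail_strict_antimono:
  assumes x: "0 \<le> x" "x < x'" and F: "F x' < 1"
  shows "limit_tail x' < limit_tail x"
proof -
  define I where "I t = (LINT z:{0..t}|lborel. exp (R1 * z) * (1 - F z))" for t
  have cont: "set_integrable lborel {a..b} (\<lambda>z. exp (R1 * z) * (1 - F z))" for a b
  proof -
    have "set_integrable lborel {a..b} (\<lambda>z. exp (R1 * b))"
      by (rule borel_integrable_atLeastAtMost') (rule continuous_on_const)
    then show ?thesis
      unfolding set_integrable_def
    proof (rule Bochner_Integration.integrable_bound)
      show "AE z in lborel. norm (indicat_real {a..b} z *\<^sub>R (exp (R1 * z) * (1 - F z)))
          \<le> norm (indicat_real {a..b} z *\<^sub>R exp (R1 * b))"
      proof (rule AE_I2)
        fix z
        have "exp (R1 * z) * (1 - F z) \<le> exp (R1 * b) * 1" if "z \<le> b"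
          using that constants F_bounds[of z] by (intro mult_mono) auto
        then show "norm (indicat_real {a..b} z *\<^sub>R (exp (R1 * z) * (1 - F z)))
          \<le> norm (indicat_real {a..b} z *\<^sub>R exp (R1 * b))"
          using F_bounds[of z] by (auto simp: indicator_def abs_mult)
      qed
    qed measurable
  qed
  have disc: "(LINT z:{0..t}|lborel. exp (- R1 * (t - z)) * (1 - F z)) = exp (- R1 * t) * I t" for t
  proof -
    have "(LINT z:{0..t}|lborel. exp (- R1 * (t - z)) * (1 - F z)) =
      (LINT z:{0..t}|lborel. exp (- R1 * t) * (exp (R1 * z) * (1 - F z)))"
      by (intro arg_cong[where f="set_lebesgue_integral lborel {0..t}"])
        (auto simp: fun_eq_iff exp_diff exp_minus right_diff_distrib divide_inverse mult_ac)
    then show ?thesis by (simp add: I_def)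
  qed
  have tail: "limit_tail t = (exp (- R1 * t) * (c - l1 * I t) - l1 * claim_tail t) / (c - l1 * \<mu>)" for t
  proof -
    have "c * exp (- R1 * t) - l1 * (exp (- R1 * t) * I t) = exp (- R1 * t) * (c - l1 * I t)"
      by (simp add: algebra_simps)
    then show ?thesis unfolding limit_tail_def disc by simp
  qed
  \<comment> \<open>Positivity is extracted from \<open>limit_tail x' \<ge> 0\<close>: the term
    \<open>l1 * claim_tail x'\<close> subtracted there is strictly positive when
    \<open>F x' < 1\<close>.\<close>
  have q: "0 < c - l1 * I x'"
  proof -
    have "0 \<le> exp (- R1 * x') * (c - l1 * I x') - l1 * claim_tail x'"
      using limit_tail_nonneg[of x'] x load_pos unfolding tail by (simp add: zero_le_divide_iff)
    moreover have "0 < l1 * claim_tail x'" using claim_tail_pos[OF _ F] x l1 by simp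
    ultimately have "0 < exp (- R1 * x') * (c - l1 * I x')" by linarith
    then show ?thesis by (simp add: zero_less_mult_iff)
  qed
  define J where "J = (LINT z:{x..x'}|lborel. exp (R1 * z) * (1 - F z))"
  define T where "T = (LINT z:{x..x'}|lborel. 1 - F z)"
  have I_split: "I x' = I x + J"
  proof -
    have "I x' = (LINT z:{0..x} \<union> {x<..x'}|lborel. exp (R1 * z) * (1 - F z))"
      unfolding I_def using x by (simp add: ivl_disj_un)
    also have "\<dots> = I x + (LINT z:{x<..x'}|lborel. exp (R1 * z) * (1 - F z))"
      unfolding I_def
      by (rule set_integral_Un) (use x in \<open>auto intro!: cont set_integrable_subset[OF cont[of 0 x']]\<close>)
    also have "(LINT z:{x<..x'}|lborel. exp (R1 * z) * (1 - F z)) = J"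
      unfolding J_def set_lebesgue_integral_def
    proof (rule integral_cong_AE)
      show "AE z in lborel. indicat_real {x<..x'} z *\<^sub>R (exp (R1 * z) * (1 - F z)) =
          indicat_real {x..x'} z *\<^sub>R (exp (R1 * z) * (1 - F z))"
        using AE_lborel_singleton[of x] by eventually_elim (auto simp: indicator_def)
    qed measurable
    finally show ?thesis .
  qed
  have T_eq: "claim_tail x = T + claim_tail x'"
  proof -
    have "claim_tail x - claim_tail x' = (LINT z|lborel. indicator {x..} z * (1 - F z) - indicator {x'..} z * (1 - F z))"
      unfolding claim_tail_def set_lebesgue_integral_def
      using integrable_claim_tail_on[of x] integrable_claim_tail_on[of x'] x by simp
    also have "\<dots> = T"
      unfolding T_def set_lebesgue_integral_def
    proof (rule integral_cong_AE)
      show "AE z in lborel. indicator {x..} z * (1 - F z) - indicator {x'..} z * (1 - F z) =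
          indicat_real {x..x'} z *\<^sub>R (1 - F z)"
        using AE_lborel_singleton[of x'] by eventually_elim (use x in \<open>auto simp: indicator_def\<close>)
    qed measurable
    finally show ?thesis by simp
  qed
  have T_int: "set_integrable lborel {x..x'} (\<lambda>z. 1 - F z)"
    unfolding set_integrable_def
    by (rule Bochner_Integration.integrable_bound[OF integrable_claim_tail]) (use x in \<open>auto simp: indicator_def\<close>)
  have "exp (R1 * x) * T = (LINT z:{x..x'}|lborel. exp (R1 * x) * (1 - F z))"
    unfolding T_def by simp
  also have "\<dots> \<le> J"
    unfolding J_def using constants F_bounds
    by (intro set_integral_mono cont set_integrable_mult_right T_int) (auto intro!: mult_right_mono)
  finally have "exp (- R1 * x) * (exp (R1 * x) * T) \<le> exp (- R1 * x) * J"
    by (intro mult_left_mono) auto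
  then have J: "T \<le> exp (- R1 * x) * J"
    by (simp add: mult.assoc[symmetric] exp_add[symmetric])
  have e: "exp (- R1 * x') < exp (- R1 * x)" using x constants by simp
  have "exp (- R1 * x') * (c - l1 * I x') - l1 * claim_tail x' < exp (- R1 * x) * (c - l1 * I x') - l1 * claim_tail x'"
    using mult_strict_right_mono[OF e q] by simp
  also have "\<dots> = exp (- R1 * x) * (c - l1 * I x) - l1 * (exp (- R1 * x) * J) - l1 * claim_tail x'"
    by (simp add: I_split algebra_simps)
  also have "\<dots> \<le> exp (- R1 * x) * (c - l1 * I x) - l1 * T - l1 * claim_tail x'"
    using J l1 by simp
  also have "\<dots> = exp (- R1 * x) * (c - l1 * I x) - l1 * claim_tail x"
    by (simp add: T_eq algebra_simps)
  finally show ?thesis unfolding tail using load_pos by (simp add: divide_strict_right_mono)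
qed

section \<open>Weak convergence of the deficit\<close>

lemma mixed_fall_bounds: "0 \<le> mixed_fall u y" "mixed_fall u y \<le> 1"
  by (auto simp: mixed_fall_def)

lemma mixed_fall_pos: "\<forall>\<^sub>F u in at_top. 0 < mixed_fall u 0"
proof -
  have "0 < measure G {l1} * c1 * limit_tail 0"
    using atom constants by (simp add: limit_tail_0)
  from order_tendstoD(1)[OF mixed_fall_asymptotics[OF order_refl] this]
  show ?thesis by eventually_elim (simp add: zero_less_mult_iff)
qed

lemma mixed_fall_ratio:
  assumes "0 \<le> y"
  shows "((\<lambda>u. mixed_fall u y / mixed_fall u 0) \<longlongrightarrow> limit_tail y) at_top"
proof -
  have "((\<lambda>u. (exp (R1 * u) * mixed_fall u y) / (exp (R1 * u) * mixed_fall u 0)) \<longlongrightarrow>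
      (measure G {l1} * c1 * limit_tail y) / (measure G {l1} * c1 * limit_tail 0)) at_top"
    using atom constants by (intro tendsto_divide mixed_fall_asymptotics assms) (auto simp: limit_tail_0)
  then show ?thesis using atom constants by (simp add: limit_tail_0)
qed

text \<open>The law of the surplus at ruin given ruin. The fallback \<open>limit_law\<close> makes
  it a distribution for every \<open>u\<close>, as the convergence theorem for sequences of
  distributions demands; for large \<open>u\<close> it does not occur.\<close>

definition cond_deficit_law :: "real \<Rightarrow> real measure" where
  "cond_deficit_law u = (if 0 \<le> u \<and> 0 < mixed_fall u 0
     then density (deficit_law M c N X u) (\<lambda>_. ennreal (1 / mixed_fall u 0)) else limit_law)"

lemma cond_deficit_law_emeasure:
  assumes "0 \<le> u" "0 < mixed_fall u 0" "A \<in> sets borel"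
  shows "emeasure (cond_deficit_law u) A = ennreal (1 / mixed_fall u 0) * emeasure (deficit_law M c N X u) A"
  using assms sets_deficit_law[OF premium, of u] by (simp add: cond_deficit_law_def emeasure_density_const)

lemma real_distribution_cond_deficit_law: "real_distribution (cond_deficit_law u)"
proof (cases "0 \<le> u \<and> 0 < mixed_fall u 0")
  case True
  have sets: "sets (cond_deficit_law u) = sets borel"
    using True sets_deficit_law[OF premium, of u] by (simp add: cond_deficit_law_def)
  have "emeasure (cond_deficit_law u) UNIV = ennreal (1 / mixed_fall u 0) * ennreal (mixed_fall u 0)"
    using True emeasure_deficit_law_UNIV[OF premium, of u]
    by (simp add: cond_deficit_law_emeasure mixed_fall_def)
  also have "\<dots> = ennreal (1 / mixed_fall u 0 * mixed_fall u 0)"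
    using True by (intro ennreal_mult[symmetric]) auto
  also have "\<dots> = 1" using True by simp
  finally have "prob_space (cond_deficit_law u)"
    using sets_eq_imp_space_eq[OF sets] by (intro prob_spaceI) simp
  with sets show ?thesis
    by (intro real_distribution.intro real_distribution_axioms.intro)
next
  case False
  then have "cond_deficit_law u = limit_law" by (auto simp: cond_deficit_law_def)
  then show ?thesis by (simp add: limit.real_distribution_axioms)
qed

lemma cond_deficit_law_lessThan:
  assumes "0 \<le> u" "0 < mixed_fall u 0" "0 \<le> y"
  shows "measure (cond_deficit_law u) {..<- y} = mixed_fall u y / mixed_fall u 0"
proof -
  have "emeasure (cond_deficit_law u) {..<- y} = ennreal (1 / mixed_fall u 0) * ennreal (mixed_fall u y)"
    using emeasure_deficit_law_lessThan[OF premium assms(1,3)] assms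
    by (simp add: cond_deficit_law_emeasure mixed_fall_def)
  also have "\<dots> = ennreal (mixed_fall u y / mixed_fall u 0)"
    using assms mixed_fall_bounds[of u y] by (simp add: ennreal_mult[symmetric])
  finally show ?thesis using assms mixed_fall_bounds by (simp add: measure_def)
qed

text \<open>Fall events give the mass of open half-lines, a distribution function that of closed
  ones. For negative \<open>a\<close> the open half-line bounds from below; from above a slightly
  larger one is used, and continuity of the limit closes the gap.\<close>

lemma cdf_cond_deficit_law_tendsto:
  "((\<lambda>u. cdf (cond_deficit_law u) a) \<longlongrightarrow> cdf limit_law a) at_top"
proof (cases "a < 0")
  case False
  have "\<forall>\<^sub>F u in at_top. cdf (cond_deficit_law u) a = 1"
    using mixed_fall_pos eventually_ge_at_top[of 0]
  proof eventually_elim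
    case (elim u)
    interpret C: real_distribution "cond_deficit_law u" by (rule real_distribution_cond_deficit_law)
    have "emeasure (cond_deficit_law u) {0..} = 0"
      using emeasure_deficit_law_nonneg[OF premium elim(2)] elim by (simp add: cond_deficit_law_emeasure)
    then have "AE x in cond_deficit_law u. x < 0"
      by (intro AE_I[where N = "{0..}"]) (auto simp: not_less)
    then have "AE x in cond_deficit_law u. x \<in> {..a}" by eventually_elim (use False in auto)
    then show ?case unfolding cdf_def by (subst C.prob_eq_1) auto
  qed
  then show ?thesis
    using False by (intro tendsto_eventually) (simp add: cdf_limit_law limit_cdf_nonneg_arg)
next
  case True
  define y where "y = - a"
  have y: "y > 0" "a = - y" using True by (auto simp: y_def)
  have lim: "cdf limit_law a = limit_tail y" using y by (simp add: cdf_limit_law limit_cdf_def max_def)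
  have good: "\<forall>\<^sub>F u in at_top. 0 \<le> u \<and> 0 < mixed_fall u 0"
    using mixed_fall_pos eventually_ge_at_top[of 0] by eventually_elim simp
  show ?thesis
    unfolding lim
  proof (rule order_tendstoI)
    fix b assume "b < limit_tail y"
    with mixed_fall_ratio[of y] y have "\<forall>\<^sub>F u in at_top. b < mixed_fall u y / mixed_fall u 0"
      by (auto dest: order_tendstoD)
    with good show "\<forall>\<^sub>F u in at_top. b < cdf (cond_deficit_law u) a"
    proof eventually_elim
      case (elim u)
      interpret C: real_distribution "cond_deficit_law u" by (rule real_distribution_cond_deficit_law)
      have "b < measure (cond_deficit_law u) {..<- y}"
        using elim y by (simp add: cond_deficit_law_lessThan)
      also have "\<dots> \<le> cdf (cond_deficit_law u) a"
        unfolding cdf_def y(2) by (intro C.finite_measure_mono) auto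
      finally show ?case .
    qed
  next
    fix b assume b: "limit_tail y < b"
    have "(\<lambda>n. limit_cdf (a + 1 / real (Suc n))) \<longlonglongrightarrow> limit_cdf a"
    proof (rule isCont_tendsto_compose[OF limit_cdf_continuous])
      have "(\<lambda>n. a + 1 / real (Suc n)) \<longlonglongrightarrow> a + 0"
        using LIMSEQ_inverse_real_of_nat by (intro tendsto_intros) (simp add: inverse_eq_divide)
      then show "(\<lambda>n. a + 1 / real (Suc n)) \<longlonglongrightarrow> a" by simp
    qed
    moreover have "limit_cdf a < b" using b lim by (simp add: cdf_limit_law)
    ultimately have "\<forall>\<^sub>F n in sequentially. limit_cdf (a + 1 / real (Suc n)) < b" by (rule order_tendstoD)
    then obtain n where n: "limit_cdf (a + 1 / real (Suc n)) < b" by (auto simp: eventually_sequentially)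
    \<comment> \<open>The maximum with 0 keeps \<open>z\<close> in the range where fall events
      describe the law, and \<open>z < y\<close> makes \<open>{..<- z}\<close> contain
      \<open>{..a}\<close>.\<close>
    define z where "z = max 0 (- (a + 1 / real (Suc n)))"
    have z: "0 \<le> z" "limit_tail z < b" "z < y"
      using n y by (auto simp: z_def limit_cdf_def)
    from order_tendstoD(2)[OF mixed_fall_ratio[OF z(1)] z(2)] good
    show "\<forall>\<^sub>F u in at_top. cdf (cond_deficit_law u) a < b"
    proof eventually_elim
      case (elim u)
      interpret C: real_distribution "cond_deficit_law u" by (rule real_distribution_cond_deficit_law)
      have "cdf (cond_deficit_law u) a \<le> measure (cond_deficit_law u) {..<- z}"
        unfolding cdf_def y(2) using z by (intro C.finite_measure_mono) auto
      also have "\<dots> < b" using elim z by (simp add: cond_deficit_law_lessThan)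
      finally show ?case .
    qed
  qed
qed

lemma integral_cond_deficit_law_tendsto:
  fixes f :: "real \<Rightarrow> real"
  assumes "f \<in> borel_measurable borel" "\<And>x. norm (f x) \<le> B"
    and "emeasure limit_law {x. \<not> isCont f x} = 0"
  shows "((\<lambda>u. integral\<^sup>L (cond_deficit_law u) f) \<longlongrightarrow> integral\<^sup>L limit_law f) at_top"
proof (rule tendsto_at_topI_sequentially)
  fix U :: "nat \<Rightarrow> real" assume U: "filterlim U at_top sequentially"
  have "weak_conv_m (\<lambda>n. cond_deficit_law (U n)) limit_law"
    unfolding weak_conv_m_def weak_conv_def
    using filterlim_compose[OF cdf_cond_deficit_law_tendsto U] by blast
  from weak_conv_imp_bdd_ae_continuous_conv[OF real_distribution_cond_deficit_law limit.real_distribution_axioms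
      this assms(3) assms(2) assms(1)]
  show "(\<lambda>n. integral\<^sup>L (cond_deficit_law (U n)) f) \<longlonglongrightarrow> integral\<^sup>L limit_law f" .
qed

lemma mixed_fall_le_tail:
  assumes "0 \<le> u" "0 \<le> y"
  shows "mixed_fall u y \<le> l1 / c * claim_tail y / (1 - l1 * \<mu> / c)"
proof -
  define B where "B = l1 / c * claim_tail y / (1 - l1 * \<mu> / c)"
  have pos: "0 < 1 - l1 * \<mu> / c" using l1 premium by simp
  have le: "given_fall l u y \<le> B" if "0 \<le> l" "l \<le> l1" for l
    using given_fall_le[OF that assms(2,1)]
    by (simp only: B_def pos_le_divide_eq[OF pos] mult.commute[of "given_fall l u y"])
  have "mixed_fall u y = (LINT l|G. indicator {0..} l * given_fall l u y)" by (rule mixed_fall_eq[OF assms(2)])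
  also have "\<dots> \<le> (LINT l|G. B)"
  proof (rule integral_mono_AE)
    show "integrable G (\<lambda>l. indicator {0..} l * given_fall l u y)"
      using mixed_fall_eq(1)[OF assms(2), of u] given_fall_bounds
      by (intro mix.integrable_const_bound[where B = 1])
        (auto simp: indicator_def measurable_cong_sets[OF sets_G refl])
    show "AE l in G. indicator {0..} l * given_fall l u y \<le> B"
      using nonneg_G support by eventually_elim (use le in auto)
  qed simp
  also have "\<dots> = B" using mix.prob_space by simp
  finally show ?thesis by (simp add: B_def)
qed

text \<open>
  Obtained from the uniform bound above and not pathwise, since several claims may occur
  simultaneously on a null set.
\<close>

lemma deficit_law_null:
  assumes u: "0 \<le> u"
  shows "emeasure (deficit_law M c N X u) {a. F (- a) = 1} = 0"
proof (cases "\<exists>y. F y = 1")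
  case False
  then have "{a. F (- a) = 1} = {}" by auto
  then show ?thesis by (simp only: emeasure_empty)
next
  case True
  \<comment> \<open>The right end point of the claim sizes. By right continuity \<open>F\<close> has
    the value 1 there, so the set in question is a closed half-line.\<close>
  define x where "x = Inf {y. F y = 1}"
  have bdd: "bdd_below {y. F y = 1}"
  proof (rule bdd_belowI)
    fix y assume "y \<in> {y. F y = 1}"
    then show "0 \<le> y" using F_0[of y] by (cases "y \<le> 0") auto
  qed
  have Fx: "F x = 1"
  proof (rule ccontr)
    assume "F x \<noteq> 1"
    then have "F x < 1" using F_bounds[of x] by simp
    then obtain e where e: "e > 0" "\<And>z. z < x + e \<Longrightarrow> F z < 1" using F_right_cont by blast
    have "x + e \<le> x"
      unfolding x_def
    proof (rule cInf_greatest)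
      show "{y. F y = 1} \<noteq> {}" using True by auto
      fix z assume "z \<in> {y. F y = 1}"
      then show "Inf {y. F y = 1} + e \<le> z" using e(2)[of z] by (force simp: x_def[symmetric])
    qed
    then show False using e(1) by simp
  qed
  have x0: "0 < x" using Fx F_0[of x] by (cases "x \<le> 0") auto
  have F_iff: "F z = 1 \<longleftrightarrow> x \<le> z" for z
  proof
    assume "F z = 1" then show "x \<le> z" unfolding x_def using bdd by (intro cInf_lower) auto
  next
    assume "x \<le> z" then show "F z = 1" using F_mono[of x z] Fx F_bounds[of z] by simp
  qed
  have eq: "{a. F (- a) = 1} = {..- x}" by (simp only: F_iff) auto
  define B where "B = l1 / c / (1 - l1 * \<mu> / c)"
  have B: "0 \<le> B" using l1 premium by (simp add: B_def)
  \<comment> \<open>A deficit of at least \<open>x\<close> exceeds every \<open>y < x\<close>, and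
    the integrated claim tail beyond \<open>y\<close> is at most \<open>x - y\<close>, which can be
    made small.\<close>
  have bound: "emeasure (deficit_law M c N X u) {..- x} \<le> ennreal (B * (x - y))" if y: "0 \<le> y" "y < x" for y
  proof -
    have "claim_tail y \<le> (LINT z:{y..x}|lborel. 1)"
      unfolding claim_tail_def set_lebesgue_integral_def
    proof (rule integral_mono)
      show "integrable lborel (\<lambda>z. indicat_real {y..} z *\<^sub>R (1 - F z))"
        using integrable_claim_tail_on[OF y(1)] by simp
      show "integrable lborel (\<lambda>z. indicat_real {y..x} z *\<^sub>R (1::real))"
        using y by (simp add: integrable_real_indicator)
      fix z
      show "indicat_real {y..} z *\<^sub>R (1 - F z) \<le> indicat_real {y..x} z *\<^sub>R 1"
        using F_iff[of z] F_bounds[of z] by (auto simp: indicator_def)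
    qed
    also have "\<dots> = x - y" using y by (simp add: set_lebesgue_integral_def)
    finally have ct: "claim_tail y \<le> x - y" .
    have "emeasure (deficit_law M c N X u) {..- x} \<le> emeasure (deficit_law M c N X u) {..<- y}"
      using y sets_deficit_law[OF premium u] by (intro emeasure_mono) auto
    also have "\<dots> = ennreal (mixed_fall u y)"
      unfolding mixed_fall_def by (rule emeasure_deficit_law_lessThan[OF premium u y(1)])
    also have "\<dots> \<le> ennreal (B * (x - y))"
    proof (rule ennreal_leI)
      have "mixed_fall u y \<le> B * claim_tail y"
        using mixed_fall_le_tail[OF u y(1)] by (simp add: B_def)
      also have "\<dots> \<le> B * (x - y)" using ct B by (rule mult_left_mono)
      finally show "mixed_fall u y \<le> B * (x - y)" .
    qed
    finally show ?thesis .
  qed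
  have "emeasure (deficit_law M c N X u) {..- x} \<le> 0"
  proof (rule ennreal_le_epsilon)
    fix e :: real assume e: "0 < e"
    \<comment> \<open>Chosen to give \<open>B * d \<le> e\<close>; the summand 1 avoids division by
      zero and the minimum keeps \<open>x - d\<close> nonnegative.\<close>
    define d where "d = min x (e / (B + 1))"
    have d: "0 < d" "d \<le> x" using x0 e B by (auto simp: d_def)
    have "B * d \<le> B * (e / (B + 1))" using B by (intro mult_left_mono) (auto simp: d_def)
    also have "\<dots> \<le> e" using B e by (simp add: field_simps)
    finally have "ennreal (B * (x - (x - d))) \<le> ennreal e" by (intro ennreal_leI) simp
    then show "emeasure (deficit_law M c N X u) {..- x} \<le> 0 + ennreal e"
      using bound[of "x - d"] d by (auto intro: order_trans)
  qed
  then show ?thesis by (simp add: eq)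
qed

section \<open>Convergence of the modified ruin probability\<close>

context
  fixes \<psi> :: "real \<Rightarrow> real"
  assumes modified: "modified_ruin_probability M c N X \<psi>"
    and regular: "continuous_on {..<0} \<psi> \<or> mono_on {..<0} \<psi> \<or> antimono_on {..<0} \<psi>"
begin

text \<open>A function on the whole line with the integral of the defining equation. The cut may
  create a jump at 0, which the atomless limiting law does not see.\<close>

definition penalty :: "real \<Rightarrow> real" where "penalty x = indicator {..<0} x * \<psi> x"

lemma psi_measurable[measurable]: "\<psi> \<in> borel_measurable borel"
  and psi_bounds: "0 \<le> \<psi> u" "\<psi> u \<le> 1"
  and psi_eq: "0 \<le> u \<Longrightarrow> \<psi> u = (LINT y|deficit_law M c N X u. penalty y)"
  using modified by (auto simp: modified_ruin_probability_def penalty_def set_lebesgue_integral_def)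

lemma penalty_bounds: "0 \<le> penalty x" "penalty x \<le> 1"
  using psi_bounds[of x] by (auto simp: penalty_def indicator_def)

lemma penalty_measurable[measurable]: "penalty \<in> borel_measurable borel"
  unfolding penalty_def by measurable

lemma countable_discontinuities: "countable {x. \<not> isCont penalty x}"
proof -
  have "countable {x \<in> {..<0}. \<not> isCont \<psi> x}"
    using regular
  proof (elim disjE)
    assume "continuous_on {..<0} \<psi>"
    then have "{x \<in> {..<0}. \<not> isCont \<psi> x} = {}"
      by (auto simp: continuous_on_eq_continuous_at)
    then show ?thesis by (simp only: countable_empty)
  next
    assume "mono_on {..<0} \<psi>"
    then show ?thesis by (intro mono_on_ctble_discont_open) auto
  next
    assume "antimono_on {..<0} \<psi>"
    then have "mono_on {..<0} (\<lambda>x. - \<psi> x)" by (auto simp: monotone_on_def)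
    then have "countable {x \<in> {..<0}. \<not> isCont (\<lambda>x. - \<psi> x) x}" by (intro mono_on_ctble_discont_open) auto
    moreover have "isCont (\<lambda>x. - \<psi> x) x = isCont \<psi> x" for x
      using continuous_minus[of "at x" "\<lambda>x. - \<psi> x"] continuous_minus[of "at x" \<psi>] by auto
    ultimately show ?thesis by simp
  qed
  moreover have "{x. \<not> isCont penalty x} \<subseteq> insert 0 {x \<in> {..<0}. \<not> isCont \<psi> x}"
  proof
    fix x assume x: "x \<in> {x. \<not> isCont penalty x}"
    consider "x < 0" | "x = 0" | "0 < x" by linarith
    then show "x \<in> insert 0 {x \<in> {..<0}. \<not> isCont \<psi> x}"
    proof cases
      case 1
      then have "\<forall>\<^sub>F z in nhds x. penalty z = \<psi> z"
        by (intro eventually_mono[OF eventually_nhds_in_open[of "{..<0}" x]]) (auto simp: penalty_def)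
      then have "isCont penalty x = isCont \<psi> x" by (rule isCont_cong)
      then show ?thesis using x 1 by auto
    next
      case 3
      then have "\<forall>\<^sub>F z in nhds x. penalty z = 0"
        by (intro eventually_mono[OF eventually_nhds_in_open[of "{0<..}" x]]) (auto simp: penalty_def)
      then have "isCont penalty x = isCont (\<lambda>_. 0::real) x" by (rule isCont_cong)
      then show ?thesis using x by simp
    qed simp
  qed
  ultimately show ?thesis by (meson countable_insert countable_subset)
qed

text \<open>By the defining equation the ratio is eventually the integral of \<open>penalty\<close>
  against the deficit law given ruin. That law converges weakly, and countably many discontinuities
  are null for an atomless limit.\<close>

lemma ratio_tendsto: "((\<lambda>u. \<psi> u / mixed_fall u 0) \<longlongrightarrow> (LINT y|limit_law. penalty y)) at_top"
proof -
  have "emeasure limit_law {x. \<not> isCont penalty x} = 0"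
  proof -
    have "AE x in limit_law. \<forall>z\<in>{x. \<not> isCont penalty x}. x \<noteq> z"
    proof (subst AE_ball_countable[OF countable_discontinuities], rule ballI)
      fix z
      have "measure limit_law {z} = 0" by (rule limit_law_singleton)
      then show "AE x in limit_law. x \<noteq> z"
        by (subst (asm) limit.prob_eq_0) auto
    qed
    then have "AE x in limit_law. \<not> \<not> isCont penalty x" by eventually_elim blast
    from emeasure_eq_0_AE[OF this] show ?thesis by simp
  qed
  then have "((\<lambda>u. integral\<^sup>L (cond_deficit_law u) penalty) \<longlongrightarrow> integral\<^sup>L limit_law penalty) at_top"
    by (intro integral_cond_deficit_law_tendsto[where B = 1]) (auto simp: penalty_bounds)
  then show ?thesis
  proof (rule Lim_transform_eventually)
    show "\<forall>\<^sub>F u in at_top. integral\<^sup>L (cond_deficit_law u) penalty = \<psi> u / mixed_fall u 0"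
      using mixed_fall_pos eventually_ge_at_top[of 0]
    proof eventually_elim
      case (elim u)
      have m: "penalty \<in> borel_measurable (deficit_law M c N X u)"
        unfolding measurable_cong_sets[OF sets_deficit_law[OF premium elim(2)] refl]
        by (rule penalty_measurable)
      have "integral\<^sup>L (cond_deficit_law u) penalty =
          (LINT y|deficit_law M c N X u. (1 / mixed_fall u 0) *\<^sub>R penalty y)"
        unfolding cond_deficit_law_def using elim m by (subst integral_density[symmetric]) auto
      then show ?case using psi_eq[OF elim(2)] by simp
    qed
  qed
qed

text \<open>A zero integral makes \<open>\<psi>\<close> vanish almost everywhere for the limiting
  law, and this law charges every interval of deficits on which \<open>F\<close> is below 1. Zeros
  are therefore dense there, and continuity or monotonicity extends them to every point.\<close>

lemma penalty_zero:
  assumes C: "(LINT y|limit_law. penalty y) = 0" and y: "0 < y" "F y < 1"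
  shows "\<psi> (- y) = 0"
proof -
  have "integrable limit_law penalty"
    by (rule limit.integrable_const_bound[where B = 1]) (auto simp: penalty_bounds)
  then have ae: "AE x in limit_law. penalty x = 0"
    using C penalty_bounds by (subst (asm) integral_nonneg_eq_0_iff_AE) auto
  have zero: "\<exists>z. - x' < z \<and> z \<le> - x \<and> \<psi> z = 0" if x: "0 < x" "x < x'" "F x' < 1" for x x'
  proof (rule ccontr)
    assume "\<not> ?thesis"
    then have "AE z in limit_law. z \<notin> {- x'<..- x}"
      using ae by (auto elim!: eventually_mono simp: penalty_def x less_le_trans[of _ "- x" 0])
        (use x in \<open>auto simp: indicator_def split: if_splits\<close>)
    then have "measure limit_law {- x'<..- x} = 0" by (subst limit.prob_eq_0) auto
    moreover have "measure limit_law ({..- x} - {..- x'}) = limit_tail x - limit_tail x'"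
      using x by (subst limit.finite_measure_Diff)
        (auto simp: limit_law_atMost limit_cdf_def max_def)
    moreover have "{..- x} - {..- x'} = {- x'<..- x}" by auto
    ultimately show False using limit_tail_strict_antimono[of x x'] x by simp
  qed
  obtain e where e: "e > 0" "\<And>z. z < y + e \<Longrightarrow> F z < 1" using F_right_cont[OF y(2)] by blast
  show ?thesis
  proof (rule ccontr)
    assume "\<psi> (- y) \<noteq> 0"
    then have pos: "0 < \<psi> (- y)" using psi_bounds(1)[of "- y"] by simp
    from regular show False
    proof (elim disjE)
      assume "continuous_on {..<0} \<psi>"
      then have "isCont \<psi> (- y)" using y by (auto simp: continuous_on_eq_continuous_at)
      then have "(\<psi> \<longlongrightarrow> \<psi> (- y)) (nhds (- y))" by (simp add: continuous_at_imp_continuous_at_within isCont_def tendsto_at_iff_tendsto_nhds)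
      from order_tendstoD(1)[OF this pos] obtain d where d: "d > 0" "\<And>z. dist z (- y) < d \<Longrightarrow> 0 < \<psi> z"
        by (auto simp: eventually_nhds_metric)
      define x' where "x' = y + min d e / 2"
      have "y < x'" "x' < y + e" "x' < y + d" using d(1) e(1) by (auto simp: x'_def)
      with zero[OF y(1), of x'] e(2)[of x'] obtain z where "- x' < z" "z \<le> - y" "\<psi> z = 0" by auto
      then show False using d(2)[of z] \<open>x' < y + d\<close> by (auto simp: dist_real_def)
    next
      \<comment> \<open>An increasing function is bounded at \<open>- y\<close> by a zero to the
        right, a decreasing one by a zero to the left; the latter takes the room beyond
        \<open>y\<close> provided by \<open>e\<close>.\<close>
      assume mono: "mono_on {..<0} \<psi>"
      from zero[of "y / 2" y] y obtain z where "- y < z" "z \<le> - (y / 2)" "\<psi> z = 0" by auto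
      then show False using mono_onD[OF mono, of "- y" z] pos y by auto
    next
      assume anti: "antimono_on {..<0} \<psi>"
      from zero[of y "y + e / 2"] y e obtain z where "z \<le> - y" "\<psi> z = 0" by auto
      then show False using monotone_onD[OF anti, of z "- y"] pos y by auto
    qed
  qed
qed

text \<open>The value at \<open>u\<close> is an integral against the deficit law at that very
  \<open>u\<close>, not against the limit; \<open>deficit_law_null\<close> ensures that the zeros
  just found cover it up to a null set.\<close>

lemma psi_zero:
  assumes C: "(LINT y|limit_law. penalty y) = 0" and u: "0 \<le> u"
  shows "\<psi> u = 0"
proof -
  have sets: "sets (deficit_law M c N X u) = sets borel" by (rule sets_deficit_law[OF premium u])
  have sp: "space (deficit_law M c N X u) = UNIV" using sets_eq_imp_space_eq[OF sets] by simp
  have "{a. F (- a) = 1} \<in> sets borel"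
  proof -
    have "{a \<in> space borel. F (- a) = 1} \<in> sets borel" by measurable
    then show ?thesis by simp
  qed
  then have "AE a in deficit_law M c N X u. F (- a) \<noteq> 1"
    using deficit_law_null[OF u] sets sp by (intro AE_I[where N = "{a. F (- a) = 1}"]) auto
  then have "AE a in deficit_law M c N X u. penalty a = 0"
  proof eventually_elim
    case (elim a)
    then have "F (- a) < 1" using F_bounds[of "- a"] by simp
    then show ?case using penalty_zero[OF C, of "- a"] by (auto simp: penalty_def indicator_def)
  qed
  then have "(LINT y|deficit_law M c N X u. penalty y) = 0" by (rule integral_eq_zero_AE)
  then show ?thesis using psi_eq[OF u] by simp
qed

text \<open>For a nonzero constant this is \<open>ratio_tendsto\<close>. For a zero constant both
  sides have to vanish eventually, which is what \<open>psi_zero\<close> gives.\<close>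

lemma psi_asymp_equiv:
  assumes \<nu>: "limit_deficit_measure c \<mu> F l1 R1 \<nu>"
  shows "\<psi> \<sim>[at_top] (\<lambda>u. (LINT y|\<nu>. \<psi> y) * mixed_fall u 0)"
proof -
  define C where "C = (LINT y|limit_law. penalty y)"
  have "sets \<nu> = sets (restrict_space borel {..<0})" using \<nu> by (simp add: limit_deficit_measure_iff)
  then have sp: "space \<nu> = {..<0}" by (auto dest: sets_eq_imp_space_eq simp: space_restrict_space)
  have "C = (LINT y|distr \<nu> borel (\<lambda>x. x). penalty y)"
    by (simp add: C_def limit_deficit_measure_distr(2)[OF \<nu>])
  also have "\<dots> = (LINT y|\<nu>. penalty y)"
    by (rule integral_distr[OF limit_deficit_measure_distr(1)[OF \<nu>]]) simp
  also have "\<dots> = (LINT y|\<nu>. \<psi> y)"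
    by (rule Bochner_Integration.integral_cong) (auto simp: sp penalty_def)
  finally have C: "(LINT y|\<nu>. \<psi> y) = C" ..
  show ?thesis
    unfolding C
  proof (cases "C = 0")
    case True
    show "\<psi> \<sim>[at_top] (\<lambda>u. C * mixed_fall u 0)"
      by (rule asymp_equiv_refl_ev)
        (use eventually_ge_at_top[of 0] in \<open>eventually_elim,
          use psi_zero True in \<open>simp add: C_def\<close>\<close>)
  next
    case False
    have "((\<lambda>u. (\<psi> u / mixed_fall u 0) / C) \<longlongrightarrow> C / C) at_top"
      unfolding C_def using False by (intro tendsto_intros ratio_tendsto) (simp add: C_def)
    then show "\<psi> \<sim>[at_top] (\<lambda>u. C * mixed_fall u 0)"
      using False by (intro asymp_equivI') (simp add: mult.commute)
  qed
qed

end

end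

section \<open>Reduction of the stated hypotheses to the working form\<close>

theorem theorem4p2:
  fixes M :: "'a measure" and \<Lambda> :: "'a \<Rightarrow> real"
    and N :: "real \<Rightarrow> 'a \<Rightarrow> nat" and X :: "nat \<Rightarrow> 'a \<Rightarrow> real"
    and Q :: "real \<Rightarrow> 'b measure"
    and K :: "real \<Rightarrow> real \<Rightarrow> 'b \<Rightarrow> nat" and Y :: "real \<Rightarrow> nat \<Rightarrow> 'b \<Rightarrow> real"
    and F :: "real \<Rightarrow> real" and G :: "real measure"
    and c \<mu> l1 c1 R1 :: real and \<psi> :: "real \<Rightarrow> real"
  assumes premium: "c > 0"
    and model: "mixed_poisson_model M \<Lambda> F N X"
    and mean: "integrable M (X 0)" "\<mu> = prob_space.expectation M (X 0)"
    and mixing_law: "G = distr M borel \<Lambda>"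
    and conditional: "\<And>l. l \<ge> 0 \<Longrightarrow> poisson_model (Q l) l F (K l) (Y l)"
    and modified: "modified_ruin_probability M c N X \<psi>"
    and l1: "ereal l1 = Inf (ereal ` {l. l \<ge> 0 \<and> cdf G l = 1})"
    and l1_bounds: "0 < l1" "l1 < c / \<mu>"
    and atom: "measure G {l1} > 0"
    and constants: "c1 > 0" "R1 > 0"
    and cramer: "(\<lambda>u. psi_cl_given Q K Y c \<mu> u l1) \<sim>[at_top] (\<lambda>u. c1 * exp (- R1 * u))"
    and lundberg: "\<And>l. l \<in> {0<..<l1} \<Longrightarrow>
          \<exists>R>R1. \<forall>u\<ge>0. psi_cl_given Q K Y c \<mu> u l \<le> exp (- R * u)"
    and regular: "continuous_on {..<0} \<psi> \<or> mono_on {..<0} \<psi> \<or> antimono_on {..<0} \<psi>"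
  shows "(\<exists>!\<nu>. limit_deficit_measure c \<mu> F l1 R1 \<nu>) \<and>
    (\<forall>\<nu>. limit_deficit_measure c \<mu> F l1 R1 \<nu> \<longrightarrow>
       \<psi> \<sim>[at_top] (\<lambda>u. (LINT y|\<nu>. \<psi> y) * psi_cl Q K Y c \<mu> G u))"
proof -
  interpret mixture_model M G F N X
    unfolding mixing_law by (rule mixture_model_mixed_poisson[OF model])
  have pure: "pure_model (Q l) l F (K l) (Y l)" if "0 \<le> l" for l
    using pure_model_poisson[OF conditional[OF that] that] .
  have int: "integrable (interval_measure F) (\<lambda>x. x)"
    unfolding distr_X[of 0, symmetric] using mean(1) by (simp add: integrable_distr_eq)
  have \<mu>: "\<mu> = (LINT x|interval_measure F. x)"
    unfolding distr_X[of 0, symmetric] mean(2) by (simp add: integral_distr)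
  have "0 \<le> \<mu>" unfolding \<mu> using claim_pos by (intro integral_nonneg_AE) (auto elim!: eventually_mono)
  \<comment> \<open>Division by 0 yields 0, so a zero mean would contradict \<open>0 < l1\<close>
    and \<open>l1 < c / \<mu>\<close>.\<close>
  moreover have "\<mu> \<noteq> 0" using l1_bounds by auto
  ultimately have \<mu>_pos: "0 < \<mu>" by simp
  have load: "l1 * \<mu> < c" using l1_bounds(2) \<mu>_pos by (simp add: pos_less_divide_eq)
  interpret GD: real_distribution G
    by (intro real_distribution.intro real_distribution_axioms.intro mix.prob_space_axioms sets_G)
  have support: "AE l in G. l \<le> l1"
  proof -
    have one: "cdf G l = 1" if "l1 < l" for l
    proof -
      have "Inf (ereal ` {l. l \<ge> 0 \<and> cdf G l = 1}) < ereal l" using that by (simp add: l1[symmetric])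
      then obtain l' where "l' < l" "cdf G l' = 1" by (auto simp: Inf_less_iff)
      then show ?thesis using GD.cdf_nondecreasing[of l' l] GD.cdf_bounded_prob[of l] by simp
    qed
    \<comment> \<open>Above the infimum the distribution function is 1; right continuity carries
      this value to \<open>l1\<close> itself.\<close>
    have "(cdf G \<longlongrightarrow> cdf G l1) (at_right l1)"
      using GD.cdf_is_right_cont[of l1] by (simp add: continuous_within)
    moreover have "(cdf G \<longlongrightarrow> 1) (at_right l1)"
      by (rule tendsto_eventually) (auto simp: eventually_at_right_field one intro!: exI[of _ "l1 + 1"])
    ultimately have "cdf G l1 = 1" by (rule tendsto_unique[rotated]) simp
    then have "AE l in G. l \<in> {..l1}" unfolding cdf_def by (subst mix.prob_eq_1[symmetric]) auto
    then show ?thesis by eventually_elim simp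
  qed
  \<comment> \<open>For rates up to \<open>l1\<close> the safety loading is positive, so the
    convention for \<open>l * \<mu> \<ge> c\<close> never applies.\<close>
  have given: "psi_cl_given Q K Y c \<mu> u l = measure (Q l) (fall_event (Q l) c (K l) (Y l) u 0)"
    if "0 \<le> l" "l \<le> l1" "0 \<le> u" for l u
  proof -
    interpret P: pure_model "Q l" l F "K l" "Y l" by (rule pure[OF that(1)])
    have "l * \<mu> \<le> l1 * \<mu>" using that \<mu>_pos by (intro mult_right_mono) auto
    then show ?thesis using load P.ruin_event_eq[OF premium that(3)] by (simp add: psi_cl_given_def)
  qed
  interpret R: mixed_ruin M G F N X Q K Y c \<mu> l1 c1 R1
  proof (intro mixed_ruin.intro mixed_ruin_axioms.intro mixture_model_axioms)
    have "((\<lambda>u. psi_cl_given Q K Y c \<mu> u l1 / (c1 * exp (- R1 * u))) \<longlongrightarrow> 1) at_top"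
      by (rule asymp_equivD_strong[OF cramer]) (use constants in simp)
    then have "((\<lambda>u. c1 * (psi_cl_given Q K Y c \<mu> u l1 / (c1 * exp (- R1 * u)))) \<longlongrightarrow> c1 * 1) at_top"
      by (intro tendsto_intros)
    then have "((\<lambda>u. c1 * (psi_cl_given Q K Y c \<mu> u l1 / (c1 * exp (- R1 * u)))) \<longlongrightarrow> c1) at_top" by simp
    then show "((\<lambda>u. exp (R1 * u) * measure (Q l1) (fall_event (Q l1) c (K l1) (Y l1) u 0)) \<longlongrightarrow> c1) at_top"
    proof (rule Lim_transform_eventually)
      show "\<forall>\<^sub>F u in at_top. c1 * (psi_cl_given Q K Y c \<mu> u l1 / (c1 * exp (- R1 * u))) =
          exp (R1 * u) * measure (Q l1) (fall_event (Q l1) c (K l1) (Y l1) u 0)"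
        using eventually_ge_at_top[of 0]
        by eventually_elim (use constants l1_bounds in \<open>simp add: given exp_minus field_simps\<close>)
    qed
    show "\<exists>R>R1. \<forall>u\<ge>0. measure (Q l) (fall_event (Q l) c (K l) (Y l) u 0) \<le> exp (- R * u)"
      if "0 < l" "l < l1" for l
      using lundberg[of l] that given[of l] by auto
  qed (rule premium pure int \<mu> support l1_bounds(1) load atom constants | assumption)+
  have psi_cl: "psi_cl Q K Y c \<mu> G u = R.mixed_fall u 0" if u: "0 \<le> u" for u
  proof -
    note [measurable] = R.mixed_fall_eq(1)[OF order_refl, of u]
    have "psi_cl Q K Y c \<mu> G u = (LINT l|G. indicator {0..} l * R.given_fall l u 0)"
      unfolding psi_cl_def set_lebesgue_integral_def
    proof (rule integral_cong_AE)
      \<comment> \<open>Measurability concerns all rates, including the null set above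
        \<open>l1\<close> where the convention may set the value to 1; hence the case
        distinction.\<close>
      have eq: "indicat_real {0..} l *\<^sub>R psi_cl_given Q K Y c \<mu> u l =
          (if l * \<mu> \<ge> c then indicator {0..} l else indicator {0..} l * R.given_fall l u 0)" for l
        using pure_model.axioms(1)[OF pure, of l, THEN mixture_model.ruin_event_eq[OF _ premium u]]
        by (cases "0 \<le> l") (auto simp: psi_cl_given_def R.given_fall_def)
      have "(\<lambda>l. if l * \<mu> \<ge> c then indicator {0..} l else indicator {0..} l * R.given_fall l u 0)
          \<in> borel_measurable borel" by measurable
      then show "(\<lambda>l. indicat_real {0..} l *\<^sub>R psi_cl_given Q K Y c \<mu> u l) \<in> borel_measurable G"
        unfolding eq measurable_cong_sets[OF sets_G refl] .
      show "(\<lambda>l. indicator {0..} l * R.given_fall l u 0) \<in> borel_measurable G"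
        unfolding measurable_cong_sets[OF sets_G refl] by measurable
      show "AE l in G. indicat_real {0..} l *\<^sub>R psi_cl_given Q K Y c \<mu> u l =
          indicator {0..} l * R.given_fall l u 0"
        using support nonneg_G by eventually_elim (simp add: given u R.given_fall_def)
    qed
    then show ?thesis by (simp add: R.mixed_fall_eq(2)[OF order_refl])
  qed
  show ?thesis
  proof (intro conjI allI impI R.ex1_limit_deficit_measure)
    fix \<nu> assume "limit_deficit_measure c \<mu> F l1 R1 \<nu>"
    from R.psi_asymp_equiv[OF modified regular this]
    have *: "\<psi> \<sim>[at_top] (\<lambda>u. (LINT y|\<nu>. \<psi> y) * R.mixed_fall u 0)" .
    have "\<forall>\<^sub>F u in at_top. (LINT y|\<nu>. \<psi> y) * R.mixed_fall u 0 = (LINT y|\<nu>. \<psi> y) * psi_cl Q K Y c \<mu> G u"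
      using eventually_ge_at_top[of 0] by eventually_elim (simp add: psi_cl)
    from asymp_equiv_cong[OF eventually_mono[OF eventually_True] this] *
    show "\<psi> \<sim>[at_top] (\<lambda>u. (LINT y|\<nu>. \<psi> y) * psi_cl Q K Y c \<mu> G u)"
      by blast
  qed
qed

end
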